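(* Let $\mathbb{L}$ be a field and let $K$ be a finitely generated abelian group. For $t\in\mathrm{Tor}(K)$ put $F_t:=\mathbb{L}^\times/(\mathbb{L}^\times)^{[o(t)]}$, and let $F_K:=\prod_{t\in\mathrm{Tor}(K)}F_t$. Let $\beta:K\times K\to\mathbb{L}^\times$ be any alternating bicharacter and let $\mu\in F_K$ (regarded as a function $t\mapsto\mu(t)\in F_t$ on $\mathrm{Tor}(K)$) be any element satisfying the following conditions for $g,h\in\mathrm{Tor}(K)$: (A) if $n$ is a positive divisor of $o(g)$, then $\mu(g^n)$ is the image of $\mu(g)\in\mathbb{L}^\times/(\mathbb{L}^\times)^{[o(g)]}$ in $\mathbb{L}^\times/(\mathbb{L}^\times)^{[o(g)/n]}$; (B) if $\gcd(o(g),o(h))=1$, then $\mu(gh)=\mu(g)^{o(h)}\mu(h)^{o(g)}$ (a well-defined element of $\mathbb{L}^\times/(\mathbb{L}^\times)^{[o(gh)]}$); (C) if $p$ is a prime and $o(g)=p^k>o(h)=p^\ell$, then $\mu(gh)=\mu(g)\mu(h)^{p^{k-\ell}}$; (D) if $p$ is a prime, $k\ge 1$ and $o(g)=o(h)=o(gh)=p^k$, then $\mu(gh)=\mu(g)\mu(h)$ if $p$ is odd, and $\mu(gh)=\beta(g,h)^{2^{k-1}}\mu(g)\mu(h)$ if $p=2$. Then there is a unique, up to isomorphism of graded algebras, graded-division algebra $\mathcal{D}(K,\beta,\mu)=\bigoplus_{t\in K}\mathcal{D}_t$ over $\mathbb{L}$ such that: (i) $\dim\mathcal{D}_t=1$ for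 all $t\in K$; (ii) $xy=\beta(s,t)yx$ for all $x\in\mathcal{D}_s$, $y\in\mathcal{D}_t$, $s,t\in K$; (iii) $x^{o(t)}\in\mu(t)$ for all $0\neq x\in\mathcal{D}_t$, $t\in\mathrm{Tor}(K)$. Every graded-division algebra $\mathcal{C}=\bigoplus_{t\in K}\mathcal{C}_t$ over $\mathbb{L}$ with $\dim\mathcal{C}_t=1$ for all $t\in K$ is isomorphic, as a graded algebra, to one, and only one, of the graded-division algebras $\mathcal{D}(K,\beta,\mu)$.
   Context: Algebras are associative. A $K$-grading on an algebra is a decomposition $\mathcal{D}=\bigoplus_{t\in K}\mathcal{D}_t$ with $\mathcal{D}_s\mathcal{D}_t\subset\mathcal{D}_{st}$; isomorphisms of graded algebras preserve degrees. A graded-division algebra is a unital graded algebra in which every nonzero homogeneous element is invertible; when all components are $1$-dimensional, $\mathcal{D}_e=\mathbb{L}1$ is identified with $\mathbb{L}$. For an abelian group $A$ (written multiplicatively): $A^{[n]}=\{a^n\mid a\in A\}$, $\mathrm{Tor}(A)$ is the torsion subgroup, and $o(a)$ is the order of $a\in A$. An alternating bicharacter is a map $\beta:K\times K\to\mathbb{L}^\times$ multiplicative in each variable with $\beta(t,t)=1$ for all $t$. In (iii), the coset $\mu(t)\in\mathbb{L}^\times/(\mathbb{L}^\times)^{[o(t)]}$ is regarded as a subset of $\mathbb{L}^\times=\mathcal{D}_e^\times$. In (D), the element $\beta(g,h)^{2^{k-1}}\in\{\pm1\}$ acts by multiplication on cosets. *)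

theory Defs
  imports
    "HOL-Computational_Algebra.Primes"
    "HOL-Algebra.Multiplicative_Group"
    "HOL-Algebra.Generated_Groups"
    "HOL-Algebra.QuotRing"
    "Jordan_Normal_Form.Missing_VectorSpace"
begin

definition finitely_generated :: "('k, 'n) monoid_scheme \<Rightarrow> bool" where
  "finitely_generated K \<longleftrightarrow> (\<exists>S. finite S \<and> S \<subseteq> carrier K \<and> generate K S = carrier K)"

definition Tor :: "('k, 'n) monoid_scheme \<Rightarrow> 'k set" where
  "Tor K = {t \<in> carrier K. \<exists>n::nat. n > 0 \<and> t [^]\<^bsub>K\<^esub> n = \<one>\<^bsub>K\<^esub>}"

text \<open>
  For \<open>S = carrier G\<close> this is $G^{[n]}$. It also gives the power of a coset: in an abelian group,
  if \<open>S\<close> is the coset $a G^{[m]}$, then \<open>powers G S n\<close> is the coset $a^n G^{[mn]}$. So the $n$-th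
  power of an element of $G/G^{[m]}$ is taken in $G/G^{[mn]}$.
\<close>
definition powers :: "('g, 'n) monoid_scheme \<Rightarrow> 'g set \<Rightarrow> nat \<Rightarrow> 'g set" where
  "powers G S n = {a [^]\<^bsub>G\<^esub> n | a. a \<in> S}"

definition power_quotient :: "('l, 'm) ring_scheme \<Rightarrow> nat \<Rightarrow> 'l set monoid" where
  "power_quotient L n = mult_of L Mod powers (mult_of L) (carrier (mult_of L)) n"

text \<open>
  The canonical map $L^\times/(L^\times)^{[n]} \to L^\times/(L^\times)^{[m]}$ for $m$ dividing $n$:
  multiplying $a(L^\times)^{[n]}$ by the larger subgroup $(L^\times)^{[m]}$ gives $a(L^\times)^{[m]}$.
\<close>
definition quotient_image :: "('l, 'm) ring_scheme \<Rightarrow> nat \<Rightarrow> 'l set \<Rightarrow> 'l set" where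
  "quotient_image L m S = powers (mult_of L) (carrier (mult_of L)) m <#>\<^bsub>mult_of L\<^esub> S"

abbreviation F :: "('l, 'm) ring_scheme \<Rightarrow> ('k, 'n) monoid_scheme \<Rightarrow> 'k \<Rightarrow> 'l set monoid" where
  "F L K t \<equiv> power_quotient L (group.ord K t)"

text \<open>
  Bicharacters and elements of the product of the \<open>F L K t\<close> are extensional functions, so that
  equality in HOL is equality of the mathematical objects.
\<close>
definition alternating_bicharacter ::
  "('l, 'm) ring_scheme \<Rightarrow> ('k, 'n) monoid_scheme \<Rightarrow> ('k \<times> 'k \<Rightarrow> 'l) \<Rightarrow> bool" where
  "alternating_bicharacter L K \<beta> \<longleftrightarrow>
     \<beta> \<in> carrier K \<times> carrier K \<rightarrow>\<^sub>E carrier (mult_of L) \<and>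
     (\<forall>s\<in>carrier K. \<forall>t\<in>carrier K. \<forall>u\<in>carrier K.
        \<beta> (s \<otimes>\<^bsub>K\<^esub> t, u) = \<beta> (s, u) \<otimes>\<^bsub>L\<^esub> \<beta> (t, u) \<and>
        \<beta> (u, s \<otimes>\<^bsub>K\<^esub> t) = \<beta> (u, s) \<otimes>\<^bsub>L\<^esub> \<beta> (u, t)) \<and>
     (\<forall>t\<in>carrier K. \<beta> (t, t) = \<one>\<^bsub>L\<^esub>)"

definition F_K :: "('l, 'm) ring_scheme \<Rightarrow> ('k, 'n) monoid_scheme \<Rightarrow> ('k \<Rightarrow> 'l set) set" where
  "F_K L K = (\<Pi>\<^sub>E t\<in>Tor K. carrier (F L K t))"

definition cond_A ::
  "('l, 'm) ring_scheme \<Rightarrow> ('k, 'n) monoid_scheme \<Rightarrow> ('k \<Rightarrow> 'l set) \<Rightarrow> bool" where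
  "cond_A L K \<mu> \<longleftrightarrow>
     (\<forall>g\<in>Tor K. \<forall>n. n > 0 \<and> n dvd group.ord K g \<longrightarrow>
        \<mu> (g [^]\<^bsub>K\<^esub> n) = quotient_image L (group.ord K g div n) (\<mu> g))"

definition cond_B ::
  "('l, 'm) ring_scheme \<Rightarrow> ('k, 'n) monoid_scheme \<Rightarrow> ('k \<Rightarrow> 'l set) \<Rightarrow> bool" where
  "cond_B L K \<mu> \<longleftrightarrow>
     (\<forall>g\<in>Tor K. \<forall>h\<in>Tor K. gcd (group.ord K g) (group.ord K h) = 1 \<longrightarrow>
        \<mu> (g \<otimes>\<^bsub>K\<^esub> h) =
          powers (mult_of L) (\<mu> g) (group.ord K h)
            \<otimes>\<^bsub>F L K (g \<otimes>\<^bsub>K\<^esub> h)\<^esub>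
          powers (mult_of L) (\<mu> h) (group.ord K g))"

definition cond_C ::
  "('l, 'm) ring_scheme \<Rightarrow> ('k, 'n) monoid_scheme \<Rightarrow> ('k \<Rightarrow> 'l set) \<Rightarrow> bool" where
  "cond_C L K \<mu> \<longleftrightarrow>
     (\<forall>g\<in>Tor K. \<forall>h\<in>Tor K. \<forall>p k l.
        prime (p::nat) \<and> group.ord K g = p ^ k \<and> group.ord K h = p ^ l \<and>
        p ^ k > p ^ l \<longrightarrow>
        \<mu> (g \<otimes>\<^bsub>K\<^esub> h) =
          \<mu> g \<otimes>\<^bsub>F L K (g \<otimes>\<^bsub>K\<^esub> h)\<^esub> powers (mult_of L) (\<mu> h) (p ^ (k - l)))"

definition cond_D ::
  "('l, 'm) ring_scheme \<Rightarrow> ('k, 'n) monoid_scheme \<Rightarrow>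
     ('k \<times> 'k \<Rightarrow> 'l) \<Rightarrow> ('k \<Rightarrow> 'l set) \<Rightarrow> bool" where
  "cond_D L K \<beta> \<mu> \<longleftrightarrow>
     (\<forall>g\<in>Tor K. \<forall>h\<in>Tor K. \<forall>p k.
        prime (p::nat) \<and> k \<ge> 1 \<and> group.ord K g = p ^ k \<and>
        group.ord K h = p ^ k \<and> group.ord K (g \<otimes>\<^bsub>K\<^esub> h) = p ^ k \<longrightarrow>
        (odd p \<longrightarrow> \<mu> (g \<otimes>\<^bsub>K\<^esub> h) = \<mu> g \<otimes>\<^bsub>F L K (g \<otimes>\<^bsub>K\<^esub> h)\<^esub> \<mu> h) \<and>
        (p = 2 \<longrightarrow> \<mu> (g \<otimes>\<^bsub>K\<^esub> h) =
           (\<beta> (g, h) [^]\<^bsub>mult_of L\<^esub> ((2::nat) ^ (k - 1)))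
             <#\<^bsub>mult_of L\<^esub> (\<mu> g \<otimes>\<^bsub>F L K (g \<otimes>\<^bsub>K\<^esub> h)\<^esub> \<mu> h)))"

definition admissible ::
  "('l, 'm) ring_scheme \<Rightarrow> ('k, 'n) monoid_scheme \<Rightarrow>
     ('k \<times> 'k \<Rightarrow> 'l) \<Rightarrow> ('k \<Rightarrow> 'l set) \<Rightarrow> bool" where
  "admissible L K \<beta> \<mu> \<longleftrightarrow>
     alternating_bicharacter L K \<beta> \<and> \<mu> \<in> F_K L K \<and>
     cond_A L K \<mu> \<and> cond_B L K \<mu> \<and> cond_C L K \<mu> \<and> cond_D L K \<beta> \<mu>"

text \<open>The locale \<open>algebra\<close> of HOL-Algebra is for commutative algebras only.\<close>
locale unital_assoc_algebra = vectorspace L A + alg: ring A for L and A (structure) +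
  assumes smult_mult_left:
      "\<lbrakk>a \<in> carrier L; x \<in> carrier A; y \<in> carrier A\<rbrakk> \<Longrightarrow> (a \<odot> x) \<otimes> y = a \<odot> (x \<otimes> y)"
    and smult_mult_right:
      "\<lbrakk>a \<in> carrier L; x \<in> carrier A; y \<in> carrier A\<rbrakk> \<Longrightarrow> x \<otimes> (a \<odot> y) = a \<odot> (x \<otimes> y)"

text \<open>
  In \<open>direct_sum\<close>, \<open>f\<close> is the family of homogeneous components of \<open>x\<close>. Values of \<open>D\<close> outside
  \<open>carrier K\<close> play no role.
\<close>
locale graded_algebra = unital_assoc_algebra L A + grp: group K
  for L and K and A (structure) and D +
  assumes component_subspace: "t \<in> carrier K \<Longrightarrow> VectorSpace.subspace L (D t) A"
    and direct_sum: "x \<in> carrier A \<Longrightarrow>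
      \<exists>!f. f \<in> (\<Pi>\<^sub>E t\<in>carrier K. D t) \<and> finite {t \<in> carrier K. f t \<noteq> \<zero>} \<and>
           x = (\<Oplus>t\<in>{t \<in> carrier K. f t \<noteq> \<zero>}. f t)"
    and component_mult: "\<lbrakk>s \<in> carrier K; t \<in> carrier K; x \<in> D s; y \<in> D t\<rbrakk> \<Longrightarrow>
      x \<otimes> y \<in> D (s \<otimes>\<^bsub>K\<^esub> t)"

locale graded_division_algebra = graded_algebra L K A D for L and K and A (structure) and D +
  assumes homogeneous_invertible:
    "\<lbrakk>t \<in> carrier K; x \<in> D t; x \<noteq> \<zero>\<rbrakk> \<Longrightarrow> x \<in> Units A"

definition graded_isomorphic ::
  "('l, 'm) ring_scheme \<Rightarrow> ('k, 'n) monoid_scheme \<Rightarrow>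
     ('l, 'a) module \<Rightarrow> ('k \<Rightarrow> 'a set) \<Rightarrow> ('l, 'b) module \<Rightarrow> ('k \<Rightarrow> 'b set) \<Rightarrow> bool" where
  "graded_isomorphic L K A D B E \<longleftrightarrow>
     (\<exists>\<phi>. \<phi> \<in> ring_iso A B \<and>
        (\<forall>a\<in>carrier L. \<forall>x\<in>carrier A. \<phi> (a \<odot>\<^bsub>A\<^esub> x) = a \<odot>\<^bsub>B\<^esub> \<phi> x) \<and>
        (\<forall>t\<in>carrier K. \<phi> ` D t = E t))"

text \<open>\<open>vectorspace.dim\<close> is unspecified on infinite-dimensional spaces, hence \<open>fin_dim\<close>.\<close>
definition one_dim_components ::
  "('l, 'm) ring_scheme \<Rightarrow> ('k, 'n) monoid_scheme \<Rightarrow>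
     ('l, 'a) module \<Rightarrow> ('k \<Rightarrow> 'a set) \<Rightarrow> bool" where
  "one_dim_components L K A D \<longleftrightarrow>
     (\<forall>t\<in>carrier K. vectorspace.fin_dim L (A\<lparr>carrier := D t\<rparr>) \<and>
                     vectorspace.dim L (A\<lparr>carrier := D t\<rparr>) = 1)"

text \<open>
  The graded algebra $\mathcal{D}(K,\beta,\mu)$ is determined up to isomorphism only, so it is
  described by a predicate. In the last clause, a scalar \<open>a\<close> is identified with \<open>a \<odot> \<one>\<close>.
\<close>
definition is_D ::
  "('l, 'm) ring_scheme \<Rightarrow> ('k, 'n) monoid_scheme \<Rightarrow> ('k \<times> 'k \<Rightarrow> 'l) \<Rightarrow> ('k \<Rightarrow> 'l set) \<Rightarrow>
     ('l, 'a) module \<Rightarrow> ('k \<Rightarrow> 'a set) \<Rightarrow> bool" where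
  "is_D L K \<beta> \<mu> A D \<longleftrightarrow>
     graded_division_algebra L K A D \<and>
     one_dim_components L K A D \<and>
     (\<forall>s\<in>carrier K. \<forall>t\<in>carrier K. \<forall>x\<in>D s. \<forall>y\<in>D t.
        x \<otimes>\<^bsub>A\<^esub> y = \<beta> (s, t) \<odot>\<^bsub>A\<^esub> (y \<otimes>\<^bsub>A\<^esub> x)) \<and>
     (\<forall>t\<in>Tor K. \<forall>x\<in>D t. x \<noteq> \<zero>\<^bsub>A\<^esub> \<longrightarrow>
        x [^]\<^bsub>A\<^esub> group.ord K t \<in> {a \<odot>\<^bsub>A\<^esub> \<one>\<^bsub>A\<^esub> | a. a \<in> \<mu> t})"

end

theory Submission
  imports Defs
begin

text \<open>
  Nonzero homogeneous elements \<open>X\<^sub>t\<close> with \<open>X\<^sub>1 = 1\<close> turn a graded-division algebra with one-dimensional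
  components into a normalized 2-cocycle \<open>\<alpha>\<close> on \<open>K\<close> with values in the units of \<open>L\<close>, and twisted group
  algebras invert this. The commutation factors of \<open>\<alpha>\<close> form an alternating bicharacter, and
  \<open>(xy)\<^sup>n = \<beta>(h, g)\<^bsup>n choose 2\<^esup> x\<^sup>n y\<^sup>n\<close> for \<open>x\<close>, \<open>y\<close> of degrees \<open>g\<close>, \<open>h\<close> yields (A)--(D).

  \<open>K\<close> is built up by finitely many steps \<open>H \<leadsto> H \<times> \<langle>g\<rangle>\<close>. If \<open>\<alpha>\<close> on \<open>H\<close> belongs to \<open>(\<beta>, \<mu>)\<close>, it is extended
  by an element \<open>Y\<close> of degree \<open>g\<close> that commutes according to \<open>\<beta>\<close> and satisfies \<open>Y\<^sup>n = c \<in> \<mu>(g)\<close>,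
  \<open>n\<close> being the order of \<open>g\<close>; by (A)--(D) the values of \<open>\<mu>\<close> on the torsion of \<open>H \<times> \<langle>g\<rangle>\<close> are determined
  by those on \<open>H\<close> and at \<open>g\<close>. If two cocycles belong to the same \<open>(\<beta>, \<mu>)\<close>, their quotient is symmetric,
  so it defines an abelian extension of \<open>K\<close> in which every torsion element has a lift of the same order;
  such an extension splits, again step by step.
\<close>

section \<open>Finitely generated abelian groups\<close>

text \<open>The order cosets of the extended cocycle are never computed. Like those of any cocycle
  they satisfy (A)--(D), and so does \<mu>; the set on which the two families agree is therefore
  closed under the operations in (A)--(D). It contains the torsion of \<open>H\<close> and, if it is
  torsion, \<open>g\<close>, and these operations reach every other torsion element: split it into
  parts of prime power order, and each part into a factor in \<open>H\<close> and a power of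
  \<open>g\<close>. This closure is delicate because (C) and (D) speak only of products with
  prescribed orders. The obstacle in both halves is that a nontrivial power of \<open>g\<close>
  lying in \<open>H\<close> would already prescribe some power of \<open>Y\<close>; hence a direct
  decomposition of \<open>K\<close> comes before any cocycle. The factor in (D) comes from the
  binomial coefficient: \<open>n choose 2\<close> is a multiple of \<open>n\<close> for odd
  \<open>n\<close>, but congruent to \<open>n div 2\<close> modulo \<open>n\<close> for even
  \<open>n\<close>. Up to the graded algebras an arbitrary abelian group \<open>U\<close> replaces
  the units of \<open>L\<close>.\<close>

definition adjoin :: "('k, 'n) monoid_scheme \<Rightarrow> 'k set \<Rightarrow> 'k \<Rightarrow> 'k set" where
  "adjoin K H g = {h \<otimes>\<^bsub>K\<^esub> g [^]\<^bsub>K\<^esub> (i::int) | h i. h \<in> H}"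

lemma adjoinI: "h \<in> H \<Longrightarrow> h \<otimes>\<^bsub>K\<^esub> g [^]\<^bsub>K\<^esub> (i::int) \<in> adjoin K H g"
  unfolding adjoin_def by blast

lemma adjoinE:
  assumes "x \<in> adjoin K H g"
  obtains h i where "h \<in> H" "x = h \<otimes>\<^bsub>K\<^esub> g [^]\<^bsub>K\<^esub> (i::int)"
  using assms unfolding adjoin_def by blast

context comm_group
begin

lemma conj_cancel:
  assumes "a \<in> carrier G" "b \<in> carrier G" "c \<in> carrier G"
  shows "a \<otimes> (b \<otimes> c) \<otimes> inv b = c \<otimes> a"
proof -
  have "a \<otimes> (b \<otimes> c) \<otimes> inv b = (c \<otimes> a) \<otimes> (b \<otimes> inv b)"
    using assms inv_closed[OF assms(2)] by (simp only: m_ac m_closed)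
  then show ?thesis using assms by simp
qed

lemma mult_inv_cancel_right:
  assumes "a \<in> carrier G" "b \<in> carrier G" "c \<in> carrier G"
  shows "(a \<otimes> b) \<otimes> (c \<otimes> inv b) = a \<otimes> c"
proof -
  have "(a \<otimes> b) \<otimes> (c \<otimes> inv b) = (a \<otimes> c) \<otimes> (b \<otimes> inv b)"
    using assms inv_closed[OF assms(2)] by (simp only: m_ac m_closed)
  then show ?thesis using assms by simp
qed

lemma mult_inv_cancel_left:
  assumes "a \<in> carrier G" "b \<in> carrier G" "c \<in> carrier G"
  shows "a \<otimes> c = (a \<otimes> inv b) \<otimes> (c \<otimes> b)"
proof -
  have "(a \<otimes> inv b) \<otimes> (c \<otimes> b) = (a \<otimes> c) \<otimes> (b \<otimes> inv b)"
    using assms inv_closed[OF assms(2)] by (simp only: m_ac m_closed)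
  then show ?thesis using assms by simp
qed

lemma adjoin_mult:
  assumes "a \<in> carrier G" "b \<in> carrier G" "g \<in> carrier G"
  shows "(a \<otimes> g [^] (i::int)) \<otimes> (b \<otimes> g [^] (j::int)) = (a \<otimes> b) \<otimes> g [^] (i + j)"
  using assms by (simp add: int_pow_mult m_ac)

lemma adjoin_inv:
  assumes "a \<in> carrier G" "g \<in> carrier G"
  shows "inv (a \<otimes> g [^] (i::int)) = inv a \<otimes> g [^] (- i)"
  using assms by (simp add: inv_mult int_pow_neg)

lemma adjoin_subgroup:
  assumes "subgroup H G" "g \<in> carrier G"
  shows "subgroup (adjoin G H g) G"
proof -
  interpret H: subgroup H G by fact
  show ?thesis
  proof (rule subgroupI)
    show "adjoin G H g \<subseteq> carrier G" using assms(2) by (auto elim!: adjoinE)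
    show "adjoin G H g \<noteq> {}" using adjoinI[OF H.one_closed] by blast
    show "inv a \<in> adjoin G H g" if "a \<in> adjoin G H g" for a
      using that assms(2) by (auto elim!: adjoinE simp: adjoin_inv intro!: adjoinI)
    show "a \<otimes> b \<in> adjoin G H g" if "a \<in> adjoin G H g" "b \<in> adjoin G H g" for a b
      using that assms(2) by (auto elim!: adjoinE simp: adjoin_mult intro!: adjoinI)
  qed
qed

lemma adjoin_superset:
  assumes "subgroup H G" "g \<in> carrier G"
  shows "H \<subseteq> adjoin G H g" and "g \<in> adjoin G H g"
proof -
  interpret H: subgroup H G by fact
  show "H \<subseteq> adjoin G H g" using adjoinI[of _ H G g 0] by force
  show "g \<in> adjoin G H g" using adjoinI[of \<one> H G g 1] assms(2) by force
qed

lemma adjoin_one: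
  assumes "subgroup H G" shows "adjoin G H \<one> = H"
  using subgroup.mem_carrier[OF assms] unfolding adjoin_def by force

lemma generate_insert:
  assumes "y \<in> carrier G" "S \<subseteq> carrier G"
  shows "generate G (insert y S) = adjoin G (generate G S) y"
proof
  have sub: "subgroup (generate G S) G" using assms generate_is_subgroup by blast
  show "generate G (insert y S) \<subseteq> adjoin G (generate G S) y"
  proof (rule generate_subgroup_incl)
    show "insert y S \<subseteq> adjoin G (generate G S) y"
      using adjoin_superset[OF sub assms(1)] generate.incl[of _ S G] by auto
  qed (rule adjoin_subgroup[OF sub assms(1)])
  have sub': "subgroup (generate G (insert y S)) G" using assms generate_is_subgroup by blast
  show "adjoin G (generate G S) y \<subseteq> generate G (insert y S)"
  proof
    fix x assume "x \<in> adjoin G (generate G S) y"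
    then obtain h i where h: "h \<in> generate G S" "x = h \<otimes> y [^] (i::int)" by (rule adjoinE)
    have "h \<in> generate G (insert y S)" using h(1) mono_generate[of S "insert y S"] by blast
    moreover have "y [^] i \<in> generate G (insert y S)"
      by (rule subgroup_int_pow_closed[OF sub']) (simp add: generate.incl)
    ultimately show "x \<in> generate G (insert y S)" by (simp add: h(2) generate.eng)
  qed
qed

text \<open>Division with remainder by \<open>d\<close> of the exponents of a word in \<open>S\<close>.\<close>
lemma generate_root_or_remainder:
  assumes "finite S" "S \<subseteq> carrier G" "z \<in> generate G S" "d > 0"
  shows "\<exists>w\<in>generate G S. z = w [^] d \<or>
           (\<exists>y\<in>S. \<exists>s v. 0 < s \<and> s < d \<and> v \<in> generate G (S - {y}) \<and>
              z \<otimes> w [^] d = y [^] (s::nat) \<otimes> v)"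
  using assms(1-3)
proof (induction S arbitrary: z rule: finite_induct)
  case empty
  then have "z = \<one>" by (simp add: generate_empty)
  then show ?case by (metis generate.one nat_pow_one)
next
  case (insert y S)
  have y: "y \<in> carrier G" and S: "S \<subseteq> carrier G" using insert.prems by auto
  have subI: "subgroup (generate G (insert y S)) G"
    using insert.prems generate_is_subgroup by blast
  have inclS: "generate G S \<subseteq> generate G (insert y S)" by (rule mono_generate) auto
  have incl_car: "generate G S \<subseteq> carrier G" using S generate_incl by blast
  have ypow: "y [^] (k::int) \<in> generate G (insert y S)" for k
    by (rule subgroup_int_pow_closed[OF subI]) (simp add: generate.incl)
  obtain z' r where z': "z' \<in> generate G S" "z = z' \<otimes> y [^] (r::int)"
    using insert.prems(2) unfolding generate_insert[OF y S] by (rule adjoinE)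
  have z'c: "z' \<in> carrier G" using z' incl_car by blast
  define q where "q = r div int d"
  define s where "s = nat (r mod int d)"
  have r: "r = q * int d + int s" using \<open>d > 0\<close> by (simp add: q_def s_def)
  have sd: "s < d" using \<open>d > 0\<close> by (simp add: s_def nat_less_iff)
  have yr: "y [^] r = (y [^] q) [^] d \<otimes> y [^] s"
    unfolding r using y by (simp add: int_pow_mult int_pow_pow flip: int_pow_int)
  show ?case
  proof (cases "s = 0")
    case False
    have "z \<otimes> (y [^] (- q)) [^] d = y [^] s \<otimes> z'"
      using y z'c conj_cancel[of z' "(y [^] q) [^] d" "y [^] s"]
      by (simp add: z'(2) yr int_pow_neg nat_pow_inv)
    moreover have "z' \<in> generate G (insert y S - {y})" using z'(1) insert.hyps by simp
    ultimately show ?thesis using False sd ypow[of "-q"] by blast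
  next
    case True
    \<comment> \<open>The generator \<open>y\<close> contributes only a \<open>d\<close>-th power,
      so the remaining generators decide which alternative holds.\<close>
    have zeq: "z = z' \<otimes> (y [^] q) [^] d" using z'(2) yr True y z'c by simp
    obtain w where w: "w \<in> generate G S" and alt: "z' = w [^] d \<or>
           (\<exists>y\<in>S. \<exists>s v. 0 < s \<and> s < d \<and> v \<in> generate G (S - {y}) \<and>
              z' \<otimes> w [^] d = y [^] (s::nat) \<otimes> v)"
      using insert.IH[OF S z'(1)] by blast
    have wc: "w \<in> carrier G" using w incl_car by blast
    from alt show ?thesis
    proof
      assume "z' = w [^] d"
      then have "z = (w \<otimes> y [^] q) [^] d" using zeq wc y by (simp add: nat_pow_distrib)
      moreover have "w \<otimes> y [^] q \<in> generate G (insert y S)"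
        by (rule generate.eng) (use w inclS ypow in auto)
      ultimately show ?thesis by blast
    next
      assume "\<exists>y\<in>S. \<exists>s v. 0 < s \<and> s < d \<and> v \<in> generate G (S - {y}) \<and>
              z' \<otimes> w [^] d = y [^] (s::nat) \<otimes> v"
      then obtain y' s' v where y': "y' \<in> S" "0 < s'" "s' < d" "v \<in> generate G (S - {y'})"
        "z' \<otimes> w [^] d = y' [^] (s'::nat) \<otimes> v" by blast
      \<comment> \<open>The sign of \<open>q\<close> is opposite to that in the first alternative:
        there \<open>w\<close> is a root of \<open>z\<close>, here its \<open>d\<close>-th power
        stands on the side of \<open>z\<close> and has to cancel the power of
        \<open>y\<close>.\<close>
      have "z \<otimes> (w \<otimes> y [^] (- q)) [^] d = z' \<otimes> w [^] d"
        using wc y z'c mult_inv_cancel_right[of z' "(y [^] q) [^] d" "w [^] d"]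
        by (simp add: zeq nat_pow_distrib int_pow_neg nat_pow_inv)
      then have "z \<otimes> (w \<otimes> y [^] (- q)) [^] d = y' [^] s' \<otimes> v" using y' by simp
      moreover have "v \<in> generate G (insert y S - {y'})"
        using y'(4) mono_generate[of "S - {y'}" "insert y S - {y'}"] by blast
      moreover have "w \<otimes> y [^] (- q) \<in> generate G (insert y S)"
        by (rule generate.eng) (use w inclS ypow in auto)
      ultimately show ?thesis using y'(1-3) by blast
    qed
  qed
qed

text \<open>This is the freedom used to improve a presentation: the adjoined element may be altered
  by elements of \<open>H\<close> without changing the group.\<close>

lemma adjoin_shift:
  assumes "subgroup H G" "g \<in> carrier G" "w \<in> H"
  shows "adjoin G H (g \<otimes> w) = adjoin G H g"
proof -
  interpret H: subgroup H G by fact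
  have w: "w \<in> carrier G" using assms by auto
  have sub: "subgroup (adjoin G H g) G" "subgroup (adjoin G H (g \<otimes> w)) G"
    using adjoin_subgroup assms w by auto
  have 1: "h \<otimes> (g \<otimes> w) [^] i = (h \<otimes> w [^] i) \<otimes> g [^] i" if "h \<in> H" for h and i :: int
    using that w assms by (simp add: int_pow_distrib m_ac)
  have 2: "h \<otimes> g [^] i = (h \<otimes> w [^] (- i)) \<otimes> (g \<otimes> w) [^] i" if "h \<in> H" for h and i :: int
    using that w assms mult_inv_cancel_left[of h "w [^] i" "g [^] i"]
    by (simp add: int_pow_distrib int_pow_neg)
  have wi: "h \<otimes> w [^] i \<in> H" if "h \<in> H" for h and i :: int
    using subgroup_int_pow_closed[OF assms(1,3)] that by blast
  show ?thesis
  proof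
    show "adjoin G H (g \<otimes> w) \<subseteq> adjoin G H g"
    proof
      fix x assume "x \<in> adjoin G H (g \<otimes> w)"
      then obtain h i where "h \<in> H" "x = h \<otimes> (g \<otimes> w) [^] (i::int)" by (rule adjoinE)
      then show "x \<in> adjoin G H g"
        using 1[of h i] wi[of h i] adjoinI[of "h \<otimes> w [^] i" H G g i] by simp
    qed
    show "adjoin G H g \<subseteq> adjoin G H (g \<otimes> w)"
    proof
      fix x assume "x \<in> adjoin G H g"
      then obtain h i where "h \<in> H" "x = h \<otimes> g [^] (i::int)" by (rule adjoinE)
      then show "x \<in> adjoin G H (g \<otimes> w)"
        using 2[of h i] wi[of h "-i"] adjoinI[of "h \<otimes> w [^] (-i)" H G "g \<otimes> w" i] by simp
    qed
  qed
qed

text \<open>Among all presentations \<open>H = M\<langle>g\<rangle>\<close> with \<open>M\<close> generated by fewer elements, one with the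
  smallest positive exponent \<open>d\<close> such that \<open>g\<^sup>d \<in> M\<close> can be modified into a direct decomposition.\<close>
lemma generate_split:
  assumes "finite S" "S \<subseteq> carrier G" "card S = Suc m"
  shows "\<exists>g T. g \<in> carrier G \<and> finite T \<and> T \<subseteq> carrier G \<and> card T \<le> m \<and>
           generate G S = adjoin G (generate G T) g \<and>
           (\<forall>i::int. g [^] i \<in> generate G T \<longrightarrow> g [^] i = \<one>)"
proof -
  define pres where "pres g T \<longleftrightarrow> g \<in> carrier G \<and> finite T \<and> T \<subseteq> carrier G \<and> card T \<le> m \<and>
    generate G S = adjoin G (generate G T) g" for g T
  define rel where "rel d \<longleftrightarrow> d > 0 \<and> (\<exists>g T. pres g T \<and> g [^] d \<in> generate G T)" for d :: nat
  obtain g0 S0 where S0: "S = insert g0 S0" "g0 \<notin> S0" "card S0 = m"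
    using assms by (metis card_Suc_eq)
  have pres0: "pres g0 S0"
    using assms S0 by (auto simp: pres_def generate_insert)
  have pos: "\<exists>n::nat. n > 0 \<and> g [^] n \<in> generate G T"
    if "g [^] (i::int) \<in> generate G T" "i \<noteq> 0" "pres g T" for g T and i :: int
  proof -
    have sub: "subgroup (generate G T) G" "g \<in> carrier G"
      using that generate_is_subgroup by (auto simp: pres_def)
    have "g [^] \<bar>i\<bar> \<in> generate G T"
      using subgroup.m_inv_closed[OF sub(1) that(1)] that(1) sub(2)
      by (cases "i \<ge> 0") (simp_all add: int_pow_neg)
    moreover have "g [^] \<bar>i\<bar> = g [^] nat \<bar>i\<bar>" by (simp flip: int_pow_int)
    moreover have "nat \<bar>i\<bar> > 0" using that(2) by simp
    ultimately show ?thesis by metis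
  qed
  show ?thesis
  proof (cases "\<exists>d. rel d")
    case False
    \<comment> \<open>Without any relation, a power of \<open>g0\<close> in the subgroup must have
      exponent 0, so the given presentation is already direct.\<close>
    have "g0 [^] i = \<one>" if i: "g0 [^] i \<in> generate G S0" for i :: int
    proof (rule ccontr)
      assume "g0 [^] i \<noteq> \<one>"
      then have "i \<noteq> 0" by auto
      then obtain n :: nat where "n > 0" "g0 [^] n \<in> generate G S0" using pos[OF i _ pres0] by blast
      then show False using False pres0 unfolding rel_def by blast
    qed
    then show ?thesis using pres0 unfolding pres_def by blast
  next
    case True
    define d where "d = (LEAST d. rel d)"
    have d: "rel d" unfolding d_def using True LeastI_ex by blast
    have dmin: "\<not> rel e" if "e < d" for e using that not_less_Least unfolding d_def by blast
    from d obtain g T where gT: "d > 0" "pres g T" "g [^] d \<in> generate G T"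
      unfolding rel_def by blast
    have g: "g \<in> carrier G" and T: "finite T" "T \<subseteq> carrier G" "card T \<le> m"
      and HS: "generate G S = adjoin G (generate G T) g" using gT(2) by (auto simp: pres_def)
    have subT: "subgroup (generate G T) G" using T generate_is_subgroup by blast
    obtain w where w: "w \<in> generate G T" and alt: "g [^] d = w [^] d \<or>
           (\<exists>y\<in>T. \<exists>s v. 0 < s \<and> s < d \<and> v \<in> generate G (T - {y}) \<and>
              g [^] d \<otimes> w [^] d = y [^] (s::nat) \<otimes> v)"
      using generate_root_or_remainder[OF T(1,2) gT(3,1)] by blast
    have wc: "w \<in> carrier G" using w subT subgroup.mem_carrier by fast
    from alt show ?thesis
    proof
      assume eq: "g [^] d = w [^] d"
      \<comment> \<open>Dividing by the root \<open>w\<close> makes the \<open>d\<close>-th power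
        trivial and keeps the group. A power of \<open>h\<close> in \<open>generate G T\<close> can
        then be reduced to an exponent below \<open>d\<close>, and minimality of \<open>d\<close>
        forces that exponent to be 0.\<close>
      define h where "h = g \<otimes> inv w"
      have h: "h \<in> carrier G" using g wc by (simp add: h_def)
      have hd: "h [^] d = \<one>" using eq g wc by (simp add: h_def nat_pow_distrib nat_pow_inv)
      have presh: "pres h T"
        using h T HS adjoin_shift[OF subT g subgroup.m_inv_closed[OF subT w]]
        by (simp add: pres_def h_def)
      have "h [^] i = \<one>" if i: "h [^] i \<in> generate G T" for i :: int
      proof -
        have "h [^] i = h [^] (int d * (i div int d)) \<otimes> h [^] (i mod int d)"
          using int_pow_mult[OF h, of "int d * (i div int d)" "i mod int d"] by simp
        also have "\<dots> = (h [^] int d) [^] (i div int d) \<otimes> h [^] (i mod int d)"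
          using h by (simp add: int_pow_pow)
        also have "\<dots> = h [^] (i mod int d)" using h hd by (simp add: int_pow_int)
        also have "\<dots> = h [^] nat (i mod int d)" using gT(1) by (simp flip: int_pow_int)
        finally have *: "h [^] i = h [^] nat (i mod int d)" .
        have "nat (i mod int d) < d" using gT(1) by (simp add: nat_less_iff)
        then have "\<not> rel (nat (i mod int d))" by (rule dmin)
        moreover have "h [^] nat (i mod int d) \<in> generate G T" using i * by simp
        ultimately have "\<not> 0 < nat (i mod int d)" using presh unfolding rel_def by metis
        then show ?thesis using * by simp
      qed
      then show ?thesis using presh unfolding pres_def by blast
    next
      assume "\<exists>y\<in>T. \<exists>s v. 0 < s \<and> s < d \<and> v \<in> generate G (T - {y}) \<and>
              g [^] d \<otimes> w [^] d = y [^] (s::nat) \<otimes> v"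
      then obtain y s v where y: "y \<in> T" "0 < s" "s < d" "v \<in> generate G (T - {y})"
        "g [^] d \<otimes> w [^] d = y [^] (s::nat) \<otimes> v" by blast
      \<comment> \<open>An exchange: \<open>h\<close> takes the place of \<open>y\<close> among the
        generators and \<open>y\<close> becomes the adjoined element. The number of generators does
        not grow, and the relation now expresses \<open>y [^] s\<close> through \<open>h\<close> and
        \<open>v\<close>, with \<open>s\<close> positive and below \<open>d\<close>, against
        minimality.\<close>
      define h where "h = g \<otimes> w"
      have h: "h \<in> carrier G" using g wc by (simp add: h_def)
      define T' where "T' = insert h (T - {y})"
      have T': "finite T'" "T' \<subseteq> carrier G" using T h by (auto simp: T'_def)
      have "card T' \<le> Suc (card (T - {y}))" using T by (simp add: T'_def card_insert_if)
      also have "\<dots> \<le> m" using T y(1) by (metis card_Suc_Diff1)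
      finally have cT': "card T' \<le> m" .
      have yc: "y \<in> carrier G" using y(1) T by blast
      have "generate G S = adjoin G (generate G T) h"
        using HS adjoin_shift[OF subT g w] by (simp add: h_def)
      also have "\<dots> = generate G (insert h T)" using generate_insert h T by simp
      also have "insert h T = insert y T'" using y(1) by (auto simp: T'_def)
      also have "generate G (insert y T') = adjoin G (generate G T') y"
        using generate_insert yc T' by simp
      finally have presy: "pres y T'" using yc T' cT' by (simp add: pres_def)
      have subT': "subgroup (generate G T') G" using T' generate_is_subgroup by blast
      have vT': "v \<in> generate G T'" using y(4) mono_generate[of "T - {y}" T'] by (auto simp: T'_def)
      have hT': "h \<in> generate G T'" by (rule generate.incl) (simp add: T'_def)
      have "h [^] d = y [^] s \<otimes> v" using y(5) g wc by (simp add: h_def nat_pow_distrib)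
      then have "y [^] s = h [^] d \<otimes> inv v"
        using yc h subgroup.mem_carrier[OF subT' vT'] by (simp add: m_assoc)
      moreover have "h [^] d \<in> generate G T'"
        using subgroup_int_pow_closed[OF subT' hT', of "int d"] by (simp add: int_pow_int)
      ultimately have "y [^] s \<in> generate G T'"
        by (simp add: generate.eng[OF _ subgroup.m_inv_closed[OF subT' vT']])
      then have "rel s" using presy y(2) unfolding rel_def by blast
      then show ?thesis using dmin y(3) by blast
    qed
  qed
qed

text \<open>Replaces the structure theorem for finitely generated abelian groups. The induction runs
  over subgroups of one fixed group, so cocycles and sections are extended inside one type. The
  premise on powers of \<open>g\<close> says that the product with the cyclic group is direct, for
  finite and infinite order of \<open>g\<close> alike.\<close>

theorem finitely_generated_induct [consumes 2, case_names trivial adjoin]: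
  assumes "finite S" "S \<subseteq> carrier G"
    and "P {\<one>}"
    and step: "\<And>H g. \<lbrakk>subgroup H G; g \<in> carrier G; g \<noteq> \<one>; P H; \<And>i::int. g [^] i \<in> H \<Longrightarrow> g [^] i = \<one>\<rbrakk>
           \<Longrightarrow> P (adjoin G H g)"
  shows "P (generate G S)"
  using assms(1,2)
proof (induction "card S" arbitrary: S rule: less_induct)
  case less
  show ?case
  proof (cases "card S")
    case 0
    then show ?thesis using less.prems assms(3) by (simp add: generate_empty)
  next
    case (Suc m)
    obtain g T where gT: "g \<in> carrier G" "finite T" "T \<subseteq> carrier G" "card T \<le> m"
           "generate G S = adjoin G (generate G T) g"
           "\<And>i::int. g [^] i \<in> generate G T \<Longrightarrow> g [^] i = \<one>"
      using generate_split[OF less.prems Suc] by blast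
    have PT: "P (generate G T)" using less.hyps[of T] gT Suc by simp
    have sub: "subgroup (generate G T) G" using gT generate_is_subgroup by simp
    show ?thesis
    proof (cases "g = \<one>")
      case True
      then show ?thesis using PT gT(5) adjoin_one[OF sub] by simp
    next
      case False
      show ?thesis unfolding gT(5) by (rule step[OF sub gT(1) False PT gT(6)])
    qed
  qed
qed

end

section \<open>Powers, orders and cosets\<close>

text \<open>Sorting the factors of \<open>(x \<otimes> y) [^] n\<close> moves each \<open>x\<close>
  to the left past the \<open>y\<close>s before it, at the price of one \<open>z\<close> each: 0 + 1
  + ... + (n - 1) in all.\<close>

lemma (in group) pow_mult_commutator:
  assumes x: "x \<in> carrier G" and y: "y \<in> carrier G" and z: "z \<in> carrier G"
    and zx: "z \<otimes> x = x \<otimes> z" and zy: "z \<otimes> y = y \<otimes> z" and yx: "y \<otimes> x = z \<otimes> (x \<otimes> y)"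
  shows "(x \<otimes> y) [^] (n::nat) = z [^] (n choose 2) \<otimes> (x [^] n \<otimes> y [^] n)"
proof -
  have zyn: "z \<otimes> y [^] n = y [^] n \<otimes> z" for n :: nat
    using group_commutes_pow[OF zy[symmetric] y z] by simp
  have znx: "z [^] n \<otimes> x = x \<otimes> z [^] n" for n :: nat
    by (rule group_commutes_pow[OF zx z x])
  have znxm: "z [^] n \<otimes> x [^] m = x [^] m \<otimes> z [^] n" for n m :: nat
    using group_commutes_pow[OF znx[symmetric] x] z by simp
  have ynx: "y [^] n \<otimes> x = z [^] n \<otimes> (x \<otimes> y [^] n)" for n :: nat
  proof (induction n)
    case (Suc n)
    have "y [^] Suc n \<otimes> x = y [^] n \<otimes> (z \<otimes> (x \<otimes> y))" using x y by (simp add: m_assoc yx)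
    also have "\<dots> = z \<otimes> (y [^] n \<otimes> x) \<otimes> y" using x y z by (simp add: m_assoc[symmetric] zyn)
    also have "\<dots> = (z \<otimes> z [^] n) \<otimes> (x \<otimes> (y [^] n \<otimes> y))"
      using x y z by (simp add: Suc.IH m_assoc)
    also have "\<dots> = z [^] Suc n \<otimes> (x \<otimes> y [^] Suc n)"
      using nat_pow_Suc2[OF z, of n] by simp
    finally show ?case .
  qed (use x in simp)
  show ?thesis
  proof (induction n)
    case (Suc n)
    have c: "Suc n choose 2 = (n choose 2) + n" by (simp add: numeral_2_eq_2)
    have "(x \<otimes> y) [^] Suc n = z [^] (n choose 2) \<otimes> (x [^] n \<otimes> (y [^] n \<otimes> x) \<otimes> y)"
      using x y z by (simp add: Suc.IH m_assoc)
    also have "\<dots> = z [^] (n choose 2) \<otimes> ((x [^] n \<otimes> z [^] n) \<otimes> (x \<otimes> y [^] n) \<otimes> y)"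
      using x y z by (simp add: ynx m_assoc)
    also have "\<dots> = (z [^] (n choose 2) \<otimes> z [^] n) \<otimes> (x [^] Suc n \<otimes> y [^] Suc n)"
      using x y z by (simp add: znxm[symmetric] m_assoc)
    also have "\<dots> = z [^] (Suc n choose 2) \<otimes> (x [^] Suc n \<otimes> y [^] Suc n)"
      using z by (simp only: c nat_pow_mult)
    finally show ?case .
  qed (simp add: numeral_2_eq_2)
qed

context comm_group
begin

lemma ord_mult_coprime:
  assumes g: "g \<in> carrier G" and h: "h \<in> carrier G" and cop: "coprime (ord g) (ord h)"
  shows "ord (g \<otimes> h) = ord g * ord h"
proof (rule dvd_antisym)
  show "ord (g \<otimes> h) dvd ord g * ord h" using abelian_ord_mul_divides[OF g h] .
  let ?m = "ord (g \<otimes> h)"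
  have 1: "g [^] ?m \<otimes> h [^] ?m = \<one>"
    using g h by (metis m_closed nat_pow_distrib pow_ord_eq_1)
  have aux: "ord a dvd ?m" if a: "a \<in> carrier G" and b: "b \<in> carrier G"
    and ab: "a [^] ?m \<otimes> b [^] ?m = \<one>" and c: "coprime (ord a) (ord b)" for a b
  proof -
    have "(a [^] ?m \<otimes> b [^] ?m) [^] ord b = a [^] (?m * ord b)"
      using a b by (simp add: nat_pow_distrib nat_pow_pow pow_eq_id)
    then have "a [^] (?m * ord b) = \<one>" using ab by simp
    then have "ord a dvd ?m * ord b" using a pow_eq_id by blast
    then show ?thesis using c coprime_dvd_mult_left_iff by blast
  qed
  have "ord g dvd ?m" using aux[OF g h 1 cop] .
  moreover have "h [^] ?m \<otimes> g [^] ?m = \<one>"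
    using 1 m_comm[of "g [^] ?m" "h [^] ?m"] g h by simp
  then have "ord h dvd ?m" using aux[OF h g] cop coprime_commute by blast
  ultimately show "ord g * ord h dvd ?m" using cop divides_mult by blast
qed

lemma ord_mult_prime_power:
  assumes g: "g \<in> carrier G" and h: "h \<in> carrier G" and p: "prime (p::nat)"
    and og: "ord g = p ^ k" and oh: "ord h = p ^ l" and lk: "l < k"
  shows "ord (g \<otimes> h) = p ^ k"
proof -
  have "g [^] (p ^ k) = \<one>" "h [^] (p ^ k) = \<one>"
    using g h og oh lk by (simp_all add: pow_eq_id le_imp_power_dvd)
  then have "(g \<otimes> h) [^] (p ^ k) = \<one>" using g h by (simp add: nat_pow_distrib)
  then have "ord (g \<otimes> h) dvd p ^ k" using g h pow_eq_id by simp
  then obtain j where j: "j \<le> k" "ord (g \<otimes> h) = p ^ j" using divides_primepow_nat[OF p] by blast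
  have "j = k"
  proof (rule ccontr)
    assume "j \<noteq> k"
    then have jk: "j \<le> k - 1" "l \<le> k - 1" using j lk by auto
    have hh: "h [^] (p ^ (k - 1)) = \<one>" using h oh jk(2) by (simp add: pow_eq_id le_imp_power_dvd)
    have "(g \<otimes> h) [^] (p ^ (k - 1)) = \<one>" using g h j jk by (simp add: pow_eq_id le_imp_power_dvd)
    then have "g [^] (p ^ (k - 1)) = \<one>" using g h hh by (simp add: nat_pow_distrib)
    then have "p ^ k dvd p ^ (k - 1)" using g og pow_eq_id by simp
    then have "k \<le> k - 1" using p by (metis power_dvd_imp_le prime_gt_1_nat)
    then show False using lk by linarith
  qed
  then show ?thesis using j by simp
qed

lemma Tor_iff: "t \<in> Tor G \<longleftrightarrow> t \<in> carrier G \<and> ord t > 0"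
  unfolding Tor_def using pow_eq_id by (auto intro: Nat.gr0I)

section \<open>Cosets of the subgroup of n-th powers\<close>

abbreviation Pow_subgroup where "Pow_subgroup n \<equiv> powers G (carrier G) n"

lemma mem_Pow_subgroup: "a \<in> carrier G \<Longrightarrow> a [^] n \<in> Pow_subgroup n"
  unfolding powers_def by blast

lemma Pow_subgroupE:
  assumes "x \<in> Pow_subgroup n" obtains a where "a \<in> carrier G" "x = a [^] n"
  using assms unfolding powers_def by blast

lemma subgroup_Pow: "subgroup (Pow_subgroup n) G"
proof (rule subgroupI)
  show "Pow_subgroup n \<subseteq> carrier G" by (auto elim: Pow_subgroupE)
  show "Pow_subgroup n \<noteq> {}" using mem_Pow_subgroup[OF one_closed] by blast
  show "inv a \<in> Pow_subgroup n" if "a \<in> Pow_subgroup n" for a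
    using that mem_Pow_subgroup[OF inv_closed] by (auto elim!: Pow_subgroupE simp: nat_pow_inv[symmetric])
  show "a \<otimes> b \<in> Pow_subgroup n" if "a \<in> Pow_subgroup n" "b \<in> Pow_subgroup n" for a b
    using that mem_Pow_subgroup[OF m_closed] by (auto elim!: Pow_subgroupE simp: nat_pow_distrib[symmetric])
qed

lemma normal_Pow: "Pow_subgroup n \<lhd> G"
  using subgroup_Pow normal_iff_subgroup by blast

abbreviation Pow_cosets where "Pow_cosets n \<equiv> rcosets (Pow_subgroup n)"

lemma mem_r_coset_Pow:
  "x \<in> Pow_subgroup n #> a \<longleftrightarrow> (\<exists>b\<in>carrier G. x = b [^] n \<otimes> a)"
  unfolding r_coset_def powers_def by auto

lemma Pow_cosetsI: "a \<in> carrier G \<Longrightarrow> Pow_subgroup n #> a \<in> Pow_cosets n"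
  by (meson rcosetsI subgroup.subset subgroup_Pow)

lemma Pow_cosets_carrier: "S \<in> Pow_cosets n \<Longrightarrow> a \<in> S \<Longrightarrow> a \<in> carrier G"
  using subgroup.rcosets_carrier[OF subgroup_Pow is_group] by blast

lemma Pow_cosets_rep: "S \<in> Pow_cosets n \<Longrightarrow> a \<in> S \<Longrightarrow> S = Pow_subgroup n #> a"
  unfolding RCOSETS_def using repr_independence[OF _ _ subgroup_Pow] by auto

lemma Pow_cosets_nonempty:
  assumes "S \<in> Pow_cosets n" obtains a where "a \<in> S" "a \<in> carrier G"
  using assms subgroup.rcosets_non_empty[OF subgroup_Pow assms] Pow_cosets_carrier by blast

text \<open>The tool behind all identities between values of \<mu>: once both sides are known to be
  cosets of the same subgroup, a single common element suffices.\<close>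

lemma Pow_cosets_eqI: "\<lbrakk>S \<in> Pow_cosets n; T \<in> Pow_cosets n; a \<in> S; a \<in> T\<rbrakk> \<Longrightarrow> S = T"
  using Pow_cosets_rep by metis

lemma Pow_cosets_powers:
  assumes "S \<in> Pow_cosets n" shows "powers G S m \<in> Pow_cosets (n * m)"
proof -
  obtain a where a: "a \<in> S" "a \<in> carrier G" using Pow_cosets_nonempty[OF assms] .
  have "powers G S m = Pow_subgroup (n * m) #> a [^] m"
  proof (intro Set.set_eqI)
    fix x
    have "x \<in> powers G S m \<longleftrightarrow> (\<exists>b\<in>carrier G. x = (b [^] n \<otimes> a) [^] m)"
      unfolding Pow_cosets_rep[OF assms a(1)] by (auto simp: powers_def[of _ "_ #> _"] mem_r_coset_Pow)
    also have "\<dots> \<longleftrightarrow> x \<in> Pow_subgroup (n * m) #> a [^] m"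
      using a by (auto simp: mem_r_coset_Pow nat_pow_distrib nat_pow_pow)
    finally show "x \<in> powers G S m \<longleftrightarrow> x \<in> Pow_subgroup (n * m) #> a [^] m" .
  qed
  then show ?thesis using a Pow_cosetsI by simp
qed

lemma mem_powers: "a \<in> S \<Longrightarrow> a [^] m \<in> powers G S m"
  unfolding powers_def by blast

lemma Pow_cosets_image:
  assumes "S \<in> Pow_cosets n" "m dvd n"
  shows "Pow_subgroup m <#> S \<in> Pow_cosets m"
proof -
  obtain a where a: "a \<in> S" "a \<in> carrier G" using Pow_cosets_nonempty[OF assms(1)] .
  obtain q where q: "n = m * q" using assms(2) ..
  have "Pow_subgroup m <#> S = Pow_subgroup m #> a"
  proof
    show "Pow_subgroup m <#> S \<subseteq> Pow_subgroup m #> a"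
    proof
      fix x assume "x \<in> Pow_subgroup m <#> S"
      then obtain b c where bc: "b \<in> carrier G" "c \<in> carrier G" "x = b [^] m \<otimes> (c [^] n \<otimes> a)"
        unfolding Pow_cosets_rep[OF assms(1) a(1)] set_mult_def
        by (auto elim!: Pow_subgroupE simp: mem_r_coset_Pow)
      then have "x = (b \<otimes> c [^] q) [^] m \<otimes> a"
        using a q by (simp add: nat_pow_distrib nat_pow_pow m_assoc mult.commute)
      then show "x \<in> Pow_subgroup m #> a" using bc by (auto simp: mem_r_coset_Pow)
    qed
    show "Pow_subgroup m #> a \<subseteq> Pow_subgroup m <#> S"
      using a(1) unfolding set_mult_def r_coset_def by auto
  qed
  then show ?thesis using a Pow_cosetsI by simp
qed

lemma mem_Pow_image: "S \<in> Pow_cosets n \<Longrightarrow> a \<in> S \<Longrightarrow> a \<in> Pow_subgroup m <#> S"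
  using subgroup.one_closed[OF subgroup_Pow, of m] Pow_cosets_carrier[of S n a]
  unfolding set_mult_def by force

lemma Pow_cosets_mult: "\<lbrakk>S \<in> Pow_cosets n; T \<in> Pow_cosets n\<rbrakk> \<Longrightarrow> S <#> T \<in> Pow_cosets n"
  using normal.setmult_closed[OF normal_Pow] by blast

lemma mem_set_mult: "a \<in> S \<Longrightarrow> b \<in> T \<Longrightarrow> a \<otimes> b \<in> S <#> T"
  unfolding set_mult_def by blast

lemma Pow_cosets_translate:
  assumes "S \<in> Pow_cosets n" "c \<in> carrier G" shows "c <# S \<in> Pow_cosets n"
proof -
  obtain a where a: "a \<in> S" "a \<in> carrier G" using Pow_cosets_nonempty[OF assms(1)] .
  have "c <# S = Pow_subgroup n #> (c \<otimes> a)"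
  proof (intro Set.set_eqI)
    fix x
    have "x \<in> c <# S \<longleftrightarrow> (\<exists>b\<in>carrier G. x = c \<otimes> (b [^] n \<otimes> a))"
      unfolding Pow_cosets_rep[OF assms(1) a(1)] l_coset_def by (auto simp: Bex_def mem_r_coset_Pow)
    also have "\<dots> \<longleftrightarrow> x \<in> Pow_subgroup n #> (c \<otimes> a)"
      unfolding mem_r_coset_Pow using a assms(2) by (intro bex_cong refl) (simp add: m_ac)
    finally show "x \<in> c <# S \<longleftrightarrow> x \<in> Pow_subgroup n #> (c \<otimes> a)" .
  qed
  then show ?thesis using a assms(2) Pow_cosetsI by simp
qed

lemma mem_l_coset: "a \<in> S \<Longrightarrow> c \<otimes> a \<in> c <# S"
  unfolding l_coset_def by blast

end

section \<open>Cocycles and the conditions (A)--(D)\<close>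

text \<open>A 2-cocycle for the trivial action. Normalization is required at the identity pair only;
  the cocycle identity spreads it to \<open>one_left\<close> and \<open>one_right\<close>.\<close>

locale cocycle = U?: comm_group U + K: comm_group K for U (structure) and K +
  fixes \<alpha> :: "'c \<Rightarrow> 'c \<Rightarrow> 'a"
  assumes closed [simp, intro]:
      "\<lbrakk>s \<in> carrier K; t \<in> carrier K\<rbrakk> \<Longrightarrow> \<alpha> s t \<in> carrier U"
    and assoc: "\<lbrakk>s \<in> carrier K; t \<in> carrier K; u \<in> carrier K\<rbrakk> \<Longrightarrow>
      \<alpha> s t \<otimes> \<alpha> (s \<otimes>\<^bsub>K\<^esub> t) u = \<alpha> t u \<otimes> \<alpha> s (t \<otimes>\<^bsub>K\<^esub> u)"
    and one_one [simp]: "\<alpha> \<one>\<^bsub>K\<^esub> \<one>\<^bsub>K\<^esub> = \<one>"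

text \<open>The central extension of \<open>K\<close> by \<open>U\<close> defined by the cocycle.
  The pair \<open>(a, s)\<close> stands for \<open>a\<close> times the basis element of degree
  \<open>s\<close>, so for the cocycle of a graded-division algebra this is the group of nonzero
  homogeneous elements.\<close>

definition twist ::
  "('u, 'm) monoid_scheme \<Rightarrow> ('k, 'n) monoid_scheme \<Rightarrow> ('k \<Rightarrow> 'k \<Rightarrow> 'u) \<Rightarrow> ('u \<times> 'k) monoid" where
  "twist U K \<alpha> = \<lparr>carrier = carrier U \<times> carrier K,
     mult = (\<lambda>(a, s) (b, t). (a \<otimes>\<^bsub>U\<^esub> b \<otimes>\<^bsub>U\<^esub> \<alpha> s t, s \<otimes>\<^bsub>K\<^esub> t)), one = (\<one>\<^bsub>U\<^esub>, \<one>\<^bsub>K\<^esub>)\<rparr>"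

text \<open>Defined on pairs so that its type is that of the bicharacter \<beta> to be
  classified.\<close>

definition commutation ::
  "('u, 'm) monoid_scheme \<Rightarrow> ('k \<Rightarrow> 'k \<Rightarrow> 'u) \<Rightarrow> 'k \<times> 'k \<Rightarrow> 'u" where
  "commutation U \<alpha> = (\<lambda>(s, t). \<alpha> s t \<otimes>\<^bsub>U\<^esub> inv\<^bsub>U\<^esub> (\<alpha> t s))"

text \<open>All lifts \<open>(b, t)\<close> of \<open>t\<close> enter at once, so the result is a
  full coset and depends on no choice of a lift.\<close>

definition order_coset ::
  "('u, 'm) monoid_scheme \<Rightarrow> ('k, 'n) monoid_scheme \<Rightarrow> ('k \<Rightarrow> 'k \<Rightarrow> 'u) \<Rightarrow> 'k \<Rightarrow> 'u set" where
  "order_coset U K \<alpha> t =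
     {a. \<exists>b\<in>carrier U. (b, t) [^]\<^bsub>twist U K \<alpha>\<^esub> group.ord K t = (a, \<one>\<^bsub>K\<^esub>)}"

lemma carrier_twist [simp]: "carrier (twist U K \<alpha>) = carrier U \<times> carrier K"
  and one_twist [simp]: "\<one>\<^bsub>twist U K \<alpha>\<^esub> = (\<one>\<^bsub>U\<^esub>, \<one>\<^bsub>K\<^esub>)"
  and mult_twist [simp]: "(a, s) \<otimes>\<^bsub>twist U K \<alpha>\<^esub> (b, t) =
    (a \<otimes>\<^bsub>U\<^esub> b \<otimes>\<^bsub>U\<^esub> \<alpha> s t, s \<otimes>\<^bsub>K\<^esub> t)"
  by (simp_all add: twist_def)

context cocycle
begin

abbreviation E where "E \<equiv> twist U K \<alpha>"
abbreviation \<beta> where "\<beta> s t \<equiv> commutation U \<alpha> (s, t)"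
abbreviation \<mu> where "\<mu> \<equiv> order_coset U K \<alpha>"

lemma one_left [simp]: "t \<in> carrier K \<Longrightarrow> \<alpha> \<one>\<^bsub>K\<^esub> t = \<one>"
  using assoc[of "\<one>\<^bsub>K\<^esub>" "\<one>\<^bsub>K\<^esub>" t] by simp

lemma one_right [simp]: "t \<in> carrier K \<Longrightarrow> \<alpha> t \<one>\<^bsub>K\<^esub> = \<one>"
  using assoc[of t "\<one>\<^bsub>K\<^esub>" "\<one>\<^bsub>K\<^esub>"] by simp

text \<open>Lets the same homogeneous element serve as left and right inverse in the twisted group
  algebra.\<close>

lemma inv_comm: "t \<in> carrier K \<Longrightarrow> \<alpha> (inv\<^bsub>K\<^esub> t) t = \<alpha> t (inv\<^bsub>K\<^esub> t)"
  using assoc[of t "inv\<^bsub>K\<^esub> t" t] by simp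

lemma group_twist: "group E"
proof (rule groupI)
  show "x \<otimes>\<^bsub>E\<^esub> y \<in> carrier E" if "x \<in> carrier E" "y \<in> carrier E" for x y
    using that by (cases x; cases y) auto
  show "\<one>\<^bsub>E\<^esub> \<in> carrier E" by simp
  show "x \<otimes>\<^bsub>E\<^esub> y \<otimes>\<^bsub>E\<^esub> z = x \<otimes>\<^bsub>E\<^esub> (y \<otimes>\<^bsub>E\<^esub> z)"
    if "x \<in> carrier E" "y \<in> carrier E" "z \<in> carrier E" for x y z
  proof -
    obtain a s b t c u where xyz: "x = (a, s)" "y = (b, t)" "z = (c, u)" by (metis prod.exhaust)
    with that have car: "a \<in> carrier U" "b \<in> carrier U" "c \<in> carrier U"
      "s \<in> carrier K" "t \<in> carrier K" "u \<in> carrier K" by auto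
    have "a \<otimes> b \<otimes> \<alpha> s t \<otimes> c \<otimes> \<alpha> (s \<otimes>\<^bsub>K\<^esub> t) u = (a \<otimes> b \<otimes> c) \<otimes> (\<alpha> s t \<otimes> \<alpha> (s \<otimes>\<^bsub>K\<^esub> t) u)"
      using car by (simp add: m_ac)
    also have "\<dots> = a \<otimes> (b \<otimes> c \<otimes> \<alpha> t u) \<otimes> \<alpha> s (t \<otimes>\<^bsub>K\<^esub> u)"
      unfolding assoc[OF car(4-6)] using car by (simp add: m_ac)
    finally show ?thesis using car by (simp add: xyz K.m_assoc)
  qed
  show "\<one>\<^bsub>E\<^esub> \<otimes>\<^bsub>E\<^esub> x = x" if "x \<in> carrier E" for x using that by (cases x) auto
  show "\<exists>y\<in>carrier E. y \<otimes>\<^bsub>E\<^esub> x = \<one>\<^bsub>E\<^esub>" if "x \<in> carrier E" for x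
  proof -
    obtain a s where x: "x = (a, s)" by force
    with that have car: "a \<in> carrier U" "s \<in> carrier K" by auto
    have "inv (a \<otimes> \<alpha> (inv\<^bsub>K\<^esub> s) s) \<otimes> a \<otimes> \<alpha> (inv\<^bsub>K\<^esub> s) s = \<one>"
      using car by (simp add: m_assoc)
    then show ?thesis using car
      by (intro bexI[of _ "(inv (a \<otimes> \<alpha> (inv\<^bsub>K\<^esub> s) s), inv\<^bsub>K\<^esub> s)"]) (auto simp: x)
  qed
qed

interpretation E: group E by (rule group_twist)

section \<open>Commutation factors of a cocycle\<close>

lemma commutation_closed [simp, intro]:
  "\<lbrakk>s \<in> carrier K; t \<in> carrier K\<rbrakk> \<Longrightarrow> \<beta> s t \<in> carrier U"
  by (simp add: commutation_def)

lemma commute: "\<lbrakk>s \<in> carrier K; t \<in> carrier K\<rbrakk> \<Longrightarrow> \<alpha> s t = \<beta> s t \<otimes> \<alpha> t s"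
  by (simp add: commutation_def m_assoc)

lemma commutationI:
  "\<lbrakk>s \<in> carrier K; t \<in> carrier K; b \<in> carrier U; \<alpha> s t = b \<otimes> \<alpha> t s\<rbrakk> \<Longrightarrow> \<beta> s t = b"
  by (simp add: commutation_def m_assoc)

lemma commutation_self [simp]: "t \<in> carrier K \<Longrightarrow> \<beta> t t = \<one>"
  by (simp add: commutation_def)

lemma commutation_swap:
  assumes "s \<in> carrier K" "t \<in> carrier K" shows "\<beta> t s = inv (\<beta> s t)"
  using assms by (simp add: commutation_def inv_mult m_comm)

text \<open>The element of degree \<open>u\<close> is moved to the left past those of degrees
  \<open>t\<close> and \<open>s\<close> in turn. Each move contributes one commutation factor, and
  the cocycle identities for \<open>(s, t, u)\<close>, \<open>(s, u, t)\<close> and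
  \<open>(u, s, t)\<close> do the rebracketing.\<close>

lemma commutation_mult_left:
  assumes [simp]: "s \<in> carrier K" "t \<in> carrier K" "u \<in> carrier K"
  shows "\<beta> (s \<otimes>\<^bsub>K\<^esub> t) u = \<beta> s u \<otimes> \<beta> t u"
proof (rule commutationI)
  have "\<alpha> s t \<otimes> \<alpha> (s \<otimes>\<^bsub>K\<^esub> t) u = \<beta> t u \<otimes> (\<alpha> u t \<otimes> \<alpha> s (u \<otimes>\<^bsub>K\<^esub> t))"
    by (simp add: assoc commute[of t u] K.m_comm[of t u] m_assoc)
  also have "\<dots> = \<beta> t u \<otimes> (\<alpha> s u \<otimes> \<alpha> (s \<otimes>\<^bsub>K\<^esub> u) t)" by (simp add: assoc[of s u t])
  also have "\<dots> = \<beta> t u \<otimes> \<beta> s u \<otimes> (\<alpha> u s \<otimes> \<alpha> (u \<otimes>\<^bsub>K\<^esub> s) t)"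
    by (simp add: commute[of s u] K.m_comm[of s u] m_assoc)
  also have "\<dots> = \<beta> t u \<otimes> \<beta> s u \<otimes> (\<alpha> s t \<otimes> \<alpha> u (s \<otimes>\<^bsub>K\<^esub> t))" by (simp add: assoc[of u s t])
  also have "\<dots> = \<alpha> s t \<otimes> ((\<beta> s u \<otimes> \<beta> t u) \<otimes> \<alpha> u (s \<otimes>\<^bsub>K\<^esub> t))" by (simp add: m_ac)
  finally show "\<alpha> (s \<otimes>\<^bsub>K\<^esub> t) u = \<beta> s u \<otimes> \<beta> t u \<otimes> \<alpha> u (s \<otimes>\<^bsub>K\<^esub> t)" by simp
qed auto

lemma commutation_mult_right:
  assumes [simp]: "s \<in> carrier K" "t \<in> carrier K" "u \<in> carrier K"
  shows "\<beta> u (s \<otimes>\<^bsub>K\<^esub> t) = \<beta> u s \<otimes> \<beta> u t"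
  by (simp add: commutation_swap[of _ u] commutation_mult_left inv_mult)

lemma commutation_pow_left:
  assumes "s \<in> carrier K" "t \<in> carrier K"
  shows "\<beta> (s [^]\<^bsub>K\<^esub> (n::nat)) t = \<beta> s t [^] n"
proof (induction n)
  case 0
  then show ?case using assms commutationI[of "\<one>\<^bsub>K\<^esub>" t \<one>] by simp
qed (use assms in \<open>simp add: commutation_mult_left\<close>)

section \<open>Powers of lifts and their cosets\<close>

lemma snd_pow [simp]: "snd ((a, s) [^]\<^bsub>E\<^esub> (n::nat)) = s [^]\<^bsub>K\<^esub> n"
proof (induction n)
  case (Suc n)
  then show ?case by (cases "(a, s) [^]\<^bsub>E\<^esub> n") simp
qed simp

lemma scalar_pow: "a \<in> carrier U \<Longrightarrow> (a, \<one>\<^bsub>K\<^esub>) [^]\<^bsub>E\<^esub> (n::nat) = (a [^] n, \<one>\<^bsub>K\<^esub>)"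
  by (induction n) simp_all

lemma scalar_central:
  "\<lbrakk>a \<in> carrier U; x \<in> carrier E\<rbrakk> \<Longrightarrow> (a, \<one>\<^bsub>K\<^esub>) \<otimes>\<^bsub>E\<^esub> x = x \<otimes>\<^bsub>E\<^esub> (a, \<one>\<^bsub>K\<^esub>)"
  by (cases x) (auto simp: m_comm)

lemma commute_twist:
  assumes "a \<in> carrier U" "b \<in> carrier U" "s \<in> carrier K" "t \<in> carrier K"
  shows "(b, t) \<otimes>\<^bsub>E\<^esub> (a, s) = (\<beta> t s, \<one>\<^bsub>K\<^esub>) \<otimes>\<^bsub>E\<^esub> ((a, s) \<otimes>\<^bsub>E\<^esub> (b, t))"
  using assms by (simp add: commute[of t s] K.m_comm m_ac)

lemma mult_pow_twist:
  assumes "a \<in> carrier U" "b \<in> carrier U" "s \<in> carrier K" "t \<in> carrier K"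
  shows "((a, s) \<otimes>\<^bsub>E\<^esub> (b, t)) [^]\<^bsub>E\<^esub> (n::nat) =
    (\<beta> t s [^] (n choose 2), \<one>\<^bsub>K\<^esub>) \<otimes>\<^bsub>E\<^esub> ((a, s) [^]\<^bsub>E\<^esub> n \<otimes>\<^bsub>E\<^esub> (b, t) [^]\<^bsub>E\<^esub> n)"
proof -
  have "(\<beta> t s, \<one>\<^bsub>K\<^esub>) [^]\<^bsub>E\<^esub> (n choose 2) = (\<beta> t s [^] (n choose 2), \<one>\<^bsub>K\<^esub>)"
    using assms by (simp add: scalar_pow)
  moreover have "((a, s) \<otimes>\<^bsub>E\<^esub> (b, t)) [^]\<^bsub>E\<^esub> n =
    (\<beta> t s, \<one>\<^bsub>K\<^esub>) [^]\<^bsub>E\<^esub> (n choose 2) \<otimes>\<^bsub>E\<^esub> ((a, s) [^]\<^bsub>E\<^esub> n \<otimes>\<^bsub>E\<^esub> (b, t) [^]\<^bsub>E\<^esub> n)"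
    by (rule E.pow_mult_commutator) (use assms in \<open>auto intro: scalar_central commute_twist
      simp del: mult_twist\<close>)
  ultimately show ?thesis by simp
qed

lemma pow_twist:
  assumes "b \<in> carrier U" "t \<in> carrier K"
  shows "(b, t) [^]\<^bsub>E\<^esub> (n::nat) = (b [^] n, \<one>\<^bsub>K\<^esub>) \<otimes>\<^bsub>E\<^esub> (\<one>, t) [^]\<^bsub>E\<^esub> n"
proof -
  have "(b, t) = (b, \<one>\<^bsub>K\<^esub>) \<otimes>\<^bsub>E\<^esub> (\<one>, t)" using assms by simp
  then show ?thesis
    using E.pow_mult_distrib[of "(b, \<one>\<^bsub>K\<^esub>)" "(\<one>, t)" n] assms
    by (simp add: scalar_central scalar_pow)
qed

lemma pow_ord_twist:
  assumes "b \<in> carrier U" "t \<in> carrier K"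
  obtains a where "a \<in> carrier U" "(b, t) [^]\<^bsub>E\<^esub> K.ord t = (a, \<one>\<^bsub>K\<^esub>)" "a \<in> \<mu> t"
proof -
  obtain a s where as: "(b, t) [^]\<^bsub>E\<^esub> K.ord t = (a, s)" by force
  have "s = \<one>\<^bsub>K\<^esub>" using snd_pow[of b t "K.ord t"] as assms by simp
  moreover have "a \<in> carrier U" using E.nat_pow_closed[of "(b, t)" "K.ord t"] as assms by simp
  ultimately show thesis using that[of a] as assms by (auto simp: order_coset_def)
qed

lemma order_coset_eq:
  assumes "t \<in> carrier K" "(\<one>, t) [^]\<^bsub>E\<^esub> K.ord t = (a, \<one>\<^bsub>K\<^esub>)" "a \<in> carrier U"
  shows "\<mu> t = Pow_subgroup (K.ord t) #> a"
proof -
  have "(b, t) [^]\<^bsub>E\<^esub> K.ord t = (b [^] K.ord t \<otimes> a, \<one>\<^bsub>K\<^esub>)" if "b \<in> carrier U" for b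
    using pow_twist[OF that assms(1), of "K.ord t"] that assms by simp
  then show ?thesis by (auto simp: order_coset_def mem_r_coset_Pow)
qed

lemma order_coset_Pow: "t \<in> carrier K \<Longrightarrow> \<mu> t \<in> Pow_cosets (K.ord t)"
  using pow_ord_twist[OF one_closed] order_coset_eq Pow_cosetsI by metis

lemma mem_order_cosetI:
  "\<lbrakk>x \<in> carrier E; snd x = t; x [^]\<^bsub>E\<^esub> K.ord t = (a, \<one>\<^bsub>K\<^esub>)\<rbrakk> \<Longrightarrow> a \<in> \<mu> t"
  by (cases x) (auto simp: order_coset_def)

text \<open>Condition (A): the \<open>n\<close>-th power of a lift of \<open>g\<close> is a lift of
  the \<open>n\<close>-th power of \<open>g\<close>, and raising it to the order of that element
  gives back the full power of the original lift.\<close>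

lemma order_coset_pow:
  assumes g: "g \<in> carrier K" "K.ord g > 0" and n: "n > 0" "n dvd K.ord g"
  shows "\<mu> (g [^]\<^bsub>K\<^esub> n) = Pow_subgroup (K.ord g div n) <#> \<mu> g"
proof -
  obtain a where a: "a \<in> carrier U" "(\<one>, g) [^]\<^bsub>E\<^esub> K.ord g = (a, \<one>\<^bsub>K\<^esub>)" "a \<in> \<mu> g"
    using pow_ord_twist[OF one_closed g(1)] .
  have on: "K.ord (g [^]\<^bsub>K\<^esub> n) = K.ord g div n" using K.ord_pow g n by simp
  have "((\<one>, g) [^]\<^bsub>E\<^esub> n) [^]\<^bsub>E\<^esub> (K.ord g div n) = (a, \<one>\<^bsub>K\<^esub>)"
    using a(2) g n by (simp add: E.nat_pow_pow)
  then have "a \<in> \<mu> (g [^]\<^bsub>K\<^esub> n)"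
    using g E.nat_pow_closed[of "(\<one>, g)" n] by (intro mem_order_cosetI[of "(\<one>, g) [^]\<^bsub>E\<^esub> n"]) (simp_all add: on)
  moreover have "a \<in> Pow_subgroup (K.ord g div n) <#> \<mu> g"
    using mem_Pow_image order_coset_Pow a(3) g(1) by blast
  moreover have "Pow_subgroup (K.ord g div n) <#> \<mu> g \<in> Pow_cosets (K.ord g div n)"
    by (rule Pow_cosets_image[OF order_coset_Pow[OF g(1)]]) (metis n(2) dvd_div_mult_self dvd_triv_left)
  ultimately show ?thesis
    using Pow_cosets_eqI order_coset_Pow[of "g [^]\<^bsub>K\<^esub> n"] g(1) on by (metis K.nat_pow_closed)
qed

text \<open>The conditions (B), (C) and (D) differ only in what becomes of the power of \<open>\<beta> h g\<close>.\<close>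
lemma order_coset_mult:
  assumes g: "g \<in> carrier K" "K.ord (g \<otimes>\<^bsub>K\<^esub> h) = K.ord g * m"
    and h: "h \<in> carrier K" "K.ord (g \<otimes>\<^bsub>K\<^esub> h) = K.ord h * n"
  shows "\<mu> (g \<otimes>\<^bsub>K\<^esub> h) = \<beta> h g [^] (K.ord (g \<otimes>\<^bsub>K\<^esub> h) choose 2) <#
           (powers U (\<mu> g) m <#> powers U (\<mu> h) n)"
proof -
  let ?N = "K.ord (g \<otimes>\<^bsub>K\<^esub> h)" let ?z = "\<beta> h g [^] (K.ord (g \<otimes>\<^bsub>K\<^esub> h) choose 2)"
  obtain a where a: "a \<in> carrier U" "(\<one>, g) [^]\<^bsub>E\<^esub> K.ord g = (a, \<one>\<^bsub>K\<^esub>)" "a \<in> \<mu> g"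
    using pow_ord_twist[OF one_closed g(1)] .
  obtain b where b: "b \<in> carrier U" "(\<one>, h) [^]\<^bsub>E\<^esub> K.ord h = (b, \<one>\<^bsub>K\<^esub>)" "b \<in> \<mu> h"
    using pow_ord_twist[OF one_closed h(1)] .
  have "(\<one>, g) [^]\<^bsub>E\<^esub> ?N = (a [^] m, \<one>\<^bsub>K\<^esub>)"
    using g a by (simp add: E.nat_pow_pow[symmetric] scalar_pow)
  moreover have "(\<one>, h) [^]\<^bsub>E\<^esub> ?N = (b [^] n, \<one>\<^bsub>K\<^esub>)"
    using h b by (simp add: E.nat_pow_pow[symmetric] scalar_pow)
  ultimately have "((\<one>, g) \<otimes>\<^bsub>E\<^esub> (\<one>, h)) [^]\<^bsub>E\<^esub> ?N = (?z \<otimes> (a [^] m \<otimes> b [^] n), \<one>\<^bsub>K\<^esub>)"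
    using mult_pow_twist[of \<one> \<one> g h ?N] g h a b by simp
  then have "?z \<otimes> (a [^] m \<otimes> b [^] n) \<in> \<mu> (g \<otimes>\<^bsub>K\<^esub> h)"
    using g h by (intro mem_order_cosetI[of "(\<one>, g) \<otimes>\<^bsub>E\<^esub> (\<one>, h)"]) auto
  moreover have "?z \<otimes> (a [^] m \<otimes> b [^] n) \<in> ?z <# (powers U (\<mu> g) m <#> powers U (\<mu> h) n)"
    using a b by (intro mem_l_coset mem_set_mult mem_powers)
  moreover have "?z <# (powers U (\<mu> g) m <#> powers U (\<mu> h) n) \<in> Pow_cosets ?N"
    using Pow_cosets_powers[OF order_coset_Pow[OF g(1)], of m]
      Pow_cosets_powers[OF order_coset_Pow[OF h(1)], of n] g h
    by (intro Pow_cosets_translate Pow_cosets_mult) (simp_all add: nat_pow_closed)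
  ultimately show ?thesis using Pow_cosets_eqI order_coset_Pow g h by (meson K.m_closed)
qed

lemma Pow_cosets_subset: "S \<in> Pow_cosets n \<Longrightarrow> S \<subseteq> carrier U"
  using Pow_cosets_carrier by blast

lemma one_l_coset: "S \<subseteq> carrier U \<Longrightarrow> \<one> <# S = S"
  by (rule lcos_mult_one)

lemma powers_1: "S \<subseteq> carrier U \<Longrightarrow> powers U S 1 = S"
  unfolding powers_def by force

lemma commutation_pow_ord_left:
  "\<lbrakk>s \<in> carrier K; t \<in> carrier K; K.ord s dvd n\<rbrakk> \<Longrightarrow> \<beta> s t [^] n = \<one>"
  using commutation_pow_left[of s t n] commutationI[of "\<one>\<^bsub>K\<^esub>" t \<one>] K.pow_eq_id[of s n] by simp

lemma commutation_pow_ord_right: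
  "\<lbrakk>s \<in> carrier K; t \<in> carrier K; K.ord t dvd n\<rbrakk> \<Longrightarrow> \<beta> s t [^] n = \<one>"
  using commutation_pow_ord_left[of t s n] commutation_swap[of t s] by (simp add: nat_pow_inv)

lemma order_coset_mult_trivial:
  assumes "g \<in> carrier K" "K.ord (g \<otimes>\<^bsub>K\<^esub> h) = K.ord g * m"
    "h \<in> carrier K" "K.ord (g \<otimes>\<^bsub>K\<^esub> h) = K.ord h * n"
    "\<beta> h g [^] (K.ord (g \<otimes>\<^bsub>K\<^esub> h) choose 2) = \<one>"
  shows "\<mu> (g \<otimes>\<^bsub>K\<^esub> h) = powers U (\<mu> g) m <#> powers U (\<mu> h) n"
proof -
  have "powers U (\<mu> g) m <#> powers U (\<mu> h) n \<in> Pow_cosets (K.ord g * m)"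
    using Pow_cosets_powers[OF order_coset_Pow[OF assms(1)], of m]
      Pow_cosets_powers[OF order_coset_Pow[OF assms(3)], of n] assms(2,4)
    by (intro Pow_cosets_mult) simp_all
  then show ?thesis
    using order_coset_mult[OF assms(1-4)] one_l_coset Pow_cosets_subset by (simp add: assms(5))
qed

text \<open>Condition (B): the order of \<open>\<beta> h g\<close> divides both orders, so this
  factor is trivial.\<close>

lemma order_coset_mult_coprime:
  assumes g: "g \<in> carrier K" and h: "h \<in> carrier K" and c: "coprime (K.ord g) (K.ord h)"
  shows "\<mu> (g \<otimes>\<^bsub>K\<^esub> h) = powers U (\<mu> g) (K.ord h) <#> powers U (\<mu> h) (K.ord g)"
proof (rule order_coset_mult_trivial[OF g _ h])
  have "\<beta> h g [^] K.ord g = \<one>" "\<beta> h g [^] K.ord h = \<one>"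
    using g h commutation_pow_ord_left[of h g] commutation_pow_ord_right[of h g] by auto
  then have "ord (\<beta> h g) dvd K.ord g" "ord (\<beta> h g) dvd K.ord h"
    using g h pow_eq_id by auto
  then have "ord (\<beta> h g) = 1" using c by (metis coprime_common_divisor_nat)
  then have "\<beta> h g = \<one>" using g h ord_eq_1[of "\<beta> h g"] by auto
  then show "\<beta> h g [^] (K.ord (g \<otimes>\<^bsub>K\<^esub> h) choose 2) = \<one>" by simp
qed (use K.ord_mult_coprime[OF g h c] in \<open>simp_all add: mult.commute\<close>)

text \<open>Condition (C): \<open>\<beta> h g\<close> is killed by \<open>p ^ l\<close>, and
  \<open>p ^ l\<close> divides \<open>p ^ k choose 2\<close>. The division by 2 is harmless: for odd
  \<open>p\<close> the number \<open>p ^ k - 1\<close> is even, and for \<open>p = 2\<close> the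
  inequality \<open>l < k\<close> leaves a spare factor 2.\<close>

lemma order_coset_mult_prime_power:
  assumes g: "g \<in> carrier K" and h: "h \<in> carrier K" and p: "prime (p::nat)"
    and og: "K.ord g = p ^ k" and oh: "K.ord h = p ^ l" and lk: "l < k"
  shows "\<mu> (g \<otimes>\<^bsub>K\<^esub> h) = \<mu> g <#> powers U (\<mu> h) (p ^ (k - l))"
proof -
  have o: "K.ord (g \<otimes>\<^bsub>K\<^esub> h) = p ^ k" by (rule K.ord_mult_prime_power[OF assms])
  have "p ^ l dvd p ^ k choose 2"
  proof -
    have "p ^ k = p ^ l * (p * p ^ (k - l - 1))"
      using lk by (simp add: power_add[symmetric] flip: power_Suc)
    then have e: "2 * (p ^ k choose 2) = p ^ l * (p * p ^ (k - l - 1) * (p ^ k - 1))"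
      by (simp add: choose_two algebra_simps)
    have "even (p * p ^ (k - l - 1) * (p ^ k - 1))"
      using lk by (cases "p = 2") (use p prime_odd_nat prime_ge_2_nat[OF p] in \<open>auto simp: order.strict_iff_order\<close>)
    then obtain c where "p * p ^ (k - l - 1) * (p ^ k - 1) = 2 * c" ..
    then have "(p ^ k choose 2) = p ^ l * c" using e by simp
    then show ?thesis by simp
  qed
  then have "\<beta> h g [^] (K.ord (g \<otimes>\<^bsub>K\<^esub> h) choose 2) = \<one>"
    unfolding o using commutation_pow_ord_left[OF h g] oh by simp
  then have "\<mu> (g \<otimes>\<^bsub>K\<^esub> h) = powers U (\<mu> g) 1 <#> powers U (\<mu> h) (p ^ (k - l))"
    using lk by (intro order_coset_mult_trivial g h) (simp_all add: o og oh flip: power_add)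
  then show ?thesis using powers_1 Pow_cosets_subset order_coset_Pow[OF g] by metis
qed

text \<open>Condition (D) for odd \<open>p\<close>: since \<open>p ^ k - 1\<close> is even, the
  binomial coefficient is a multiple of \<open>p ^ k\<close>, which kills
  \<open>\<beta> h g\<close>.\<close>

lemma order_coset_mult_odd:
  assumes g: "g \<in> carrier K" and h: "h \<in> carrier K" and p: "prime (p::nat)" "odd p"
    and og: "K.ord g = p ^ k" and oh: "K.ord h = p ^ k" and o: "K.ord (g \<otimes>\<^bsub>K\<^esub> h) = p ^ k"
  shows "\<mu> (g \<otimes>\<^bsub>K\<^esub> h) = \<mu> g <#> \<mu> h"
proof -
  have "even (p ^ k - 1)" using p by simp
  then have "p ^ k dvd p ^ k choose 2" by (simp add: choose_two div_mult_swap[symmetric] flip: div_mult_swap)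
  then have "\<beta> h g [^] (K.ord (g \<otimes>\<^bsub>K\<^esub> h) choose 2) = \<one>"
    unfolding o using commutation_pow_ord_left[OF h g] oh by simp
  then have "\<mu> (g \<otimes>\<^bsub>K\<^esub> h) = powers U (\<mu> g) 1 <#> powers U (\<mu> h) 1"
    by (intro order_coset_mult_trivial g h) (simp_all add: o og oh)
  then show ?thesis using powers_1 Pow_cosets_subset order_coset_Pow g h by metis
qed

text \<open>Condition (D) for \<open>p = 2\<close>: the binomial coefficient is
  \<open>2 ^ k * 2 ^ (k - 1) - 2 ^ (k - 1)\<close>. Only the negative exponent survives, and the
  sign turns \<open>\<beta> h g\<close> into \<open>\<beta> g h\<close>.\<close>

lemma order_coset_mult_two:
  assumes g: "g \<in> carrier K" and h: "h \<in> carrier K" and k: "k \<ge> 1"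
    and og: "K.ord g = 2 ^ k" and oh: "K.ord h = 2 ^ k" and o: "K.ord (g \<otimes>\<^bsub>K\<^esub> h) = 2 ^ k"
  shows "\<mu> (g \<otimes>\<^bsub>K\<^esub> h) = \<beta> g h [^] ((2::nat) ^ (k - 1)) <# (\<mu> g <#> \<mu> h)"
proof -
  have kk: "(2::nat) ^ k = 2 * 2 ^ (k - 1)" using k by (simp flip: power_Suc)
  have e: "((2::nat) ^ k choose 2) + 2 ^ (k - 1) = 2 ^ k * 2 ^ (k - 1)"
  proof -
    have "(2 * m choose 2) + m = 2 * m * m" for m :: nat
      by (cases m) (simp_all add: choose_two mult.assoc algebra_simps)
    then show ?thesis unfolding kk by simp
  qed
  have "\<beta> h g [^] ((2::nat) ^ k choose 2) \<otimes> \<beta> h g [^] ((2::nat) ^ (k - 1)) = \<one>"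
    using g h commutation_pow_ord_left[OF h g, of "2 ^ k * 2 ^ (k - 1)"]
    by (simp add: nat_pow_mult e[unfolded One_nat_def] oh)
  then have "\<beta> h g [^] ((2::nat) ^ k choose 2) = inv (\<beta> h g [^] ((2::nat) ^ (k - 1)))"
    using g h by (simp add: inv_equality)
  then have "\<beta> h g [^] (K.ord (g \<otimes>\<^bsub>K\<^esub> h) choose 2) = \<beta> g h [^] ((2::nat) ^ (k - 1))"
    using g h by (simp add: o commutation_swap[of h g] nat_pow_inv)
  moreover have "\<mu> (g \<otimes>\<^bsub>K\<^esub> h) = \<beta> h g [^] (K.ord (g \<otimes>\<^bsub>K\<^esub> h) choose 2) <#
      (powers U (\<mu> g) 1 <#> powers U (\<mu> h) 1)"
    by (intro order_coset_mult g h) (simp_all add: o og oh)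
  ultimately show ?thesis using powers_1 Pow_cosets_subset order_coset_Pow g h by metis
qed

end

section \<open>Torsion elements of direct products\<close>

context comm_group
begin

text \<open>Closure under products is available only for the orders in \<open>C\<close> and
  \<open>D\<close>, so powers need a detour. Write \<open>j = r + p * q\<close>. The
  \<open>p * q\<close>-th power is covered by induction, since \<open>w [^] p\<close> has smaller
  order. For \<open>0 < r < p\<close> all powers up to the \<open>r\<close>-th have the full order
  of \<open>w\<close>, so \<open>D\<close> allows multiplying by \<open>w\<close> one step at a
  time. Finally \<open>C\<close> joins the two factors, whose orders differ.\<close>

lemma power_mem_closure:
  assumes p: "prime (p::nat)"
    and A: "\<And>x n. \<lbrakk>x \<in> S; ord x > 0; n > 0; n dvd ord x\<rbrakk> \<Longrightarrow> x [^] (n::nat) \<in> S"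
    and C: "\<And>x y k l. \<lbrakk>x \<in> S; y \<in> S; ord x = p ^ k; ord y = p ^ l; l < k\<rbrakk> \<Longrightarrow> x \<otimes> y \<in> S"
    and D: "\<And>x y k. \<lbrakk>x \<in> S; y \<in> S; k \<ge> 1; ord x = p ^ k; ord y = p ^ k; ord (x \<otimes> y) = p ^ k\<rbrakk>
        \<Longrightarrow> x \<otimes> y \<in> S"
    and S: "S \<subseteq> carrier G" and w: "w \<in> S" "ord w = p ^ k"
  shows "w [^] (j::nat) \<in> S"
  using w
proof (induction k arbitrary: w j)
  case 0
  then show ?case using S ord_eq_1[of w] by auto
next
  case (Suc k)
  have wc: "w \<in> carrier G" using Suc.prems S by auto
  have p0: "p > 0" "p > 1" using p prime_gt_0_nat prime_gt_1_nat by auto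
  define q r where "q = j div p" and "r = j mod p"
  have j: "j = r + p * q" and rp: "r < p" using p0 by (simp_all add: q_def r_def)
  have wp: "w [^] p \<in> S" by (rule A) (use Suc.prems p0 in auto)
  have owp: "ord (w [^] p) = p ^ k" using ord_pow[OF wc, of p] Suc.prems(2) p0 by simp
  have wpq: "(w [^] p) [^] q \<in> S" using Suc.IH[OF wp owp] .
  have ord_wr: "ord (w [^] r) = p ^ Suc k" if "0 < r" "r < p" for r
  proof -
    have "coprime p r" using that p by (meson dvd_imp_le not_less prime_imp_coprime)
    then have "coprime (p ^ Suc k) r" by simp
    then have "gcd (p ^ Suc k) r = 1" by (simp only: coprime_iff_gcd_eq_1)
    moreover have "ord (w [^] r) = p ^ Suc k div gcd (p ^ Suc k) r"
      using ord_pow_gen[OF wc, of r] that(1) unfolding Suc.prems(2) by simp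
    ultimately show ?thesis by simp
  qed
  have wr: "w [^] r \<in> S" if "0 < r" "r < p" for r
    using that
  proof (induction r)
    case (Suc r)
    show ?case
    proof (cases "r = 0")
      case True
      then show ?thesis using wc \<open>w \<in> S\<close> by simp
    next
      case False
      have "w [^] r \<otimes> w \<in> S"
        by (rule D[of _ _ "Suc k"])
          (use False Suc.IH Suc.prems ord_wr[of r] ord_wr[of "Suc r"] \<open>w \<in> S\<close> \<open>ord w = _\<close> in auto)
      then show ?thesis by simp
    qed
  qed simp
  have wj: "w [^] j = w [^] r \<otimes> (w [^] p) [^] q" using wc by (simp add: j nat_pow_mult nat_pow_pow)
  show ?case
  proof (cases "r = 0")
    case True
    then show ?thesis using wj wpq wc by simp
  next
    case False
    have "((w [^] p) [^] q) [^] (p ^ k) = ((w [^] p) [^] (p ^ k)) [^] q"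
      using wc by (simp add: nat_pow_pow mult_ac)
    also have "\<dots> = \<one>" using wc pow_eq_id[of "w [^] p" "p ^ k"] owp by simp
    finally have "ord ((w [^] p) [^] q) dvd p ^ k" using wc pow_eq_id by simp
    then obtain l where l: "l \<le> k" "ord ((w [^] p) [^] q) = p ^ l"
      using divides_primepow_nat[OF p] by blast
    then show ?thesis unfolding wj
      using C[OF wr wpq ord_wr l(2)] False rp l(1) by simp
  qed
qed

lemma int_pow_mod_ord:
  assumes "g \<in> carrier G" shows "g [^] (i mod int (ord g)) = g [^] (i::int)"
  using assms int_pow_eq[of g "i mod int (ord g)" i] by (simp add: minus_mod_eq_mult_div)

text \<open>To be applied to the set of elements at which two families with (A)--(D) agree.\<close>
lemma torsion_closure:
  assumes sub: "subgroup H G" and g: "g \<in> carrier G"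
    and ind: "\<And>i::int. g [^] i \<in> H \<Longrightarrow> g [^] i = \<one>"
    and A: "\<And>x n. \<lbrakk>x \<in> S; ord x > 0; n > 0; n dvd ord x\<rbrakk> \<Longrightarrow> x [^] (n::nat) \<in> S"
    and B: "\<And>x y. \<lbrakk>x \<in> S; y \<in> S; ord x > 0; ord y > 0; coprime (ord x) (ord y)\<rbrakk> \<Longrightarrow> x \<otimes> y \<in> S"
    and C: "\<And>x y p k l. \<lbrakk>x \<in> S; y \<in> S; prime (p::nat); ord x = p ^ k; ord y = p ^ l; l < k\<rbrakk>
        \<Longrightarrow> x \<otimes> y \<in> S"
    and D: "\<And>x y p k. \<lbrakk>x \<in> S; y \<in> S; prime (p::nat); k \<ge> 1; ord x = p ^ k; ord y = p ^ k;
        ord (x \<otimes> y) = p ^ k\<rbrakk> \<Longrightarrow> x \<otimes> y \<in> S"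
    and S: "S \<subseteq> carrier G" and HS: "\<And>h. \<lbrakk>h \<in> H; ord h > 0\<rbrakk> \<Longrightarrow> h \<in> S"
    and gS: "ord g > 0 \<Longrightarrow> g \<in> S"
    and x: "x \<in> adjoin G H g" "ord x > 0"
  shows "x \<in> S"
proof -
  interpret H: subgroup H G by fact
  have sub': "subgroup (adjoin G H g) G" by (rule adjoin_subgroup[OF sub g])
  have oneS: "\<one> \<in> S" using HS[of \<one>] by simp
  have pp: "x \<in> S" if p: "prime (p::nat)" and x: "x \<in> adjoin G H g" "ord x = p ^ k" for x p k
  proof -
    have p0: "p > 0" using p prime_gt_0_nat by auto
    obtain u i where u: "u \<in> H" "x = u \<otimes> g [^] (i::int)" using x(1) by (rule adjoinE)
    define v where "v = g [^] i"
    have uc: "u \<in> carrier G" and vc: "v \<in> carrier G" using u g by (auto simp: v_def)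
    have xuv: "x = u \<otimes> v" using u by (simp add: v_def)
    \<comment> \<open>If the product is killed, then \<open>v [^] n\<close> is a power of
      \<open>g\<close> that lies in \<open>H\<close>, hence trivial; so the orders of
      \<open>u\<close> and \<open>v\<close> can be read off from that of \<open>x\<close>.\<close>
    have indep: "u [^] n = \<one> \<and> v [^] n = \<one>" if "x [^] n = \<one>" for n :: nat
    proof -
      have *: "u [^] n \<otimes> v [^] n = \<one>" using that uc vc by (simp add: xuv nat_pow_distrib)
      have "v [^] n = g [^] (i * int n)"
        unfolding v_def using g by (simp add: int_pow_pow flip: int_pow_int)
      moreover have "v [^] n \<in> H"
      proof -
        have "v [^] n = inv (u [^] n)" using * uc vc
          by (metis inv_equality m_comm nat_pow_closed)
        moreover have "u [^] n \<in> H"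
          using subgroup_int_pow_closed[OF sub u(1), of "int n"] by (simp add: int_pow_int)
        ultimately show ?thesis by simp
      qed
      ultimately have "v [^] n = \<one>" using ind by metis
      then show ?thesis using * uc by simp
    qed
    have "x [^] (p ^ k) = \<one>" using x(2) uc vc pow_eq_id[of x] xuv by simp
    then have "ord u dvd p ^ k" "ord v dvd p ^ k" using indep uc vc pow_eq_id by blast+
    then obtain a b where ab: "ord u = p ^ a" "ord v = p ^ b"
      using divides_primepow_nat[OF p] by blast
    have uS: "u \<in> S" using HS[OF u(1)] ab p0 by simp
    have vS: "v \<in> S"
    proof (cases "ord g = 0")
      \<comment> \<open>For \<open>g\<close> of infinite order a torsion element cannot involve
        \<open>g\<close>, so \<open>v\<close> is the identity.\<close>
      case True
      have "v [^] (p ^ b) = \<one>" using ab vc pow_eq_id by simp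
      moreover have "v [^] (p ^ b) = g [^] (i * int (p ^ b))"
        unfolding v_def using g by (simp add: int_pow_pow flip: int_pow_int)
      ultimately have "g [^] (i * int (p ^ b)) = \<one>" by metis
      then have "int (ord g) dvd i * int (p ^ b)" using int_pow_eq_id[OF g] by blast
      then have "i = 0" using True p0 by simp
      then show ?thesis using oneS by (simp add: v_def)
    next
      case False
      have "v [^] (ord g) = (g [^] int (ord g)) [^] i"
        unfolding v_def using g by (simp add: int_pow_pow mult.commute flip: int_pow_int)
      then have "v [^] (ord g) = \<one>" using g by (simp add: int_pow_int)
      then have "p ^ b dvd ord g" using vc ab pow_eq_id by metis
      \<comment> \<open>The cofactor \<open>m\<close> is chosen so that \<open>g [^] m\<close> has
        order exactly \<open>p ^ b\<close>; this power lies in \<open>S\<close> by \<open>A\<close>,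
        and \<open>v\<close> is a power of it.\<close>
      then obtain m where m: "ord g = p ^ b * m" ..
      then have m0: "m > 0" using False by (cases m) auto
      have wS: "g [^] m \<in> S" by (rule A[OF gS]) (use False m m0 in auto)
      have ow: "ord (g [^] m) = p ^ b" using ord_pow[OF g, of m] m m0 by simp
      have "v [^] (p ^ b) = g [^] (i * int (p ^ b))"
        unfolding v_def using g by (simp add: int_pow_pow flip: int_pow_int)
      moreover have "v [^] (p ^ b) = \<one>" using ab vc pow_eq_id by simp
      ultimately have "int (ord g) dvd i * int (p ^ b)" using int_pow_eq_id[OF g] by metis
      then have "int m dvd i" using m p0 by (simp add: mult.commute)
      then obtain j where j: "i = int m * j" ..
      have "v = (g [^] m) [^] j" unfolding v_def j using g by (simp add: int_pow_pow flip: int_pow_int)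
      also have "\<dots> = (g [^] m) [^] (j mod int (p ^ b))"
        using int_pow_mod_ord[of "g [^] m" j] g ow by simp
      also have "\<dots> = (g [^] m) [^] nat (j mod int (p ^ b))" using p0 by (simp flip: int_pow_int)
      also have "\<dots> \<in> S" by (rule power_mem_closure[OF p A C D S wS ow]) (use p in auto)
      finally show ?thesis .
    qed
    \<comment> \<open>Different orders call for \<open>C\<close>, with the factor of larger order in
      front. For equal orders \<open>D\<close> also needs the order of the product, which
      \<open>indep\<close> supplies.\<close>
    consider "b < a" | "a < b" | "a = b" "a = 0" | "a = b" "a \<ge> 1" by linarith
    then show "x \<in> S"
    proof cases
      case 1 then show ?thesis unfolding xuv by (intro C[OF uS vS p ab])
    next
      case 2
      have "v \<otimes> u \<in> S" by (rule C[OF vS uS p ab(2,1) 2])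
      then show ?thesis using uc vc by (simp add: xuv m_comm)
    next
      case 3
      then show ?thesis using ab uc vc ord_eq_1 oneS xuv by simp
    next
      case 4
      have "ord x dvd p ^ a"
        using pow_eq_id[of x "p ^ a"] pow_eq_id[OF uc, of "p ^ a"] pow_eq_id[OF vc, of "p ^ a"] ab uc vc 4
        by (simp add: xuv nat_pow_distrib)
      moreover have "p ^ a dvd ord x"
        using indep[of "ord x"] uc vc ab pow_eq_id[OF uc] by (simp add: xuv)
      ultimately have "ord x = p ^ a" by (rule dvd_antisym)
      then show ?thesis unfolding xuv by (intro D[OF uS vS p 4(2)]) (use ab 4 in auto)
    qed
  qed
  show ?thesis using x
  proof (induction "ord x" arbitrary: x rule: less_induct)
    case less
    have xc: "x \<in> carrier G" using less.prems(1) subgroup.mem_carrier[OF sub'] by blast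
    show ?case
    proof (cases "ord x = 1")
      case True
      then show ?thesis using oneS ord_eq_1 xc by simp
    next
      case False
      then obtain p where p: "prime p" "p dvd ord x" using prime_factor_nat by blast
      define a where "a = multiplicity p (ord x)"
      obtain m where m: "ord x = p ^ a * m" "\<not> p dvd m"
        unfolding a_def using multiplicity_decompose'[of "ord x" p] less.prems(2) p(1)
        by (metis neq0_conv not_prime_unit)
      have a0: "a \<noteq> 0" using m p(2) by (cases a) auto
      have m0: "m > 0" using m less.prems(2) by (cases m) auto
      have "1 < p ^ a" using a0 p(1) by (metis one_less_power prime_gt_1_nat neq0_conv)
      then have mlt: "m < ord x" using m(1) m0 by simp
      have cop: "coprime (p ^ a) m" using m(2) p(1) by (simp add: prime_imp_coprime)
      then have "coprime (int m) (int (p ^ a))" by (simp only: coprime_int_iff coprime_commute)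
      \<comment> \<open>The Bezout coefficients split \<open>x\<close> into its
        \<open>p\<close>-part \<open>y\<close> and a part \<open>z\<close> of order prime to
        \<open>p\<close>. The order of \<open>z\<close> is smaller than that of \<open>x\<close>, so
        induction applies to it, and \<open>B\<close> rejoins the two parts.\<close>
      then obtain c d where cd: "c * int m + d * int (p ^ a) = 1"
        using bezout_int[of "int m" "int (p ^ a)"] by (auto simp: coprime_iff_gcd_eq_1)
      define y z where "y = x [^] (c * int m)" and "z = x [^] (d * int (p ^ a))"
      have yz: "x = y \<otimes> z" using xc cd by (simp add: y_def z_def flip: int_pow_mult)
      have mem: "y \<in> adjoin G H g" "z \<in> adjoin G H g"
        unfolding y_def z_def using subgroup_int_pow_closed[OF sub' less.prems(1)] by blast+
      have car: "y \<in> carrier G" "z \<in> carrier G" using xc by (auto simp: y_def z_def)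
      have "y [^] (p ^ a) = x [^] (int (ord x) * c)"
        unfolding y_def using xc m(1) by (simp add: int_pow_pow mult_ac flip: int_pow_int)
      also have "\<dots> = \<one>" using int_pow_eq_id[OF xc] by simp
      finally have oy: "ord y dvd p ^ a" using car pow_eq_id by blast
      have "z [^] m = x [^] (int (ord x) * d)"
        unfolding z_def using xc m(1) by (simp add: int_pow_pow mult_ac flip: int_pow_int)
      also have "\<dots> = \<one>" using int_pow_eq_id[OF xc] by simp
      finally have oz: "ord z dvd m" using car pow_eq_id by blast
      obtain k where k: "ord y = p ^ k" using oy divides_primepow_nat[OF p(1)] by blast
      have "y \<in> S" using pp[OF p(1) mem(1) k] .
      moreover have oz': "ord z > 0" "ord z < ord x"
        using oz m0 mlt dvd_imp_le[OF oz] by (auto intro!: Nat.gr0I)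
      then have "z \<in> S" using less.hyps mem(2) by blast
      moreover have "ord y > 0" using k p(1) prime_gt_0_nat by simp
      moreover have "coprime (ord y) (ord z)" using cop oy oz coprime_divisors by blast
      ultimately show ?thesis unfolding yz using B oz'(1) by blast
    qed
  qed
qed

text \<open>Reducing exponents modulo the order of \<open>g\<close> makes them unique. For infinite
  order the modulus is 0, and \<open>i mod 0 = i\<close> gives the right convention.\<close>

lemma adjoin_coordinates:
  assumes sub: "subgroup H G" and g: "g \<in> carrier G"
    and ind: "\<And>i::int. g [^] i \<in> H \<Longrightarrow> g [^] i = \<one>"
  obtains pr e where
    "\<And>x. x \<in> adjoin G H g \<Longrightarrow> pr x \<in> H" and
    "\<And>x. x \<in> adjoin G H g \<Longrightarrow> x = pr x \<otimes> g [^] (e x :: int)" and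
    "\<And>h i. h \<in> H \<Longrightarrow> pr (h \<otimes> g [^] (i::int)) = h" and
    "\<And>h i. h \<in> H \<Longrightarrow> e (h \<otimes> g [^] (i::int)) = i mod int (ord g)"
proof -
  interpret H: subgroup H G by fact
  have "\<forall>x\<in>adjoin G H g. \<exists>h i. h \<in> H \<and> x = h \<otimes> g [^] (i::int)" by (blast elim: adjoinE)
  then obtain pr f where prfx: "\<And>x. x \<in> adjoin G H g \<Longrightarrow> pr x \<in> H \<and> x = pr x \<otimes> g [^] (f x :: int)"
    by metis
  have uniq: "h = h' \<and> int (ord g) dvd j - i"
    if h: "h \<in> H" "h' \<in> H" and eq: "h \<otimes> g [^] i = h' \<otimes> g [^] j" for h h' and i j :: int
  proof -
    have car: "h \<in> carrier G" "h' \<in> carrier G" using h by auto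
    have "inv h' \<otimes> h = inv h' \<otimes> (h \<otimes> g [^] i) \<otimes> g [^] (- i)"
      using car g by (simp add: m_assoc int_pow_neg)
    also have "\<dots> = g [^] (j - i)"
      unfolding eq using car g by (simp add: m_assoc[symmetric] int_pow_neg int_pow_diff)
    finally have *: "inv h' \<otimes> h = g [^] (j - i)" .
    then have "g [^] (j - i) \<in> H" using h by (metis H.m_closed H.m_inv_closed)
    then have 1: "g [^] (j - i) = \<one>" by (rule ind)
    then have "h = h'" using * car by (metis inv_equality inv_inv inv_closed)
    moreover have "int (ord g) dvd j - i" using 1 int_pow_eq_id[OF g] by blast
    ultimately show ?thesis by blast
  qed
  show thesis
  proof (rule that[of pr "\<lambda>x. f x mod int (ord g)"])
    show "pr x \<in> H" if "x \<in> adjoin G H g" for x using prfx that by blast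
    show "x = pr x \<otimes> g [^] (f x mod int (ord g))" if "x \<in> adjoin G H g" for x
      using prfx[OF that] int_pow_mod_ord[OF g] by metis
    fix h and i :: int assume h: "h \<in> H"
    then have *: "h \<otimes> g [^] i \<in> adjoin G H g" by (rule adjoinI)
    from uniq[OF h _ conjunct2[OF prfx[OF *]]] prfx[OF *]
    have "h = pr (h \<otimes> g [^] i)" "int (ord g) dvd f (h \<otimes> g [^] i) - i" by blast+
    then show "pr (h \<otimes> g [^] i) = h" "f (h \<otimes> g [^] i) mod int (ord g) = i mod int (ord g)"
      by (simp_all add: mod_eq_dvd_iff)
  qed
qed

end

section \<open>Extending cocycles\<close>

lemma (in comm_group) subgroup_comm_group:
  "subgroup H G \<Longrightarrow> comm_group (G\<lparr>carrier := H\<rparr>)"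
  by (rule group.group_comm_groupI[OF subgroup_imp_group])
     (auto simp: m_comm subgroup.mem_carrier)

lemma nat_pow_carrier_update: "x [^]\<^bsub>G\<lparr>carrier := H\<rparr>\<^esub> (n::nat) = x [^]\<^bsub>G\<^esub> n"
  by (simp add: nat_pow_def)

lemma (in group) ord_carrier_update:
  "subgroup H G \<Longrightarrow> group.ord (G\<lparr>carrier := H\<rparr>) x = ord x"
  using subgroup_imp_group
  by (simp add: group.ord_def ord_def nat_pow_carrier_update)

text \<open>Powers look only at multiplication and unit, not at the carrier, so a cocycle on a
  subgroup may be evaluated in the twist over the whole of \<open>K\<close>.\<close>

lemma twist_pow_carrier_update:
  "x [^]\<^bsub>twist U (K\<lparr>carrier := H\<rparr>) \<alpha>\<^esub> (n::nat) = x [^]\<^bsub>twist U K \<alpha>\<^esub> n"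
  by (simp add: nat_pow_def twist_def)

lemma (in group) order_coset_carrier_update:
  "subgroup H G \<Longrightarrow> order_coset U (G\<lparr>carrier := H\<rparr>) \<alpha> x = order_coset U G \<alpha> x"
  by (simp add: order_coset_def ord_carrier_update twist_pow_carrier_update)

text \<open>The degrees of the powers stay in \<open>H\<close>, so only the values of the cocycle on
  \<open>H\<close> are ever used.\<close>

lemma twist_pow_cong:
  assumes K: "group K" and sub: "subgroup H K" and eq: "\<And>s t. \<lbrakk>s \<in> H; t \<in> H\<rbrakk> \<Longrightarrow> \<alpha> s t = \<alpha>' s t"
    and t: "t \<in> H"
  shows "(b, t) [^]\<^bsub>twist U K \<alpha>\<^esub> (n::nat) = (b, t) [^]\<^bsub>twist U K \<alpha>'\<^esub> n \<and>
         snd ((b, t) [^]\<^bsub>twist U K \<alpha>\<^esub> n) \<in> H"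
proof (induction n)
  case 0
  then show ?case using subgroup.one_closed[OF sub] by simp
next
  case (Suc n)
  obtain c s where cs: "(b, t) [^]\<^bsub>twist U K \<alpha>\<^esub> n = (c, s)" by force
  then show ?case using Suc t eq[of s t] subgroup.m_closed[OF sub, of s t] by auto
qed

lemma order_coset_cong:
  assumes "group K" "subgroup H K" "\<And>s t. \<lbrakk>s \<in> H; t \<in> H\<rbrakk> \<Longrightarrow> \<alpha> s t = \<alpha>' s t" "t \<in> H"
  shows "order_coset U K \<alpha> t = order_coset U K \<alpha>' t"
  using twist_pow_cong[OF assms(1,2), where \<alpha> = \<alpha> and \<alpha>' = \<alpha>' and t = t and U = U] assms(3,4) unfolding order_coset_def by simp

text \<open>Used twice: to assemble an extended cocycle from three simpler ones, and to form the
  quotient of two cocycles.\<close>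

lemma cocycle_mult:
  assumes "cocycle U K \<alpha>" "cocycle U K \<alpha>'"
  shows "cocycle U K (\<lambda>s t. \<alpha> s t \<otimes>\<^bsub>U\<^esub> \<alpha>' s t)"
proof -
  interpret a: cocycle U K \<alpha> by fact
  interpret b: cocycle U K \<alpha>' by fact
  show ?thesis
  proof
    fix s t u assume c: "s \<in> carrier K" "t \<in> carrier K" "u \<in> carrier K"
    have "\<alpha> s t \<otimes>\<^bsub>U\<^esub> \<alpha>' s t \<otimes>\<^bsub>U\<^esub> (\<alpha> (s \<otimes>\<^bsub>K\<^esub> t) u \<otimes>\<^bsub>U\<^esub> \<alpha>' (s \<otimes>\<^bsub>K\<^esub> t) u) =
      (\<alpha> s t \<otimes>\<^bsub>U\<^esub> \<alpha> (s \<otimes>\<^bsub>K\<^esub> t) u) \<otimes>\<^bsub>U\<^esub> (\<alpha>' s t \<otimes>\<^bsub>U\<^esub> \<alpha>' (s \<otimes>\<^bsub>K\<^esub> t) u)"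
      using c by (simp add: a.m_ac)
    also have "\<dots> = \<alpha> t u \<otimes>\<^bsub>U\<^esub> \<alpha>' t u \<otimes>\<^bsub>U\<^esub> (\<alpha> s (t \<otimes>\<^bsub>K\<^esub> u) \<otimes>\<^bsub>U\<^esub> \<alpha>' s (t \<otimes>\<^bsub>K\<^esub> u))"
      unfolding a.assoc[OF c] b.assoc[OF c] using c by (simp add: a.m_ac)
    finally show "\<alpha> s t \<otimes>\<^bsub>U\<^esub> \<alpha>' s t \<otimes>\<^bsub>U\<^esub> (\<alpha> (s \<otimes>\<^bsub>K\<^esub> t) u \<otimes>\<^bsub>U\<^esub> \<alpha>' (s \<otimes>\<^bsub>K\<^esub> t) u) =
      \<alpha> t u \<otimes>\<^bsub>U\<^esub> \<alpha>' t u \<otimes>\<^bsub>U\<^esub> (\<alpha> s (t \<otimes>\<^bsub>K\<^esub> u) \<otimes>\<^bsub>U\<^esub> \<alpha>' s (t \<otimes>\<^bsub>K\<^esub> u))" .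
  qed auto
qed

section \<open>Bicharacters\<close>

locale bicharacter = U?: comm_group U + K: comm_group K for U (structure) and K +
  fixes b :: "'c \<Rightarrow> 'c \<Rightarrow> 'a"
  assumes closed [simp, intro]:
      "\<lbrakk>s \<in> carrier K; t \<in> carrier K\<rbrakk> \<Longrightarrow> b s t \<in> carrier U"
    and mult_left: "\<lbrakk>s \<in> carrier K; t \<in> carrier K; u \<in> carrier K\<rbrakk> \<Longrightarrow>
      b (s \<otimes>\<^bsub>K\<^esub> t) u = b s u \<otimes> b t u"
    and mult_right: "\<lbrakk>s \<in> carrier K; t \<in> carrier K; u \<in> carrier K\<rbrakk> \<Longrightarrow>
      b u (s \<otimes>\<^bsub>K\<^esub> t) = b u s \<otimes> b u t"
begin

lemma one_left [simp]: "t \<in> carrier K \<Longrightarrow> b \<one>\<^bsub>K\<^esub> t = \<one>"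
  using mult_left[of "\<one>\<^bsub>K\<^esub>" "\<one>\<^bsub>K\<^esub>" t] by simp

lemma one_right [simp]: "t \<in> carrier K \<Longrightarrow> b t \<one>\<^bsub>K\<^esub> = \<one>"
  using mult_right[of "\<one>\<^bsub>K\<^esub>" "\<one>\<^bsub>K\<^esub>" t] by simp

lemma pow_left: "\<lbrakk>s \<in> carrier K; t \<in> carrier K\<rbrakk> \<Longrightarrow> b (s [^]\<^bsub>K\<^esub> (n::nat)) t = b s t [^] n"
  by (induction n) (simp_all add: mult_left)

lemma inv_left:
  assumes "s \<in> carrier K" "t \<in> carrier K" shows "b (inv\<^bsub>K\<^esub> s) t = inv (b s t)"
proof -
  have "b (inv\<^bsub>K\<^esub> s) t \<otimes> b s t = \<one>" using mult_left[of "inv\<^bsub>K\<^esub> s" s t] assms by simp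
  then have "inv (b s t) = b (inv\<^bsub>K\<^esub> s) t" by (rule inv_equality) (use assms in auto)
  then show ?thesis by simp
qed

lemma int_pow_left:
  assumes "s \<in> carrier K" "t \<in> carrier K" shows "b (s [^]\<^bsub>K\<^esub> (i::int)) t = b s t [^] i"
proof (cases i rule: int_cases2)
  case (nonneg n)
  then show ?thesis using assms by (simp add: int_pow_int pow_left)
next
  case (nonpos n)
  then show ?thesis using assms by (simp add: int_pow_neg K.int_pow_neg int_pow_int pow_left inv_left)
qed

end

locale alternating = bicharacter +
  assumes self [simp]: "t \<in> carrier K \<Longrightarrow> b t t = \<one>"
begin

text \<open>Polarization: expand the trivial value at
  \<open>(s \<otimes> t, s \<otimes> t)\<close>.\<close>

lemma swap:
  assumes "s \<in> carrier K" "t \<in> carrier K" shows "b s t \<otimes> b t s = \<one>"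
proof -
  have "\<one> = b s (s \<otimes>\<^bsub>K\<^esub> t) \<otimes> b t (s \<otimes>\<^bsub>K\<^esub> t)"
    using mult_left[of s t "s \<otimes>\<^bsub>K\<^esub> t"] assms by simp
  then show ?thesis using assms by (simp add: mult_right m_comm)
qed

lemma int_pow_right:
  assumes "s \<in> carrier K" "t \<in> carrier K" shows "b s (t [^]\<^bsub>K\<^esub> (i::int)) = b s t [^] i"
proof -
  have inv: "b u v = inv (b v u)" if "u \<in> carrier K" "v \<in> carrier K" for u v
    using inv_equality[OF swap[OF that]] that by simp
  show ?thesis using assms by (simp add: inv[of s] int_pow_left int_pow_inv)
qed

lemma restrict_subgroup:
  assumes "subgroup H K" shows "alternating U (K\<lparr>carrier := H\<rparr>) b"
proof -
  interpret H: subgroup H K by fact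
  interpret KH: comm_group "K\<lparr>carrier := H\<rparr>" by (rule K.subgroup_comm_group[OF assms])
  show ?thesis by unfold_locales (simp_all add: mult_left mult_right)
qed

end

text \<open>Given \<open>X\<^sub>u\<close> for \<open>u \<in> H\<close> and an element \<open>Y\<close> of degree \<open>g\<close> with \<open>Y\<^sup>n = c\<close>, the cocycle below belongs to
  the basis \<open>X\<^sub>u Y\<^sup>i\<close>, \<open>0 \<le> i < n\<close>; the quotient by \<open>n = ord g\<close> is the carry of \<open>i + j\<close>. If \<open>g\<close> has
  infinite order then \<open>n = 0\<close>, and there is no carry since \<open>x div 0 = 0\<close>.\<close>
lemma cocycle_extend:
  assumes K: "comm_group K" and sub: "subgroup H K" and g: "g \<in> carrier K" "g \<noteq> \<one>\<^bsub>K\<^esub>"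
    and ind: "\<And>i::int. g [^]\<^bsub>K\<^esub> i \<in> H \<Longrightarrow> g [^]\<^bsub>K\<^esub> i = \<one>\<^bsub>K\<^esub>"
    and \<alpha>: "cocycle U (K\<lparr>carrier := H\<rparr>) \<alpha>" and b: "alternating U K b"
    and ab: "\<And>s t. \<lbrakk>s \<in> H; t \<in> H\<rbrakk> \<Longrightarrow> \<alpha> s t = b s t \<otimes>\<^bsub>U\<^esub> \<alpha> t s"
    and c: "c \<in> carrier U"
  obtains \<alpha>' where "cocycle U (K\<lparr>carrier := adjoin K H g\<rparr>) \<alpha>'"
    and "\<And>s t. \<lbrakk>s \<in> adjoin K H g; t \<in> adjoin K H g\<rbrakk> \<Longrightarrow> \<alpha>' s t = b s t \<otimes>\<^bsub>U\<^esub> \<alpha>' t s"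
    and "\<And>s t. \<lbrakk>s \<in> H; t \<in> H\<rbrakk> \<Longrightarrow> \<alpha>' s t = \<alpha> s t"
    and "group.ord K g > 0 \<Longrightarrow>
      (\<one>\<^bsub>U\<^esub>, g) [^]\<^bsub>twist U K \<alpha>'\<^esub> group.ord K g = (c, \<one>\<^bsub>K\<^esub>)"
proof -
  interpret K: comm_group K by fact
  interpret H: subgroup H K by fact
  interpret b: alternating U K b by fact
  interpret \<alpha>: cocycle U "K\<lparr>carrier := H\<rparr>" \<alpha> by fact
  let ?n = "int (K.ord g)" and ?H' = "adjoin K H g"
  have sub': "subgroup ?H' K" by (rule K.adjoin_subgroup[OF sub g(1)])
  interpret H': subgroup ?H' K by (rule sub')
  interpret KH': comm_group "K\<lparr>carrier := ?H'\<rparr>" by (rule K.subgroup_comm_group[OF sub'])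
  obtain pr e where pr: "\<And>x. x \<in> ?H' \<Longrightarrow> pr x \<in> H"
    and xeq: "\<And>x. x \<in> ?H' \<Longrightarrow> x = pr x \<otimes>\<^bsub>K\<^esub> g [^]\<^bsub>K\<^esub> (e x :: int)"
    and pre: "\<And>h i. h \<in> H \<Longrightarrow> pr (h \<otimes>\<^bsub>K\<^esub> g [^]\<^bsub>K\<^esub> (i::int)) = h"
    and ee: "\<And>h i. h \<in> H \<Longrightarrow> e (h \<otimes>\<^bsub>K\<^esub> g [^]\<^bsub>K\<^esub> (i::int)) = i mod ?n"
    using K.adjoin_coordinates[OF sub g(1) ind] by blast
  have xy: "x \<otimes>\<^bsub>K\<^esub> y = (pr x \<otimes>\<^bsub>K\<^esub> pr y) \<otimes>\<^bsub>K\<^esub> g [^]\<^bsub>K\<^esub> (e x + e y)" if "x \<in> ?H'" "y \<in> ?H'" for x y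
    using K.adjoin_mult[of "pr x" "pr y" g "e x" "e y"] xeq[OF that(1)] xeq[OF that(2)] pr that g by simp
  have prm: "pr (x \<otimes>\<^bsub>K\<^esub> y) = pr x \<otimes>\<^bsub>K\<^esub> pr y" if "x \<in> ?H'" "y \<in> ?H'" for x y
    unfolding xy[OF that] using pre pr that by simp
  have em: "e (x \<otimes>\<^bsub>K\<^esub> y) = (e x + e y) mod ?n" if "x \<in> ?H'" "y \<in> ?H'" for x y
    unfolding xy[OF that] using ee pr that by simp
  have prH: "pr h = h" "e h = 0" if "h \<in> H" for h
    using pre[OF that, of 0] ee[OF that, of 0] that by simp_all
  have HH': "H \<subseteq> ?H'" "g \<in> ?H'" using K.adjoin_superset[OF sub g(1)] by auto
  have gpow: "g [^]\<^bsub>K\<^esub> e (x \<otimes>\<^bsub>K\<^esub> y) = g [^]\<^bsub>K\<^esub> e x \<otimes>\<^bsub>K\<^esub> g [^]\<^bsub>K\<^esub> e y" if "x \<in> ?H'" "y \<in> ?H'" for x y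
    using em[OF that] K.int_pow_mod_ord[OF g(1)] K.int_pow_mult[OF g(1)] by simp
  \<comment> \<open>The three factors arise when two basis elements are multiplied:
    \<open>\<alpha>2\<close> from moving the power of \<open>Y\<close> past the second element of
    degree in \<open>H\<close>, \<open>\<alpha>1\<close> from multiplying the two elements of degree
    in \<open>H\<close>, and \<open>\<alpha>3\<close> from reducing the power of
    \<open>Y\<close>.\<close>
  define \<alpha>1 where "\<alpha>1 s t = \<alpha> (pr s) (pr t)" for s t
  define \<alpha>2 where "\<alpha>2 s t = b (g [^]\<^bsub>K\<^esub> e s) (pr t)" for s t
  define \<alpha>3 where "\<alpha>3 s t = c [^]\<^bsub>U\<^esub> ((e s + e t) div ?n)" for s t
  define \<alpha>' where "\<alpha>' s t = \<alpha>1 s t \<otimes>\<^bsub>U\<^esub> \<alpha>2 s t \<otimes>\<^bsub>U\<^esub> \<alpha>3 s t" for s t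
  have prK: "pr x \<in> carrier K" if "x \<in> ?H'" for x using pr[OF that] by simp
  have "cocycle U (K\<lparr>carrier := ?H'\<rparr>) \<alpha>1"
    by unfold_locales (use \<alpha>.assoc \<alpha>.one_one in \<open>auto simp: \<alpha>1_def prm pr prH\<close>)
  \<comment> \<open>Both coordinates are multiplicative, so \<open>\<alpha>2\<close> is a
    bicharacter, and every bicharacter is a cocycle.\<close>
  moreover have "cocycle U (K\<lparr>carrier := ?H'\<rparr>) \<alpha>2"
  proof unfold_locales
    fix s t u assume "s \<in> carrier (K\<lparr>carrier := ?H'\<rparr>)" "t \<in> carrier (K\<lparr>carrier := ?H'\<rparr>)"
      "u \<in> carrier (K\<lparr>carrier := ?H'\<rparr>)"
    then show "\<alpha>2 s t \<otimes>\<^bsub>U\<^esub> \<alpha>2 (s \<otimes>\<^bsub>K\<lparr>carrier := ?H'\<rparr>\<^esub> t) u =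
       \<alpha>2 t u \<otimes>\<^bsub>U\<^esub> \<alpha>2 s (t \<otimes>\<^bsub>K\<lparr>carrier := ?H'\<rparr>\<^esub> u)"
      using g prK by (simp add: \<alpha>2_def gpow prm b.mult_left b.mult_right b.m_ac)
  qed (use prK g in \<open>auto simp: \<alpha>2_def prH\<close>)
  moreover have "cocycle U (K\<lparr>carrier := ?H'\<rparr>) \<alpha>3"
  proof unfold_locales
    fix s t u assume stu: "s \<in> carrier (K\<lparr>carrier := ?H'\<rparr>)" "t \<in> carrier (K\<lparr>carrier := ?H'\<rparr>)"
      "u \<in> carrier (K\<lparr>carrier := ?H'\<rparr>)"
    \<comment> \<open>Either way of bracketing three summands produces the same total carry.\<close>
    have carry: "(x + y) div m + ((x + y) mod m + z) div m = (x + y + z) div m" for x y z m :: int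
    proof (cases "m = 0")
      case False
      have "x + y + z = ((x + y) mod m + z) + (x + y) div m * m" by simp
      then show ?thesis using False by (metis add.commute div_mult_self1)
    qed simp
    have "(e s + e t) div ?n + (e (s \<otimes>\<^bsub>K\<^esub> t) + e u) div ?n = (e s + e t + e u) div ?n"
      using stu by (simp add: em carry)
    moreover have "(e t + e u) div ?n + (e s + e (t \<otimes>\<^bsub>K\<^esub> u)) div ?n = (e s + e t + e u) div ?n"
      using stu carry[of "e t" "e u" ?n "e s"] by (simp add: em add_ac)
    ultimately show "\<alpha>3 s t \<otimes>\<^bsub>U\<^esub> \<alpha>3 (s \<otimes>\<^bsub>K\<lparr>carrier := ?H'\<rparr>\<^esub> t) u =
       \<alpha>3 t u \<otimes>\<^bsub>U\<^esub> \<alpha>3 s (t \<otimes>\<^bsub>K\<lparr>carrier := ?H'\<rparr>\<^esub> u)"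
      using c by (simp add: \<alpha>3_def flip: b.int_pow_mult)
  qed (use c in \<open>auto simp: \<alpha>3_def prH\<close>)
  ultimately have coc: "cocycle U (K\<lparr>carrier := ?H'\<rparr>) \<alpha>'"
    unfolding \<alpha>'_def by (intro cocycle_mult)
  \<comment> \<open>The fourth factor of the expansion pairs two powers of \<open>g\<close> and is
    trivial because \<open>b\<close> is alternating.\<close>
  have bs: "b s t = b (pr s) (pr t) \<otimes>\<^bsub>U\<^esub> (b (g [^]\<^bsub>K\<^esub> e s) (pr t) \<otimes>\<^bsub>U\<^esub> b (pr s) (g [^]\<^bsub>K\<^esub> e t))"
    if "s \<in> ?H'" "t \<in> ?H'" for s t
  proof -
    have "b s t = b (pr s \<otimes>\<^bsub>K\<^esub> g [^]\<^bsub>K\<^esub> e s) (pr t \<otimes>\<^bsub>K\<^esub> g [^]\<^bsub>K\<^esub> e t)" using xeq that by metis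
    then show ?thesis using that prK g
      by (simp add: b.mult_left b.mult_right b.int_pow_left b.int_pow_right b.m_ac)
  qed
  have comm: "\<alpha>' s t = b s t \<otimes>\<^bsub>U\<^esub> \<alpha>' t s" if st: "s \<in> ?H'" "t \<in> ?H'" for s t
  proof -
    have *: "b (pr s) (g [^]\<^bsub>K\<^esub> e t) \<otimes>\<^bsub>U\<^esub> b (g [^]\<^bsub>K\<^esub> e t) (pr s) = \<one>\<^bsub>U\<^esub>"
      using b.swap st prK g by simp
    have **: "\<alpha>3 t s = \<alpha>3 s t" by (simp add: \<alpha>3_def add.commute)
    have car: "\<alpha> (pr t) (pr s) \<in> carrier U" "\<alpha>3 s t \<in> carrier U" using st pr c by (auto simp: \<alpha>3_def)
    have "b s t \<otimes>\<^bsub>U\<^esub> \<alpha>' t s = (b (pr s) (pr t) \<otimes>\<^bsub>U\<^esub> \<alpha> (pr t) (pr s)) \<otimes>\<^bsub>U\<^esub> b (g [^]\<^bsub>K\<^esub> e s) (pr t) \<otimes>\<^bsub>U\<^esub> \<alpha>3 s t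
      \<otimes>\<^bsub>U\<^esub> (b (pr s) (g [^]\<^bsub>K\<^esub> e t) \<otimes>\<^bsub>U\<^esub> b (g [^]\<^bsub>K\<^esub> e t) (pr s))"
      unfolding bs[OF st] \<alpha>'_def \<alpha>1_def \<alpha>2_def ** using st prK g car by (simp add: b.m_ac)
    then show ?thesis
      unfolding * \<alpha>'_def \<alpha>1_def \<alpha>2_def using ab[OF pr pr, OF st] st prK g car by simp
  qed
  have ext: "\<alpha>' s t = \<alpha> s t" if "s \<in> H" "t \<in> H" for s t
    using that \<alpha>.closed[of s t] by (simp add: \<alpha>'_def \<alpha>1_def \<alpha>2_def \<alpha>3_def prH)
  have ordg: "(\<one>\<^bsub>U\<^esub>, g) [^]\<^bsub>twist U K \<alpha>'\<^esub> K.ord g = (c, \<one>\<^bsub>K\<^esub>)" if "K.ord g > 0"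
  proof -
    \<comment> \<open>Here \<open>g\<close> being different from the identity matters: for order 1
      the exponent \<open>e g\<close> would be \<open>1 mod 1 = 0\<close> and not 1.\<close>
    have n2: "K.ord g \<ge> 2" using that g K.ord_eq_1[of g] by linarith
    have gj: "g [^]\<^bsub>K\<^esub> (j::nat) \<in> ?H'" "pr (g [^]\<^bsub>K\<^esub> j) = \<one>\<^bsub>K\<^esub>" "e (g [^]\<^bsub>K\<^esub> j) = int j mod ?n" for j
      using adjoinI[OF H.one_closed, of K g "int j"] pre[OF H.one_closed, of "int j"]
        ee[OF H.one_closed, of "int j"] g by (simp_all add: int_pow_int)
    have g1: "pr g = \<one>\<^bsub>K\<^esub>" "e g = 1" using gj(2,3)[of 1] g n2 by simp_all
    \<comment> \<open>The carry occurs only in the last multiplication, so the scalar stays trivial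
      until the exponent reaches the order of \<open>g\<close>, where \<open>c\<close>
      appears.\<close>
    have \<alpha>'g: "\<alpha>' (g [^]\<^bsub>K\<^esub> j) g = (if Suc j = K.ord g then c else \<one>\<^bsub>U\<^esub>)" if "j < K.ord g" for j
    proof -
      have "(int j + 1) div ?n = (if Suc j = K.ord g then 1 else 0)"
      proof (cases "Suc j = K.ord g")
        case True
        then have "int j + 1 = ?n" by linarith
        then show ?thesis unfolding \<open>int j + 1 = ?n\<close> using True n2 by simp
      qed (use that in \<open>simp add: div_pos_pos_trivial\<close>)
      then show ?thesis using g c that \<alpha>.one_one
        by (simp add: \<alpha>'_def \<alpha>1_def \<alpha>2_def \<alpha>3_def gj g1)
    qed
    have "(\<one>\<^bsub>U\<^esub>, g) [^]\<^bsub>twist U K \<alpha>'\<^esub> j = (\<one>\<^bsub>U\<^esub>, g [^]\<^bsub>K\<^esub> j)" if "j < K.ord g" for j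
      using that by (induction j) (simp_all add: \<alpha>'g)
    note pow = this
    obtain m where m: "K.ord g = Suc m" using \<open>K.ord g > 0\<close> gr0_conv_Suc by blast
    have "(\<one>\<^bsub>U\<^esub>, g) [^]\<^bsub>twist U K \<alpha>'\<^esub> Suc m = (c, g [^]\<^bsub>K\<^esub> Suc m)"
      using pow[of m] \<alpha>'g[of m] m c by simp
    moreover have "g [^]\<^bsub>K\<^esub> Suc m = \<one>\<^bsub>K\<^esub>" using g m K.pow_ord_eq_1 by metis
    ultimately show ?thesis by (simp only: m)
  qed
  show thesis by (rule that[OF coc comm ext ordg])
qed

section \<open>Existence of a cocycle\<close>

text \<open>Conditions (A)--(D) for an abelian group \<open>U\<close> in place of the units of a
  field. Torsion is expressed by positive order, and values of \<mu> elsewhere are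
  unconstrained.\<close>

locale order_family = alternating U K b for U (structure) and K and b +
  fixes \<mu> :: "'c \<Rightarrow> 'a set"
  assumes coset: "\<lbrakk>t \<in> carrier K; K.ord t > 0\<rbrakk> \<Longrightarrow> \<mu> t \<in> Pow_cosets (K.ord t)"
    and pow: "\<lbrakk>g \<in> carrier K; K.ord g > 0; n > 0; n dvd K.ord g\<rbrakk> \<Longrightarrow>
      \<mu> (g [^]\<^bsub>K\<^esub> (n::nat)) = Pow_subgroup (K.ord g div n) <#> \<mu> g"
    and mult_coprime: "\<lbrakk>g \<in> carrier K; h \<in> carrier K; K.ord g > 0; K.ord h > 0;
        coprime (K.ord g) (K.ord h)\<rbrakk> \<Longrightarrow>
      \<mu> (g \<otimes>\<^bsub>K\<^esub> h) = powers U (\<mu> g) (K.ord h) <#> powers U (\<mu> h) (K.ord g)"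
    and mult_prime_power: "\<lbrakk>g \<in> carrier K; h \<in> carrier K; prime (p::nat);
        K.ord g = p ^ k; K.ord h = p ^ l; l < k\<rbrakk> \<Longrightarrow>
      \<mu> (g \<otimes>\<^bsub>K\<^esub> h) = \<mu> g <#> powers U (\<mu> h) (p ^ (k - l))"
    and mult_odd: "\<lbrakk>g \<in> carrier K; h \<in> carrier K; prime (p::nat); odd p; k \<ge> 1;
        K.ord g = p ^ k; K.ord h = p ^ k; K.ord (g \<otimes>\<^bsub>K\<^esub> h) = p ^ k\<rbrakk> \<Longrightarrow>
      \<mu> (g \<otimes>\<^bsub>K\<^esub> h) = \<mu> g <#> \<mu> h"
    and mult_two: "\<lbrakk>g \<in> carrier K; h \<in> carrier K; k \<ge> 1;
        K.ord g = 2 ^ k; K.ord h = 2 ^ k; K.ord (g \<otimes>\<^bsub>K\<^esub> h) = 2 ^ k\<rbrakk> \<Longrightarrow>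
      \<mu> (g \<otimes>\<^bsub>K\<^esub> h) = b g h [^] ((2::nat) ^ (k - 1)) <# (\<mu> g <#> \<mu> h)"

lemma (in cocycle) alternating_commutation: "alternating U K (\<lambda>s t. commutation U \<alpha> (s, t))"
  by unfold_locales (auto simp: commutation_mult_left commutation_mult_right)

text \<open>Gives the necessity of (A)--(D). In the existence proof it is applied to the cocycle
  just extended, which replaces any computation of its order cosets.\<close>

lemma (in cocycle) order_family_order_coset:
  "order_family U K (\<lambda>s t. commutation U \<alpha> (s, t)) (order_coset U K \<alpha>)"
proof -
  interpret alternating U K "\<lambda>s t. commutation U \<alpha> (s, t)" by (rule alternating_commutation)
  show ?thesis
  proof
    show "order_coset U K \<alpha> t \<in> Pow_cosets (K.ord t)" if "t \<in> carrier K" for t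
      using order_coset_Pow[OF that] .
  qed (rule order_coset_pow order_coset_mult_coprime order_coset_mult_prime_power
      order_coset_mult_odd order_coset_mult_two; assumption)+
qed

text \<open>All elements at which (A)--(D) evaluate \<mu> are torsion, because powers and products
  of torsion elements are.\<close>

lemma (in order_family) order_family_cong:
  assumes b: "\<And>s t. \<lbrakk>s \<in> carrier K; t \<in> carrier K\<rbrakk> \<Longrightarrow> b' s t = b s t"
    and \<mu>: "\<And>t. t \<in> Tor K \<Longrightarrow> \<mu>' t = \<mu> t"
  shows "order_family U K b' \<mu>'"
proof -
  have Tor: "\<mu>' t = \<mu> t" if "t \<in> carrier K" "K.ord t > 0" for t using \<mu> that K.Tor_iff by blast
  have Tor_pow: "K.ord (t [^]\<^bsub>K\<^esub> n) > 0" if "t \<in> carrier K" "K.ord t > 0" for t and n :: nat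
  proof -
    have "K.ord (t [^]\<^bsub>K\<^esub> n) dvd K.ord t"
      using that by (metis K.nat_pow_closed K.nat_pow_one K.nat_pow_pow K.pow_eq_id K.pow_ord_eq_1 mult.commute)
    then show ?thesis using that(2) by (auto intro!: Nat.gr0I)
  qed
  have Tor_mult: "K.ord (s \<otimes>\<^bsub>K\<^esub> t) > 0" if "s \<in> carrier K" "t \<in> carrier K" "K.ord s > 0" "K.ord t > 0" for s t
    using K.abelian_ord_mul_divides[OF that(1,2)] that(3,4) by (auto intro!: Nat.gr0I)
  show ?thesis
  proof
    show "\<mu>' t \<in> Pow_cosets (K.ord t)" if "t \<in> carrier K" "K.ord t > 0" for t
      using coset that Tor by simp
    show "\<mu>' (g [^]\<^bsub>K\<^esub> (n::nat)) = Pow_subgroup (K.ord g div n) <#> \<mu>' g"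
      if "g \<in> carrier K" "K.ord g > 0" "n > 0" "n dvd K.ord g" for g n
      using pow that Tor Tor_pow by simp
    show "\<mu>' (g \<otimes>\<^bsub>K\<^esub> h) = powers U (\<mu>' g) (K.ord h) <#> powers U (\<mu>' h) (K.ord g)"
      if "g \<in> carrier K" "h \<in> carrier K" "K.ord g > 0" "K.ord h > 0" "coprime (K.ord g) (K.ord h)" for g h
      using mult_coprime that Tor Tor_mult by simp
    show "\<mu>' (g \<otimes>\<^bsub>K\<^esub> h) = \<mu>' g <#> powers U (\<mu>' h) (p ^ (k - l))"
      if "g \<in> carrier K" "h \<in> carrier K" "prime (p::nat)" "K.ord g = p ^ k" "K.ord h = p ^ l" "l < k"
      for g h p k l
      using mult_prime_power that Tor Tor_mult[OF that(1,2)] by (simp add: prime_gt_0_nat)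
    show "\<mu>' (g \<otimes>\<^bsub>K\<^esub> h) = \<mu>' g <#> \<mu>' h"
      if "g \<in> carrier K" "h \<in> carrier K" "prime (p::nat)" "odd p" "k \<ge> 1" "K.ord g = p ^ k"
        "K.ord h = p ^ k" "K.ord (g \<otimes>\<^bsub>K\<^esub> h) = p ^ k" for g h p k
      using mult_odd[OF that] that Tor Tor_mult[OF that(1,2)] by (simp add: prime_gt_0_nat)
    show "\<mu>' (g \<otimes>\<^bsub>K\<^esub> h) = b' g h [^] ((2::nat) ^ (k - 1)) <# (\<mu>' g <#> \<mu>' h)"
      if "g \<in> carrier K" "h \<in> carrier K" "k \<ge> 1" "K.ord g = 2 ^ k"
        "K.ord h = 2 ^ k" "K.ord (g \<otimes>\<^bsub>K\<^esub> h) = 2 ^ k" for g h k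
      using mult_two[OF that] that Tor Tor_mult[OF that(1,2)] b by simp
  qed (use b in \<open>auto simp: mult_left mult_right\<close>)
qed

lemma (in order_family) order_family_subgroup:
  assumes "subgroup H K" shows "order_family U (K\<lparr>carrier := H\<rparr>) b \<mu>"
proof -
  interpret H: subgroup H K by fact
  interpret H: alternating U "K\<lparr>carrier := H\<rparr>" b by (rule restrict_subgroup[OF assms])
  note upd = K.ord_carrier_update[OF assms] nat_pow_carrier_update
  show ?thesis
    by unfold_locales (simp_all add: upd coset pow mult_coprime mult_prime_power mult_odd mult_two
      del: One_nat_def)
qed

text \<open>Each of (A)--(D) expresses the value at a power or product through values at its
  constituents and the common \<open>b\<close>, so the set of agreement has the closure properties
  that \<open>torsion_closure\<close> asks for.\<close>

lemma order_family_agree: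
  assumes "order_family U K b \<mu>" "order_family U K b \<mu>'"
    and sub: "subgroup H K" and g: "g \<in> carrier K"
    and ind: "\<And>i::int. g [^]\<^bsub>K\<^esub> i \<in> H \<Longrightarrow> g [^]\<^bsub>K\<^esub> i = \<one>\<^bsub>K\<^esub>"
    and full: "adjoin K H g = carrier K"
    and H: "\<And>t. \<lbrakk>t \<in> H; group.ord K t > 0\<rbrakk> \<Longrightarrow> \<mu> t = \<mu>' t"
    and gg: "group.ord K g > 0 \<Longrightarrow> \<mu> g = \<mu>' g"
    and t: "t \<in> carrier K" "group.ord K t > 0"
  shows "\<mu> t = \<mu>' t"
proof -
  interpret m: order_family U K b \<mu> by fact
  interpret m': order_family U K b \<mu>' by fact
  interpret H: subgroup H K by fact
  let ?S = "{t \<in> carrier K. \<mu> t = \<mu>' t}"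
  have "t \<in> ?S"
  proof (rule m.K.torsion_closure[OF sub g ind])
    show "x \<otimes>\<^bsub>K\<^esub> y \<in> ?S" if "x \<in> ?S" "y \<in> ?S" "prime p" "k \<ge> 1" "m.K.ord x = p ^ k"
      "m.K.ord y = p ^ k" "m.K.ord (x \<otimes>\<^bsub>K\<^esub> y) = p ^ k" for x y p k
    proof (cases "odd p")
      case True
      then show ?thesis using that m.mult_odd[of x y p k] m'.mult_odd[of x y p k] by simp
    next
      case False
      then have "p = 2" using that(3) by (metis primes_dvd_imp_eq two_is_prime_nat)
      then show ?thesis using that m.mult_two[of x y k] m'.mult_two[of x y k] by simp
    qed
    show "x [^]\<^bsub>K\<^esub> n \<in> ?S" if "x \<in> ?S" "m.K.ord x > 0" "n > 0" "n dvd m.K.ord x" for x and n :: nat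
      using m.pow[of x n] m'.pow[of x n] that by simp
    show "x \<otimes>\<^bsub>K\<^esub> y \<in> ?S" if "x \<in> ?S" "y \<in> ?S" "m.K.ord x > 0" "m.K.ord y > 0"
      "coprime (m.K.ord x) (m.K.ord y)" for x y
      using m.mult_coprime[of x y] m'.mult_coprime[of x y] that by simp
    show "x \<otimes>\<^bsub>K\<^esub> y \<in> ?S" if "x \<in> ?S" "y \<in> ?S" "prime p" "m.K.ord x = p ^ k"
      "m.K.ord y = p ^ l" "l < k" for x y p k l
      using m.mult_prime_power[of x y p k l] m'.mult_prime_power[of x y p k l] that by simp
  qed (use H gg g t full in auto)
  then show ?thesis by simp
qed

text \<open>Forces the value of \<mu> at the identity, which starts the induction on
  subgroups.\<close>

lemma (in comm_group) Pow_cosets_1: "S \<in> Pow_cosets 1 \<Longrightarrow> S = carrier G"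
proof -
  assume S: "S \<in> Pow_cosets 1"
  then obtain a where a: "a \<in> S" "a \<in> carrier G" by (rule Pow_cosets_nonempty)
  have "x \<in> Pow_subgroup 1 #> a" if "x \<in> carrier G" for x
    unfolding mem_r_coset_Pow using that a by (intro bexI[of _ "x \<otimes> inv a"]) (auto simp: m_assoc)
  then show ?thesis using Pow_cosets_rep[OF S a(1)] Pow_cosets_carrier[OF S] by blast
qed

theorem (in order_family) exists_cocycle:
  assumes fg: "finitely_generated K"
  obtains \<alpha> where "cocycle U K \<alpha>"
    "\<And>s t. \<lbrakk>s \<in> carrier K; t \<in> carrier K\<rbrakk> \<Longrightarrow> commutation U \<alpha> (s, t) = b s t"
    "\<And>t. \<lbrakk>t \<in> carrier K; K.ord t > 0\<rbrakk> \<Longrightarrow> order_coset U K \<alpha> t = \<mu> t"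
proof -
  \<comment> \<open>The cocycle is required on \<open>H\<close> only, while orders and order cosets
    are taken in \<open>K\<close>; this avoids translating them at every extension.\<close>
  define P where "P H \<longleftrightarrow> (\<exists>\<alpha>. cocycle U (K\<lparr>carrier := H\<rparr>) \<alpha> \<and>
    (\<forall>s\<in>H. \<forall>t\<in>H. \<alpha> s t = b s t \<otimes> \<alpha> t s) \<and>
    (\<forall>t\<in>H. K.ord t > 0 \<longrightarrow> order_coset U K \<alpha> t = \<mu> t))" for H
  obtain S where S: "finite S" "S \<subseteq> carrier K" "generate K S = carrier K"
    using fg unfolding finitely_generated_def by blast
  have "P (generate K S)" using S(1,2)
  proof (induction rule: K.finitely_generated_induct)
    case trivial
    have sub: "subgroup {\<one>\<^bsub>K\<^esub>} K" by (rule K.triv_subgroup)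
    have triv: "cocycle U (K\<lparr>carrier := {\<one>\<^bsub>K\<^esub>}\<rparr>) (\<lambda>_ _. \<one>)"
      by (intro cocycle.intro cocycle_axioms.intro comm_group_axioms K.subgroup_comm_group[OF sub])
        simp_all
    have "order_coset U K (\<lambda>_ _. \<one>) \<one>\<^bsub>K\<^esub> = \<mu> \<one>\<^bsub>K\<^esub>"
      using Pow_cosets_1[of "order_coset U K (\<lambda>_ _. \<one>) \<one>\<^bsub>K\<^esub>"] Pow_cosets_1[of "\<mu> \<one>\<^bsub>K\<^esub>"]
        cocycle.order_coset_Pow[OF triv, of "\<one>\<^bsub>K\<^esub>"] coset[of "\<one>\<^bsub>K\<^esub>"]
      by (simp add: K.order_coset_carrier_update[OF sub] K.ord_carrier_update[OF sub])
    then show ?case unfolding P_def using triv by (intro exI[of _ "\<lambda>_ _. \<one>"]) simp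
  next
    case (adjoin H g)
    note sub = adjoin.hyps(1) and g = adjoin.hyps(2,3) and ind = adjoin.hyps(4)
    let ?H' = "adjoin K H g" let ?K' = "K\<lparr>carrier := ?H'\<rparr>"
    have sub': "subgroup ?H' K" by (rule K.adjoin_subgroup[OF sub g(1)])
    have HH': "H \<subseteq> ?H'" "g \<in> ?H'" using K.adjoin_superset[OF sub g(1)] by auto
    obtain \<alpha> where \<alpha>: "cocycle U (K\<lparr>carrier := H\<rparr>) \<alpha>"
      "\<And>s t. \<lbrakk>s \<in> H; t \<in> H\<rbrakk> \<Longrightarrow> \<alpha> s t = b s t \<otimes> \<alpha> t s"
      "\<And>t. \<lbrakk>t \<in> H; K.ord t > 0\<rbrakk> \<Longrightarrow> order_coset U K \<alpha> t = \<mu> t"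
      using adjoin.IH unfolding P_def by blast
    \<comment> \<open>For \<open>g\<close> of infinite order there is no coset to respect and any
      \<open>c\<close> will do.\<close>
    obtain c where c: "c \<in> carrier U" "K.ord g > 0 \<Longrightarrow> c \<in> \<mu> g"
      using coset[OF g(1)] Pow_cosets_nonempty by (metis one_closed)
    obtain \<alpha>' where \<alpha>': "cocycle U ?K' \<alpha>'"
      "\<And>s t. \<lbrakk>s \<in> ?H'; t \<in> ?H'\<rbrakk> \<Longrightarrow> \<alpha>' s t = b s t \<otimes> \<alpha>' t s"
      "\<And>s t. \<lbrakk>s \<in> H; t \<in> H\<rbrakk> \<Longrightarrow> \<alpha>' s t = \<alpha> s t"
      "K.ord g > 0 \<Longrightarrow> (\<one>, g) [^]\<^bsub>twist U K \<alpha>'\<^esub> K.ord g = (c, \<one>\<^bsub>K\<^esub>)"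
    proof (rule cocycle_extend[OF K.comm_group_axioms sub g ind \<alpha>(1) alternating_axioms \<alpha>(2) c(1)])
      fix \<alpha>'
      assume "cocycle U ?K' \<alpha>'" "\<And>s t. \<lbrakk>s \<in> ?H'; t \<in> ?H'\<rbrakk> \<Longrightarrow> \<alpha>' s t = b s t \<otimes> \<alpha>' t s"
        "\<And>s t. \<lbrakk>s \<in> H; t \<in> H\<rbrakk> \<Longrightarrow> \<alpha>' s t = \<alpha> s t"
        "K.ord g > 0 \<Longrightarrow> (\<one>, g) [^]\<^bsub>twist U K \<alpha>'\<^esub> K.ord g = (c, \<one>\<^bsub>K\<^esub>)"
      then show thesis by (rule that)
    qed
    \<comment> \<open>The order cosets of \<open>\<alpha>'\<close> satisfy (A)--(D) for the same
      \<open>b\<close>, so comparing them with \<mu> on \<open>H\<close> and at \<open>g\<close> is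
      enough.\<close>
    have fam: "order_family U ?K' b (order_coset U K \<alpha>')"
    proof (rule order_family.order_family_cong[OF cocycle.order_family_order_coset[OF \<alpha>'(1)]])
      show "b s t = commutation U \<alpha>' (s, t)" if "s \<in> carrier ?K'" "t \<in> carrier ?K'" for s t
      proof -
        have mem: "s \<in> ?H'" "t \<in> ?H'" using that by simp_all
        then have "b s t \<in> carrier U" using subgroup.mem_carrier[OF sub'] by simp
        then show ?thesis using cocycle.commutationI[OF \<alpha>'(1) that _ \<alpha>'(2)[OF mem]] by simp
      qed
      show "order_coset U K \<alpha>' t = order_coset U ?K' \<alpha>' t" for t
        by (rule K.order_coset_carrier_update[OF sub', symmetric])
    qed
    have fam': "order_family U ?K' b \<mu>" by (rule order_family_subgroup[OF sub'])
    have ip: "g [^]\<^bsub>?K'\<^esub> (i::int) = g [^]\<^bsub>K\<^esub> i" for i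
      by (rule K.int_pow_consistent[OF sub' HH'(2), symmetric])
    have "order_coset U K \<alpha>' t = \<mu> t" if t: "t \<in> ?H'" "K.ord t > 0" for t
    proof (rule order_family_agree[OF fam fam', of H g])
      show "subgroup H ?K'" using K.subgroup_incl[OF sub sub' HH'(1)] .
      show "g \<in> carrier ?K'" using HH' by simp
      show "g [^]\<^bsub>?K'\<^esub> i = \<one>\<^bsub>?K'\<^esub>" if "g [^]\<^bsub>?K'\<^esub> i \<in> H" for i :: int
        using that ind unfolding ip by simp
      show "adjoin ?K' H g = carrier ?K'"
        unfolding adjoin_def[of ?K'] ip by (simp add: adjoin_def)
      show "order_coset U K \<alpha>' t = \<mu> t" if "t \<in> H" "group.ord ?K' t > 0" for t
      proof -
        have "order_coset U K \<alpha>' t = order_coset U K \<alpha> t"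
          by (rule order_coset_cong[OF K.is_group sub]) (use \<alpha>'(3) that in auto)
        then show ?thesis using \<alpha>(3)[OF that(1)] that(2) by (simp add: K.ord_carrier_update[OF sub'])
      qed
      \<comment> \<open>The common element is \<open>c\<close>: it was taken from
        \<open>\<mu> g\<close>, and it is the power of the new lift of \<open>g\<close>.\<close>
      show "order_coset U K \<alpha>' g = \<mu> g" if "group.ord ?K' g > 0"
      proof (rule Pow_cosets_eqI)
        have o: "K.ord g > 0" using that by (simp add: K.ord_carrier_update[OF sub'])
        show "\<mu> g \<in> Pow_cosets (K.ord g)" "c \<in> \<mu> g" using coset[OF g(1) o] c(2)[OF o] by auto
        show "order_coset U K \<alpha>' g \<in> Pow_cosets (K.ord g)"
          using cocycle.order_coset_Pow[OF \<alpha>'(1), of g] HH'(2)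
          by (simp add: K.ord_carrier_update[OF sub'] K.order_coset_carrier_update[OF sub'])
        show "c \<in> order_coset U K \<alpha>' g" using \<alpha>'(4)[OF o] unfolding order_coset_def by blast
      qed
    qed (use t in \<open>auto simp: K.ord_carrier_update[OF sub']\<close>)
    then show ?case unfolding P_def using \<alpha>'(1,2) by blast
  qed
  moreover have upd: "K\<lparr>carrier := carrier K\<rparr> = K" by simp
  ultimately obtain \<alpha> where \<alpha>: "cocycle U K \<alpha>"
      "\<And>s t. \<lbrakk>s \<in> carrier K; t \<in> carrier K\<rbrakk> \<Longrightarrow> \<alpha> s t = b s t \<otimes> \<alpha> t s"
      "\<And>t. \<lbrakk>t \<in> carrier K; K.ord t > 0\<rbrakk> \<Longrightarrow> order_coset U K \<alpha> t = \<mu> t"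
    unfolding P_def S(3) upd by blast
  show thesis
    by (rule that[OF \<alpha>(1) cocycle.commutationI[OF \<alpha>(1)] \<alpha>(3)]) (rule closed \<alpha>(2); assumption | assumption)+
qed

section \<open>Uniqueness of the cocycle\<close>

text \<open>Over a direct factor generated by \<open>g\<close>, a section is given by any lift
  \<open>Y\<close> with \<open>Y [^] n = 1\<close>, where \<open>n\<close> is the order of
  \<open>g\<close>. The lifting hypothesis provides \<open>Y\<close> for torsion \<open>g\<close>;
  for infinite order \<open>n\<close> is 0 and every lift qualifies.\<close>

lemma finitely_generated_section:
  assumes E: "comm_group E" and K: "comm_group K" and fg: "finitely_generated K"
    and \<pi>: "\<pi> \<in> hom E K" and surj: "\<pi> ` carrier E = carrier K"
    and lift: "\<And>t. t \<in> Tor K \<Longrightarrow>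
      \<exists>x\<in>carrier E. \<pi> x = t \<and> x [^]\<^bsub>E\<^esub> group.ord K t = \<one>\<^bsub>E\<^esub>"
  obtains \<sigma> where "\<sigma> \<in> hom K E" "\<And>t. t \<in> carrier K \<Longrightarrow> \<pi> (\<sigma> t) = t"
proof -
  interpret E: comm_group E by fact
  interpret K: comm_group K by fact
  interpret \<pi>: group_hom E K \<pi> by unfold_locales (rule \<pi>)
  define P where "P H \<longleftrightarrow> (\<exists>\<sigma>. \<forall>x\<in>H. \<sigma> x \<in> carrier E \<and> \<pi> (\<sigma> x) = x \<and>
    (\<forall>y\<in>H. \<sigma> (x \<otimes>\<^bsub>K\<^esub> y) = \<sigma> x \<otimes>\<^bsub>E\<^esub> \<sigma> y))" for H
  obtain S where S: "finite S" "S \<subseteq> carrier K" "generate K S = carrier K"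
    using fg unfolding finitely_generated_def by blast
  have "P (generate K S)" using S(1,2)
  proof (induction rule: K.finitely_generated_induct)
    case trivial
    show ?case unfolding P_def by (intro exI[of _ "\<lambda>_. \<one>\<^bsub>E\<^esub>"]) simp
  next
    case (adjoin H g)
    note sub = adjoin.hyps(1) and g = adjoin.hyps(2) and ind = adjoin.hyps(4)
    interpret H: subgroup H K by fact
    let ?H' = "adjoin K H g" and ?n = "int (K.ord g)"
    obtain \<sigma> where \<sigma>: "\<And>x. x \<in> H \<Longrightarrow> \<sigma> x \<in> carrier E" "\<And>x. x \<in> H \<Longrightarrow> \<pi> (\<sigma> x) = x"
      "\<And>x y. \<lbrakk>x \<in> H; y \<in> H\<rbrakk> \<Longrightarrow> \<sigma> (x \<otimes>\<^bsub>K\<^esub> y) = \<sigma> x \<otimes>\<^bsub>E\<^esub> \<sigma> y"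
      using adjoin.IH unfolding P_def by blast
    obtain Y where Y: "Y \<in> carrier E" "\<pi> Y = g" "Y [^]\<^bsub>E\<^esub> K.ord g = \<one>\<^bsub>E\<^esub>"
    proof (cases "K.ord g > 0")
      case True
      then show thesis using lift[of g] that g K.Tor_iff by blast
    next
      case False
      have "g \<in> \<pi> ` carrier E" using surj g by simp
      then obtain Y where "Y \<in> carrier E" "\<pi> Y = g" by auto
      then show thesis using that[of Y] False by simp
    qed
    have "E.ord Y dvd K.ord g" using Y E.pow_eq_id by blast
    then have dvd: "int (E.ord Y) dvd ?n" by simp
    \<comment> \<open>Coordinates are reduced modulo the order of \<open>g\<close>; that the order
      of \<open>Y\<close> divides it is what makes the extended section multiplicative.\<close>
    have Ymod: "Y [^]\<^bsub>E\<^esub> (i mod ?n) = Y [^]\<^bsub>E\<^esub> i" for i :: int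
    proof -
      have "?n dvd i - i mod ?n" by (simp add: minus_mod_eq_mult_div)
      then show ?thesis using E.int_pow_eq[OF Y(1)] dvd dvd_trans by blast
    qed
    obtain pr e where pr: "\<And>x. x \<in> ?H' \<Longrightarrow> pr x \<in> H"
      and xeq: "\<And>x. x \<in> ?H' \<Longrightarrow> x = pr x \<otimes>\<^bsub>K\<^esub> g [^]\<^bsub>K\<^esub> (e x :: int)"
      and pre: "\<And>h i. h \<in> H \<Longrightarrow> pr (h \<otimes>\<^bsub>K\<^esub> g [^]\<^bsub>K\<^esub> (i::int)) = h"
      and ee: "\<And>h i. h \<in> H \<Longrightarrow> e (h \<otimes>\<^bsub>K\<^esub> g [^]\<^bsub>K\<^esub> (i::int)) = i mod ?n"
      using K.adjoin_coordinates[OF sub g ind] by blast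
    define \<sigma>' where "\<sigma>' x = \<sigma> (pr x) \<otimes>\<^bsub>E\<^esub> Y [^]\<^bsub>E\<^esub> e x" for x
    have "\<sigma>' x \<in> carrier E \<and> \<pi> (\<sigma>' x) = x \<and> (\<forall>y\<in>?H'. \<sigma>' (x \<otimes>\<^bsub>K\<^esub> y) = \<sigma>' x \<otimes>\<^bsub>E\<^esub> \<sigma>' y)"
      if x: "x \<in> ?H'" for x
    proof (intro conjI ballI)
      show "\<sigma>' x \<in> carrier E" using x pr \<sigma>(1) Y(1) by (simp add: \<sigma>'_def)
      show "\<pi> (\<sigma>' x) = x"
        using xeq[OF x] pr[OF x] \<sigma> Y by (simp add: \<sigma>'_def \<pi>.hom_int_pow)
      fix y assume y: "y \<in> ?H'"
      have xy: "x \<otimes>\<^bsub>K\<^esub> y = (pr x \<otimes>\<^bsub>K\<^esub> pr y) \<otimes>\<^bsub>K\<^esub> g [^]\<^bsub>K\<^esub> (e x + e y)"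
        using K.adjoin_mult[of "pr x" "pr y" g "e x" "e y"] xeq[OF x] xeq[OF y] pr x y g by simp
      have "\<sigma>' (x \<otimes>\<^bsub>K\<^esub> y) = \<sigma> (pr x \<otimes>\<^bsub>K\<^esub> pr y) \<otimes>\<^bsub>E\<^esub> Y [^]\<^bsub>E\<^esub> (e x + e y)"
        unfolding xy \<sigma>'_def using pre ee pr x y Ymod by simp
      also have "\<dots> = \<sigma>' x \<otimes>\<^bsub>E\<^esub> \<sigma>' y"
        unfolding \<sigma>'_def using pr x y \<sigma> Y by (simp add: E.adjoin_mult)
      finally show "\<sigma>' (x \<otimes>\<^bsub>K\<^esub> y) = \<sigma>' x \<otimes>\<^bsub>E\<^esub> \<sigma>' y" .
    qed
    then show ?case unfolding P_def by blast
  qed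
  then show thesis using that unfolding P_def S(3) hom_def by auto
qed

lemma cocycle_inverse:
  assumes "cocycle U K \<alpha>" shows "cocycle U K (\<lambda>s t. inv\<^bsub>U\<^esub> (\<alpha> s t))"
proof -
  interpret cocycle U K \<alpha> by fact
  show ?thesis
    by unfold_locales (simp_all add: assoc flip: inv_mult)
qed

text \<open>The scalar part of a power of the lift \<open>(1, t)\<close> is a product of cocycle
  values, hence multiplicative in the cocycle.\<close>

lemma twist_pow_mult:
  assumes "cocycle U K \<alpha>" "cocycle U K \<alpha>'" and t: "t \<in> carrier K"
    and eq: "\<And>s t. \<lbrakk>s \<in> carrier K; t \<in> carrier K\<rbrakk> \<Longrightarrow> \<alpha>'' s t = \<alpha> s t \<otimes>\<^bsub>U\<^esub> \<alpha>' s t"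
    and "(\<one>\<^bsub>U\<^esub>, t) [^]\<^bsub>twist U K \<alpha>\<^esub> (n::nat) = (a, s)" "(\<one>\<^bsub>U\<^esub>, t) [^]\<^bsub>twist U K \<alpha>'\<^esub> n = (a', s)"
  shows "(\<one>\<^bsub>U\<^esub>, t) [^]\<^bsub>twist U K \<alpha>''\<^esub> n = (a \<otimes>\<^bsub>U\<^esub> a', s) \<and> s \<in> carrier K \<and> a \<in> carrier U \<and> a' \<in> carrier U"
  using assms(5,6)
proof (induction n arbitrary: a a' s)
  case 0
  interpret cocycle U K \<alpha> by fact
  show ?case using 0 by auto
next
  case (Suc n)
  interpret a: cocycle U K \<alpha> by fact
  interpret b: cocycle U K \<alpha>' by fact
  obtain c r where c: "(\<one>\<^bsub>U\<^esub>, t) [^]\<^bsub>twist U K \<alpha>\<^esub> n = (c, r)" by force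
  obtain c' r' where c': "(\<one>\<^bsub>U\<^esub>, t) [^]\<^bsub>twist U K \<alpha>'\<^esub> n = (c', r')" by force
  have "r' = r" using a.snd_pow[of "\<one>\<^bsub>U\<^esub>" t n] b.snd_pow[of "\<one>\<^bsub>U\<^esub>" t n] c c' by simp
  then have IH: "(\<one>\<^bsub>U\<^esub>, t) [^]\<^bsub>twist U K \<alpha>''\<^esub> n = (c \<otimes>\<^bsub>U\<^esub> c', r)"
    "r \<in> carrier K" "c \<in> carrier U" "c' \<in> carrier U" using Suc.IH c c' by auto
  then show ?case using Suc.prems c c' t \<open>r' = r\<close> by (auto simp: eq a.m_ac)
qed

theorem cocycle_cohomologous:
  assumes \<alpha>: "cocycle U K \<alpha>" and \<alpha>': "cocycle U K \<alpha>'" and fg: "finitely_generated K"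
    and comm: "\<And>s t. \<lbrakk>s \<in> carrier K; t \<in> carrier K\<rbrakk> \<Longrightarrow>
      commutation U \<alpha> (s, t) = commutation U \<alpha>' (s, t)"
    and coset: "\<And>t. t \<in> Tor K \<Longrightarrow> order_coset U K \<alpha> t = order_coset U K \<alpha>' t"
  obtains l where "\<And>t. t \<in> carrier K \<Longrightarrow> l t \<in> carrier U"  and
    "\<And>s t. \<lbrakk>s \<in> carrier K; t \<in> carrier K\<rbrakk> \<Longrightarrow>
      \<alpha>' s t \<otimes>\<^bsub>U\<^esub> (l s \<otimes>\<^bsub>U\<^esub> l t) = \<alpha> s t \<otimes>\<^bsub>U\<^esub> l (s \<otimes>\<^bsub>K\<^esub> t)"
proof -
  interpret a: cocycle U K \<alpha> by fact
  interpret b: cocycle U K \<alpha>' by fact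
  define \<gamma> where "\<gamma> s t = \<alpha>' s t \<otimes>\<^bsub>U\<^esub> inv\<^bsub>U\<^esub> (\<alpha> s t)" for s t
  have coc: "cocycle U K \<gamma>" unfolding \<gamma>_def by (rule cocycle_mult[OF \<alpha>' cocycle_inverse[OF \<alpha>]])
  interpret c: cocycle U K \<gamma> by fact
  have \<gamma>\<alpha>: "\<alpha>' s t = \<gamma> s t \<otimes>\<^bsub>U\<^esub> \<alpha> s t" if "s \<in> carrier K" "t \<in> carrier K" for s t
    using that by (simp add: \<gamma>_def a.m_assoc)
  have sym: "\<gamma> s t = \<gamma> t s" if "s \<in> carrier K" "t \<in> carrier K" for s t
  proof -
    let ?b = "commutation U \<alpha> (s, t)"
    have "\<gamma> s t = (?b \<otimes>\<^bsub>U\<^esub> \<alpha>' t s) \<otimes>\<^bsub>U\<^esub> inv\<^bsub>U\<^esub> (?b \<otimes>\<^bsub>U\<^esub> \<alpha> t s)"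
      unfolding \<gamma>_def using a.commute[OF that] b.commute[OF that] comm[OF that] by metis
    also have "\<dots> = (?b \<otimes>\<^bsub>U\<^esub> inv\<^bsub>U\<^esub> ?b) \<otimes>\<^bsub>U\<^esub> \<gamma> t s"
      unfolding \<gamma>_def using that a.commutation_closed[OF that]
      by (simp add: a.inv_mult a.m_ac del: a.r_inv)
    finally show ?thesis using that a.commutation_closed[OF that] by simp
  qed
  let ?E = "twist U K \<gamma>"
  have E: "comm_group ?E"
    by (rule group.group_comm_groupI[OF c.group_twist]) (auto simp: sym a.m_comm a.K.m_comm)
  have \<pi>: "snd \<in> hom ?E K" by (auto simp: hom_def)
  have surj: "snd ` carrier ?E = carrier K" using a.one_closed by force
  have lift: "\<exists>x\<in>carrier ?E. snd x = t \<and> x [^]\<^bsub>?E\<^esub> a.K.ord t = \<one>\<^bsub>?E\<^esub>" if "t \<in> Tor K" for t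
  proof -
    have t: "t \<in> carrier K" using that by (simp add: a.K.Tor_iff)
    obtain x where x: "x \<in> carrier U" "(\<one>\<^bsub>U\<^esub>, t) [^]\<^bsub>twist U K \<alpha>\<^esub> a.K.ord t = (x, \<one>\<^bsub>K\<^esub>)"
      "x \<in> order_coset U K \<alpha> t" by (rule a.pow_ord_twist[OF a.one_closed t])
    obtain y where y: "y \<in> carrier U" "(\<one>\<^bsub>U\<^esub>, t) [^]\<^bsub>twist U K \<alpha>'\<^esub> a.K.ord t = (y, \<one>\<^bsub>K\<^esub>)"
      "y \<in> order_coset U K \<alpha>' t" by (rule b.pow_ord_twist[OF a.one_closed t])
    obtain z where z: "z \<in> carrier U" "(\<one>\<^bsub>U\<^esub>, t) [^]\<^bsub>?E\<^esub> a.K.ord t = (z, \<one>\<^bsub>K\<^esub>)"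
      by (rule c.pow_ord_twist[OF a.one_closed t])
    have yzx: "y = z \<otimes>\<^bsub>U\<^esub> x" using twist_pow_mult[OF coc \<alpha> t \<gamma>\<alpha> z(2) x(2)] y(2) by simp
    have "y \<in> order_coset U K \<alpha> t" using y(3) coset[OF that] by simp
    then obtain d where d: "d \<in> carrier U" "y = d [^]\<^bsub>U\<^esub> a.K.ord t \<otimes>\<^bsub>U\<^esub> x"
      using a.order_coset_eq[OF t x(2,1)] a.mem_r_coset_Pow by blast
    \<comment> \<open>Equality of the order cosets makes the quotient \<open>z\<close> of
      \<open>y\<close> by \<open>x\<close> an \<open>n\<close>-th power, \<open>n\<close> being the
      order of \<open>t\<close>. Rescaling the lift by the inverse of \<open>d\<close> therefore
      makes its \<open>n\<close>-th power trivial.\<close>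
    have "z = d [^]\<^bsub>U\<^esub> a.K.ord t" using yzx d x z by simp
    then have "(inv\<^bsub>U\<^esub> d, t) [^]\<^bsub>?E\<^esub> a.K.ord t = (\<one>\<^bsub>U\<^esub>, \<one>\<^bsub>K\<^esub>)"
      using c.pow_twist[of "inv\<^bsub>U\<^esub> d" t "a.K.ord t"] d z t by (simp add: a.nat_pow_inv)
    then show ?thesis using d t by (intro bexI[of _ "(inv\<^bsub>U\<^esub> d, t)"]) auto
  qed
  obtain \<sigma> where \<sigma>: "\<sigma> \<in> hom K ?E" "\<And>t. t \<in> carrier K \<Longrightarrow> snd (\<sigma> t) = t"
    using finitely_generated_section[OF E a.K.comm_group_axioms fg \<pi> surj lift] by blast
  \<comment> \<open>The scalars by which the section departs from the lifts \<open>(1, t)\<close>;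
    multiplicativity of the section is exactly the coboundary relation between the cocycles.\<close>
  define l where "l t = fst (\<sigma> t)" for t
  have \<sigma>l: "\<sigma> t = (l t, t)" if "t \<in> carrier K" for t using \<sigma>(2)[OF that] by (simp add: l_def prod_eq_iff)
  have l: "l t \<in> carrier U" if "t \<in> carrier K" for t
    using hom_in_carrier[OF \<sigma>(1) that] \<sigma>l[OF that] by simp
  show thesis
  proof (rule that[OF l])
    fix s t assume st: "s \<in> carrier K" "t \<in> carrier K"
    have "(l (s \<otimes>\<^bsub>K\<^esub> t), s \<otimes>\<^bsub>K\<^esub> t) = (l s, s) \<otimes>\<^bsub>?E\<^esub> (l t, t)"
      using hom_mult[OF \<sigma>(1) st] \<sigma>l st by simp
    then have "l (s \<otimes>\<^bsub>K\<^esub> t) = l s \<otimes>\<^bsub>U\<^esub> l t \<otimes>\<^bsub>U\<^esub> \<gamma> s t" by simp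
    then show "\<alpha>' s t \<otimes>\<^bsub>U\<^esub> (l s \<otimes>\<^bsub>U\<^esub> l t) = \<alpha> s t \<otimes>\<^bsub>U\<^esub> l (s \<otimes>\<^bsub>K\<^esub> t)"
      using st l \<gamma>\<alpha>[OF st] by (simp add: a.m_ac)
  qed
qed

section \<open>Graded-division algebras with one-dimensional components\<close>

lemma (in field) comm_group_mult_of: "comm_group (mult_of R)"
  by (rule group.group_comm_groupI[OF field_mult_group]) (simp add: m_comm)

text \<open>Replaces dimension by a nonzero spanning vector, the form in which one-dimensionality is
  used from here on.\<close>

lemma (in vectorspace) fin_dim_dim_1_iff:
  "fin_dim \<and> dim = 1 \<longleftrightarrow>
    (\<exists>x\<in>carrier V. x \<noteq> \<zero>\<^bsub>V\<^esub> \<and> (\<forall>y\<in>carrier V. \<exists>a\<in>carrier K. y = a \<odot>\<^bsub>V\<^esub> x))"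
proof
  assume fd: "fin_dim \<and> dim = 1"
  then obtain B where B: "finite B" "basis B" using finite_basis_exists by blast
  then have "card B = 1" using dim_basis fd by simp
  then obtain x where x: "B = {x}" by (auto simp: card_1_singleton_iff)
  have basis: "lin_indpt {x}" "span {x} = carrier V" "x \<in> carrier V"
    using B(2) x by (auto simp: basis_def)
  have "carrier K \<noteq> {\<zero>\<^bsub>K\<^esub>}" using zero_not_one R.one_closed by (metis singletonD)
  then have "x \<noteq> \<zero>\<^bsub>V\<^esub>" using zero_nin_lin_indpt[of "{x}"] basis by auto
  moreover have "\<exists>a\<in>carrier K. y = a \<odot>\<^bsub>V\<^esub> x" if "y \<in> carrier V" for y
  proof -
    have "y \<in> span {x}" using that basis by simp
    then obtain a where "a \<in> {x} \<rightarrow> carrier K" "y = lincomb a {x}"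
      using finite_span[of "{x}"] basis by auto
    then have "a x \<in> carrier K" "y = a x \<odot>\<^bsub>V\<^esub> x" using basis(3) by (auto simp: lincomb_def)
    then show ?thesis by blast
  qed
  ultimately show "\<exists>x\<in>carrier V. x \<noteq> \<zero>\<^bsub>V\<^esub> \<and> (\<forall>y\<in>carrier V. \<exists>a\<in>carrier K. y = a \<odot>\<^bsub>V\<^esub> x)"
    using basis(3) by blast
next
  assume "\<exists>x\<in>carrier V. x \<noteq> \<zero>\<^bsub>V\<^esub> \<and> (\<forall>y\<in>carrier V. \<exists>a\<in>carrier K. y = a \<odot>\<^bsub>V\<^esub> x)"
  then obtain x where x: "x \<in> carrier V" "x \<noteq> \<zero>\<^bsub>V\<^esub>"
    "\<And>y. y \<in> carrier V \<Longrightarrow> \<exists>a\<in>carrier K. y = a \<odot>\<^bsub>V\<^esub> x" by blast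
  have "y \<in> span {x}" if y: "y \<in> carrier V" for y
  proof -
    obtain a where a: "a \<in> carrier K" "y = a \<odot>\<^bsub>V\<^esub> x" using x(3)[OF y] by blast
    then have "y = lincomb (\<lambda>_. a) {x}" using x(1) by (simp add: lincomb_def)
    then show ?thesis using a(1) unfolding span_def by blast
  qed
  then have gen: "span {x} = carrier V" using span_is_subset2[of "{x}"] x(1) by blast
  then have "fin_dim" unfolding fin_dim_def using x(1) by (intro exI[of _ "{x}"]) auto
  then show "fin_dim \<and> dim = 1" using dim1I[OF gen x(2,1)] by blast
qed

context vectorspace
begin

lemma smult_eq_zeroD:
  assumes "a \<in> carrier K" "x \<in> carrier V" "a \<odot>\<^bsub>V\<^esub> x = \<zero>\<^bsub>V\<^esub>" "x \<noteq> \<zero>\<^bsub>V\<^esub>"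
  shows "a = \<zero>\<^bsub>K\<^esub>"
proof (rule ccontr)
  assume "a \<noteq> \<zero>\<^bsub>K\<^esub>"
  then have a: "a \<in> Units K" using assms(1) field_Units by simp
  have "x = (inv\<^bsub>K\<^esub> a \<otimes>\<^bsub>K\<^esub> a) \<odot>\<^bsub>V\<^esub> x" using a assms(2) by simp
  also have "\<dots> = \<zero>\<^bsub>V\<^esub>" using a assms by (simp add: smult_assoc1 del: Units_l_inv)
  finally show False using assms(4) by simp
qed

lemma smult_right_cancel:
  assumes "a \<in> carrier K" "b \<in> carrier K" "x \<in> carrier V" "a \<odot>\<^bsub>V\<^esub> x = b \<odot>\<^bsub>V\<^esub> x" "x \<noteq> \<zero>\<^bsub>V\<^esub>"
  shows "a = b"
proof -
  have "(a \<ominus>\<^bsub>K\<^esub> b) \<odot>\<^bsub>V\<^esub> x = \<zero>\<^bsub>V\<^esub>"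
    using assms(1-4) by (simp add: smult_l_distr smult_l_minus R.minus_eq M.r_neg)
  then have "a \<ominus>\<^bsub>K\<^esub> b = \<zero>\<^bsub>K\<^esub>" using assms smult_eq_zeroD by blast
  then show ?thesis using assms(1,2) R.r_right_minus_eq by blast
qed

end

text \<open>Independence across degrees is left to the directness of the grading. Taking the unit as
  basis element at the identity is what normalizes the cocycle \<alpha> of structure
  constants.\<close>

definition homogeneous_basis ::
  "('l, 'm) ring_scheme \<Rightarrow> ('k, 'n) monoid_scheme \<Rightarrow> ('l, 'a, 'c) module_scheme \<Rightarrow>
     ('k \<Rightarrow> 'a set) \<Rightarrow> ('k \<Rightarrow> 'a) \<Rightarrow> ('k \<Rightarrow> 'k \<Rightarrow> 'l) \<Rightarrow> bool" where
  "homogeneous_basis L K A D x \<alpha> \<longleftrightarrow>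
     (\<forall>t\<in>carrier K. x t \<in> D t \<and> x t \<noteq> \<zero>\<^bsub>A\<^esub> \<and> (\<forall>y\<in>D t. \<exists>a\<in>carrier L. y = a \<odot>\<^bsub>A\<^esub> x t)) \<and>
     x \<one>\<^bsub>K\<^esub> = \<one>\<^bsub>A\<^esub> \<and>
     (\<forall>s\<in>carrier K. \<forall>t\<in>carrier K. x s \<otimes>\<^bsub>A\<^esub> x t = \<alpha> s t \<odot>\<^bsub>A\<^esub> x (s \<otimes>\<^bsub>K\<^esub> t))"

context graded_algebra
begin

lemma component_submodule: "t \<in> carrier K \<Longrightarrow> submodule L (D t) A"
  using component_subspace is_module by blast

lemma component_carrier: "t \<in> carrier K \<Longrightarrow> x \<in> D t \<Longrightarrow> x \<in> carrier A"
  using submodule.subset[OF component_submodule] by blast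

lemma component_smult: "\<lbrakk>t \<in> carrier K; a \<in> carrier L; x \<in> D t\<rbrakk> \<Longrightarrow> a \<odot> x \<in> D t"
  using submodule.smult_closed[OF component_submodule] by blast

lemma smult_mult_smult:
  assumes "a \<in> carrier L" "b \<in> carrier L" "x \<in> carrier A" "y \<in> carrier A"
  shows "(a \<odot> x) \<otimes> (b \<odot> y) = (a \<otimes>\<^bsub>L\<^esub> b) \<odot> (x \<otimes> y)"
proof -
  have "(a \<odot> x) \<otimes> (b \<odot> y) = a \<odot> (x \<otimes> (b \<odot> y))" using assms by (intro smult_mult_left) auto
  also have "x \<otimes> (b \<odot> y) = b \<odot> (x \<otimes> y)" using assms by (intro smult_mult_right)
  also have "a \<odot> (b \<odot> (x \<otimes> y)) = (a \<otimes>\<^bsub>L\<^esub> b) \<odot> (x \<otimes> y)" using assms by (simp add: smult_assoc1)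
  finally show ?thesis .
qed

end

lemma one_dim_components_iff:
  fixes A :: "('l, 'a) module" (structure)
  assumes "graded_algebra L K A D"
  shows "one_dim_components L K A D \<longleftrightarrow>
    (\<forall>t\<in>carrier K. \<exists>x\<in>D t. x \<noteq> \<zero> \<and> (\<forall>y\<in>D t. \<exists>a\<in>carrier L. y = a \<odot> x))"
proof -
  interpret graded_algebra L K A D by fact
  show ?thesis
    unfolding one_dim_components_def
    using vectorspace.fin_dim_dim_1_iff[OF subspace_is_vs[OF component_subspace]] by simp
qed

context graded_division_algebra
begin

theorem exists_homogeneous_basis:
  assumes K: "comm_group K" and dim: "\<forall>t\<in>carrier K. \<exists>x\<in>D t. x \<noteq> \<zero> \<and> (\<forall>y\<in>D t. \<exists>a\<in>carrier L. y = a \<odot> x)"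
  obtains x \<alpha> where "cocycle (mult_of L) K \<alpha>" "homogeneous_basis L K A D x \<alpha>"
proof -
  interpret K: comm_group K by fact
  obtain z where z: "\<And>t. t \<in> carrier K \<Longrightarrow> z t \<in> D t \<and> z t \<noteq> \<zero> \<and> (\<forall>y\<in>D t. \<exists>a\<in>carrier L. y = a \<odot> z t)"
    using dim by metis
  let ?e = "\<one>\<^bsub>K\<^esub>"
  have ze: "z ?e \<in> D ?e" "z ?e \<noteq> \<zero>" "z ?e \<in> carrier A" using z[of ?e] component_carrier by auto
  have nontriv: "\<one> \<noteq> \<zero>" using ze(2,3) by (metis alg.l_null alg.l_one)
  have unit: "y \<in> Units A \<longleftrightarrow> y \<noteq> \<zero>" if "t \<in> carrier K" "y \<in> D t" for y t
  proof -
    have "\<zero> \<notin> Units A" using nontriv by (auto simp: Units_def)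
    then show ?thesis using homogeneous_invertible that by blast
  qed
  have mult_nz: "y \<otimes> y' \<noteq> \<zero>" if "s \<in> carrier K" "t \<in> carrier K" "y \<in> D s" "y' \<in> D t" "y \<noteq> \<zero>" "y' \<noteq> \<zero>"
    for s t y y'
    using unit[of s y] unit[of t y'] unit[of "s \<otimes>\<^bsub>K\<^esub> t" "y \<otimes> y'"] component_mult[of s t y y'] that by simp
  \<comment> \<open>That the unit has degree the identity is not among the axioms and is derived
    here: the square of \<open>z ?e\<close> stays in its component, so it is \<open>c\<close> times
    \<open>z ?e\<close>, and cancelling the invertible element \<open>z ?e\<close> shows that
    \<open>z ?e\<close> is \<open>c\<close> times the unit.\<close>
  have "z ?e \<otimes> z ?e \<in> D ?e" using component_mult[of ?e ?e "z ?e" "z ?e"] ze by simp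
  then obtain c where c: "c \<in> carrier L" "z ?e \<otimes> z ?e = c \<odot> z ?e" using z[of ?e] by auto
  have "z ?e = c \<odot> \<one>"
  proof -
    have u: "z ?e \<in> Units A" using unit[of ?e] ze by simp
    have "z ?e \<otimes> z ?e = z ?e \<otimes> (c \<odot> \<one>)" using c ze by (simp add: smult_mult_right)
    then show ?thesis using u ze c by (simp add: alg.Units_l_cancel)
  qed
  moreover have "c \<noteq> \<zero>\<^bsub>L\<^esub>" using calculation ze(2) by auto
  ultimately have "\<one> = inv\<^bsub>L\<^esub> c \<odot> z ?e"
    using c field_Units by (simp add: smult_assoc1[symmetric])
  then have one: "\<one> \<in> D ?e"
    using component_smult[of ?e "inv\<^bsub>L\<^esub> c" "z ?e"] ze c \<open>c \<noteq> \<zero>\<^bsub>L\<^esub>\<close> field_Units by simp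
  define x where "x = z(?e := \<one>)"
  have x: "x t \<in> D t" "x t \<noteq> \<zero>" "x t \<in> carrier A" if "t \<in> carrier K" for t
    using z[OF that] one nontriv that component_carrier by (auto simp: x_def)
  have xe: "x ?e = \<one>" by (simp add: x_def)
  have gen: "\<exists>a\<in>carrier L. y = a \<odot> x t" if t: "t \<in> carrier K" and y: "y \<in> D t" for t y
  proof -
    obtain a where a: "a \<in> carrier L" "y = a \<odot> z t" using z[OF t] y by blast
    show ?thesis
    proof (cases "t = ?e")
      case True
      have "y = (a \<otimes>\<^bsub>L\<^esub> c) \<odot> x t" using a \<open>z ?e = c \<odot> \<one>\<close> c(1) True by (simp add: xe smult_assoc1)
      then show ?thesis using a(1) c(1) by blast
    next
      case False
      then show ?thesis using a by (auto simp: x_def)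
    qed
  qed
  have "\<exists>a. a \<in> carrier L \<and> x s \<otimes> x t = a \<odot> x (s \<otimes>\<^bsub>K\<^esub> t)" if "s \<in> carrier K" "t \<in> carrier K" for s t
    using gen[of "s \<otimes>\<^bsub>K\<^esub> t"] component_mult[OF that x(1) x(1)] that by auto
  then obtain \<alpha> where \<alpha>: "\<And>s t. \<lbrakk>s \<in> carrier K; t \<in> carrier K\<rbrakk> \<Longrightarrow>
      \<alpha> s t \<in> carrier L \<and> x s \<otimes> x t = \<alpha> s t \<odot> x (s \<otimes>\<^bsub>K\<^esub> t)" by metis
  \<comment> \<open>Nonzero homogeneous elements are invertible, so their products do not vanish,
    and the structure constants are units of \<open>L\<close>.\<close>
  have \<alpha>nz: "\<alpha> s t \<noteq> \<zero>\<^bsub>L\<^esub>" if "s \<in> carrier K" "t \<in> carrier K" for s t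
    using mult_nz[OF that x(1) x(1) x(2) x(2)] \<alpha>[OF that] x that by auto
  have "cocycle (mult_of L) K \<alpha>"
  proof (intro cocycle.intro comm_group_mult_of K cocycle_axioms.intro)
    fix s t u assume stu: "s \<in> carrier K" "t \<in> carrier K" "u \<in> carrier K"
    have "(x s \<otimes> x t) \<otimes> x u = (\<alpha> s t \<otimes>\<^bsub>L\<^esub> \<alpha> (s \<otimes>\<^bsub>K\<^esub> t) u) \<odot> x (s \<otimes>\<^bsub>K\<^esub> t \<otimes>\<^bsub>K\<^esub> u)"
      using \<alpha> x stu by (simp add: smult_mult_left smult_assoc1)
    moreover have "x s \<otimes> (x t \<otimes> x u) = (\<alpha> t u \<otimes>\<^bsub>L\<^esub> \<alpha> s (t \<otimes>\<^bsub>K\<^esub> u)) \<odot> x (s \<otimes>\<^bsub>K\<^esub> t \<otimes>\<^bsub>K\<^esub> u)"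
      using \<alpha> x stu by (simp add: smult_mult_right smult_assoc1 grp.m_assoc)
    moreover have "(x s \<otimes> x t) \<otimes> x u = x s \<otimes> (x t \<otimes> x u)" using x stu by (simp add: alg.m_assoc)
    ultimately have "\<alpha> s t \<otimes>\<^bsub>L\<^esub> \<alpha> (s \<otimes>\<^bsub>K\<^esub> t) u = \<alpha> t u \<otimes>\<^bsub>L\<^esub> \<alpha> s (t \<otimes>\<^bsub>K\<^esub> u)"
      using \<alpha> x stu by (intro smult_right_cancel[of _ _ "x (s \<otimes>\<^bsub>K\<^esub> t \<otimes>\<^bsub>K\<^esub> u)"]) simp_all
    then show "\<alpha> s t \<otimes>\<^bsub>mult_of L\<^esub> \<alpha> (s \<otimes>\<^bsub>K\<^esub> t) u = \<alpha> t u \<otimes>\<^bsub>mult_of L\<^esub> \<alpha> s (t \<otimes>\<^bsub>K\<^esub> u)"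
      by simp
  next
    have "\<one> = \<alpha> ?e ?e \<odot> \<one>" using \<alpha>[of ?e ?e] xe by simp
    then have "\<one>\<^bsub>L\<^esub> \<odot> \<one> = \<alpha> ?e ?e \<odot> \<one>" by simp
    then show "\<alpha> ?e ?e = \<one>\<^bsub>mult_of L\<^esub>"
      using smult_right_cancel[of "\<one>\<^bsub>L\<^esub>" "\<alpha> ?e ?e" \<one>] \<alpha>[of ?e ?e] nontriv by simp
  qed (use \<alpha> \<alpha>nz in auto)
  moreover have "homogeneous_basis L K A D x \<alpha>"
    unfolding homogeneous_basis_def by (intro conjI ballI x gen xe conjunct2[OF \<alpha>])
  ultimately show thesis by (rule that)
qed

end

locale based_graded_algebra = graded_division_algebra L K A D + cocycle: cocycle "mult_of L" K \<alpha>
  for L :: "('l, 'm) ring_scheme" and K :: "('k, 'n) monoid_scheme" and A :: "('l, 'a) module" (structure)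
    and D and \<alpha> +
  fixes x
  assumes basis: "homogeneous_basis L K A D x \<alpha>"
begin

lemma basis_mem: "t \<in> carrier K \<Longrightarrow> x t \<in> D t"
  and basis_nonzero: "t \<in> carrier K \<Longrightarrow> x t \<noteq> \<zero>"
  and basis_gen: "\<lbrakk>t \<in> carrier K; y \<in> D t\<rbrakk> \<Longrightarrow> \<exists>a\<in>carrier L. y = a \<odot> x t"
  and basis_one: "x \<one>\<^bsub>K\<^esub> = \<one>"
  and basis_mult: "\<lbrakk>s \<in> carrier K; t \<in> carrier K\<rbrakk> \<Longrightarrow>
    x s \<otimes> x t = \<alpha> s t \<odot> x (s \<otimes>\<^bsub>K\<^esub> t)"
  using basis unfolding homogeneous_basis_def by blast+

lemma basis_carrier [simp]: "t \<in> carrier K \<Longrightarrow> x t \<in> carrier A"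
  using basis_mem component_carrier by blast

lemma cocycle_carrier [simp]: "\<lbrakk>s \<in> carrier K; t \<in> carrier K\<rbrakk> \<Longrightarrow> \<alpha> s t \<in> carrier L"
  using cocycle.closed by auto

text \<open>Sending \<open>(a, t)\<close> to \<open>a\<close> times \<open>x t\<close> turns
  products in the twist into products in the algebra; this is how order cosets become the powers in
  (iii).\<close>

lemma basis_pow:
  assumes "a \<in> carrier L" "a \<noteq> \<zero>\<^bsub>L\<^esub>" "t \<in> carrier K"
    "(a, t) [^]\<^bsub>twist (mult_of L) K \<alpha>\<^esub> (n::nat) = (c, s)"
  shows "(a \<odot> x t) [^] n = c \<odot> x s \<and> c \<in> carrier L \<and> s \<in> carrier K"
  using assms(4)
proof (induction n arbitrary: c s)
  case 0
  then show ?case by (auto simp: basis_one)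
next
  case (Suc n)
  obtain d r where dr: "(a, t) [^]\<^bsub>twist (mult_of L) K \<alpha>\<^esub> n = (d, r)" by force
  note IH = Suc.IH[OF dr]
  have "c = d \<otimes>\<^bsub>L\<^esub> a \<otimes>\<^bsub>L\<^esub> \<alpha> r t" "s = r \<otimes>\<^bsub>K\<^esub> t" using Suc.prems dr by auto
  then show ?case using IH assms(1,3)
    by (simp add: smult_mult_smult basis_mult smult_assoc1)
qed

lemma components_commute:
  assumes "s \<in> carrier K" "t \<in> carrier K" "y \<in> D s" "z \<in> D t"
  shows "y \<otimes> z = commutation (mult_of L) \<alpha> (s, t) \<odot> (z \<otimes> y)"
proof -
  obtain a b where ab: "a \<in> carrier L" "y = a \<odot> x s" "b \<in> carrier L" "z = b \<odot> x t"
    using basis_gen assms by metis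
  let ?c = "commutation (mult_of L) \<alpha> (s, t)"
  have c: "?c \<in> carrier L" "\<alpha> s t = ?c \<otimes>\<^bsub>L\<^esub> \<alpha> t s"
    using cocycle.commutation_closed[OF assms(1,2)] cocycle.commute[OF assms(1,2)] by simp_all
  have "y \<otimes> z = (a \<otimes>\<^bsub>L\<^esub> b \<otimes>\<^bsub>L\<^esub> \<alpha> s t) \<odot> x (s \<otimes>\<^bsub>K\<^esub> t)"
    using ab assms by (simp add: smult_mult_smult basis_mult smult_assoc1)
  also have "a \<otimes>\<^bsub>L\<^esub> b \<otimes>\<^bsub>L\<^esub> \<alpha> s t = ?c \<otimes>\<^bsub>L\<^esub> (b \<otimes>\<^bsub>L\<^esub> a \<otimes>\<^bsub>L\<^esub> \<alpha> t s)"
    unfolding c(2) using c(1) ab assms by (simp add: R.m_ac)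
  also have "\<dots> \<odot> x (s \<otimes>\<^bsub>K\<^esub> t) = ?c \<odot> (z \<otimes> y)"
    using ab assms c(1) by (simp add: smult_mult_smult basis_mult smult_assoc1 cocycle.K.m_comm)
  finally show ?thesis .
qed

lemma component_pow:
  assumes "t \<in> Tor K" "y \<in> D t" "y \<noteq> \<zero>"
  obtains c where "c \<in> carrier L" "c \<in> order_coset (mult_of L) K \<alpha> t"
    "y [^] group.ord K t = c \<odot> \<one>"
proof -
  have t: "t \<in> carrier K" using assms(1) by (simp add: Tor_def)
  obtain a where a: "a \<in> carrier L" "y = a \<odot> x t" using basis_gen[OF t assms(2)] by blast
  then have a0: "a \<noteq> \<zero>\<^bsub>L\<^esub>" using assms(3) t by auto
  obtain c where c: "(a, t) [^]\<^bsub>twist (mult_of L) K \<alpha>\<^esub> group.ord K t = (c, \<one>\<^bsub>K\<^esub>)"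
    "c \<in> order_coset (mult_of L) K \<alpha> t"
    using cocycle.pow_ord_twist[of a t] a a0 t by auto
  then show thesis using that[of c] basis_pow[OF a(1) a0 t c(1)] a(2) by (simp add: basis_one)
qed

end

section \<open>Twisted group algebras\<close>

definition support :: "('l, 'm) ring_scheme \<Rightarrow> ('k \<Rightarrow> 'l) \<Rightarrow> 'k set" where
  "support L f = {t. f t \<noteq> \<zero>\<^bsub>L\<^esub>}"

definition single :: "('l, 'm) ring_scheme \<Rightarrow> 'k \<Rightarrow> 'l \<Rightarrow> 'k \<Rightarrow> 'l" where
  "single L t a = (\<lambda>s. if s = t then a else \<zero>\<^bsub>L\<^esub>)"

text \<open>A function \<open>f\<close> stands for the finite sum of its values times basis
  elements, and the product is convolution weighted by \<alpha>. Summing over the support of the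
  left factor keeps the sum finite, and vanishing off the carrier of \<open>K\<close> makes equality
  of functions the right equality.\<close>

definition twisted_algebra ::
  "('l, 'm) ring_scheme \<Rightarrow> ('k, 'n) monoid_scheme \<Rightarrow> ('k \<Rightarrow> 'k \<Rightarrow> 'l) \<Rightarrow> ('l, 'k \<Rightarrow> 'l) module" where
  "twisted_algebra L K \<alpha> =
    \<lparr>carrier = {f. range f \<subseteq> carrier L \<and> finite (support L f) \<and> support L f \<subseteq> carrier K},
     mult = (\<lambda>f g t. if t \<in> carrier K then
       \<Oplus>\<^bsub>L\<^esub>s\<in>support L f. f s \<otimes>\<^bsub>L\<^esub> g (inv\<^bsub>K\<^esub> s \<otimes>\<^bsub>K\<^esub> t) \<otimes>\<^bsub>L\<^esub> \<alpha> s (inv\<^bsub>K\<^esub> s \<otimes>\<^bsub>K\<^esub> t) else \<zero>\<^bsub>L\<^esub>),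
     one = single L \<one>\<^bsub>K\<^esub> \<one>\<^bsub>L\<^esub>, zero = (\<lambda>_. \<zero>\<^bsub>L\<^esub>), add = (\<lambda>f g t. f t \<oplus>\<^bsub>L\<^esub> g t),
     smult = (\<lambda>a f t. a \<otimes>\<^bsub>L\<^esub> f t)\<rparr>"

definition twisted_component :: "('l, 'm) ring_scheme \<Rightarrow> 'k \<Rightarrow> ('k \<Rightarrow> 'l) set" where
  "twisted_component L t = single L t ` carrier L"

locale twisted_group_algebra = L?: field L + cocycle: cocycle "mult_of L" K \<alpha>
  for L (structure) and K and \<alpha>
begin

abbreviation A where "A \<equiv> twisted_algebra L K \<alpha>"

abbreviation conv (infixl \<open>\<star>\<close> 70) where "f \<star> g \<equiv> f \<otimes>\<^bsub>A\<^esub> g"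
abbreviation plus_A (infixl \<open>\<boxplus>\<close> 65) where "f \<boxplus> g \<equiv> f \<oplus>\<^bsub>A\<^esub> g"
abbreviation scale_A (infixl \<open>\<cdot>\<close> 70) where "a \<cdot> f \<equiv> a \<odot>\<^bsub>A\<^esub> f"

lemma cocycle_nonzero: "\<lbrakk>s \<in> carrier K; t \<in> carrier K\<rbrakk> \<Longrightarrow> \<alpha> s t \<noteq> \<zero>"
  and cocycle_closed [simp]: "\<lbrakk>s \<in> carrier K; t \<in> carrier K\<rbrakk> \<Longrightarrow> \<alpha> s t \<in> carrier L"
  using cocycle.closed[of s t] by auto

lemma cocycle_one [simp]:
  "t \<in> carrier K \<Longrightarrow> \<alpha> \<one>\<^bsub>K\<^esub> t = \<one>" "t \<in> carrier K \<Longrightarrow> \<alpha> t \<one>\<^bsub>K\<^esub> = \<one>"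
  using cocycle.one_left[of t] cocycle.one_right[of t] by auto

lemma cocycle_assoc:
  "\<lbrakk>s \<in> carrier K; t \<in> carrier K; u \<in> carrier K\<rbrakk> \<Longrightarrow>
    \<alpha> s t \<otimes> \<alpha> (s \<otimes>\<^bsub>K\<^esub> t) u = \<alpha> t u \<otimes> \<alpha> s (t \<otimes>\<^bsub>K\<^esub> u)"
  using cocycle.assoc[of s t u] by simp

lemma mem_A: "f \<in> carrier A \<longleftrightarrow>
    (\<forall>t. f t \<in> carrier L) \<and> finite (support L f) \<and> support L f \<subseteq> carrier K"
  by (auto simp: twisted_algebra_def)

lemma A_simps [simp]:
  "\<one>\<^bsub>A\<^esub> = single L \<one>\<^bsub>K\<^esub> \<one>" "\<zero>\<^bsub>A\<^esub> = (\<lambda>_. \<zero>)"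
  by (simp_all add: twisted_algebra_def)

lemma A_apply: "(f \<boxplus> g) t = f t \<oplus> g t" "(a \<cdot> f) t = a \<otimes> f t"
  by (simp_all add: twisted_algebra_def)

lemma A_val [simp]: "f \<in> carrier A \<Longrightarrow> f t \<in> carrier L"
  by (simp add: mem_A)

lemma outside: "f \<in> carrier A \<Longrightarrow> t \<notin> carrier K \<Longrightarrow> f t = \<zero>"
  by (auto simp: mem_A support_def)

lemma single_same [simp]: "single L t a t = a"
  and single_other: "s \<noteq> t \<Longrightarrow> single L t a s = \<zero>"
  by (simp_all add: single_def)

lemma support_single: "support L (single L t a) \<subseteq> {t}"
  by (auto simp: support_def single_def)

lemma single_closed [simp]: "t \<in> carrier K \<Longrightarrow> a \<in> carrier L \<Longrightarrow> single L t a \<in> carrier A"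
  using support_single[of t a] finite_subset[of "support L (single L t a)" "{t}"]
  by (auto simp: mem_A single_def)

lemma add_closed: "\<lbrakk>f \<in> carrier A; g \<in> carrier A\<rbrakk> \<Longrightarrow> f \<boxplus> g \<in> carrier A"
proof -
  assume fg: "f \<in> carrier A" "g \<in> carrier A"
  have "support L (f \<boxplus> g) \<subseteq> support L f \<union> support L g" by (auto simp: support_def A_apply)
  then show ?thesis using fg finite_subset[of "support L (f \<boxplus> g)"] by (auto simp: mem_A A_apply)
qed

lemma smult_closed_A: "\<lbrakk>a \<in> carrier L; f \<in> carrier A\<rbrakk> \<Longrightarrow> a \<cdot> f \<in> carrier A"
proof -
  assume af: "a \<in> carrier L" "f \<in> carrier A"
  have "support L (a \<cdot> f) \<subseteq> support L f" using af by (auto simp: support_def A_apply)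
  then show ?thesis using af finite_subset[of "support L (a \<cdot> f)"] by (auto simp: mem_A A_apply)
qed

lemma abelian_group_A: "abelian_group A"
proof (rule abelian_groupI)
  show "\<zero>\<^bsub>A\<^esub> \<in> carrier A" by (simp add: mem_A support_def)
  fix f assume f: "f \<in> carrier A"
  have "support L (\<lambda>t. \<ominus> f t) = support L f" using f by (auto simp: support_def)
  then have "(\<lambda>t. \<ominus> f t) \<in> carrier A" using f by (auto simp: mem_A)
  moreover have "(\<lambda>t. \<ominus> f t) \<boxplus> f = \<zero>\<^bsub>A\<^esub>" using f by (auto simp: L.l_neg A_apply fun_eq_iff)
  ultimately show "\<exists>g\<in>carrier A. g \<boxplus> f = \<zero>\<^bsub>A\<^esub>" by blast
qed (auto simp: add_closed fun_eq_iff A_apply L.a_ac)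

lemma module_A: "module L A"
  by (rule moduleI[OF L.is_cring abelian_group_A])
    (auto simp: smult_closed_A fun_eq_iff A_apply L.l_distr L.r_distr L.m_assoc)

interpretation A: abelian_group A by (rule abelian_group_A)

text \<open>Enlarging the range of summation allows products with different left factors to be
  compared over a common range.\<close>

lemma mult_A:
  assumes f: "f \<in> carrier A" and g: "g \<in> carrier A" and t: "t \<in> carrier K"
    and S: "finite S" "support L f \<subseteq> S" "S \<subseteq> carrier K"
  shows "(f \<star> g) t = (\<Oplus>s\<in>S. f s \<otimes> g (inv\<^bsub>K\<^esub> s \<otimes>\<^bsub>K\<^esub> t) \<otimes> \<alpha> s (inv\<^bsub>K\<^esub> s \<otimes>\<^bsub>K\<^esub> t))"
proof -
  have "(f \<star> g) t =
    (\<Oplus>s\<in>support L f. f s \<otimes> g (inv\<^bsub>K\<^esub> s \<otimes>\<^bsub>K\<^esub> t) \<otimes> \<alpha> s (inv\<^bsub>K\<^esub> s \<otimes>\<^bsub>K\<^esub> t))"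
    using t by (simp add: twisted_algebra_def)
  also have "\<dots> = (\<Oplus>s\<in>S. f s \<otimes> g (inv\<^bsub>K\<^esub> s \<otimes>\<^bsub>K\<^esub> t) \<otimes> \<alpha> s (inv\<^bsub>K\<^esub> s \<otimes>\<^bsub>K\<^esub> t))"
  proof (rule L.add.finprod_mono_neutral_cong_left[OF S(1,2)])
    show "f s \<otimes> g (inv\<^bsub>K\<^esub> s \<otimes>\<^bsub>K\<^esub> t) \<otimes> \<alpha> s (inv\<^bsub>K\<^esub> s \<otimes>\<^bsub>K\<^esub> t) = \<zero>" if "s \<in> S - support L f" for s
    proof -
      have "f s = \<zero>" "s \<in> carrier K" using that S(3) by (auto simp: support_def)
      then show ?thesis using g t by simp
    qed
  qed (use f g t S in auto)
  finally show ?thesis .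
qed

lemma mult_A_outside: "t \<notin> carrier K \<Longrightarrow> (f \<star> g) t = \<zero>"
  by (simp add: twisted_algebra_def)

lemma A_supp: "f \<in> carrier A \<Longrightarrow> finite (support L f)" "f \<in> carrier A \<Longrightarrow> support L f \<subseteq> carrier K"
  by (auto simp: mem_A)

lemma mult_closed: assumes f: "f \<in> carrier A" and g: "g \<in> carrier A" shows "f \<star> g \<in> carrier A"
proof -
  let ?S = "(\<lambda>(s, u). s \<otimes>\<^bsub>K\<^esub> u) ` (support L f \<times> support L g)"
  have S: "finite ?S" "?S \<subseteq> carrier K" using A_supp f g by auto
  have zero: "(f \<star> g) t = \<zero>" if t: "t \<notin> ?S" for t
  proof (cases "t \<in> carrier K")
    case True
    have "g (inv\<^bsub>K\<^esub> s \<otimes>\<^bsub>K\<^esub> t) = \<zero>" if s: "s \<in> support L f" for s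
    proof (rule ccontr)
      assume "g (inv\<^bsub>K\<^esub> s \<otimes>\<^bsub>K\<^esub> t) \<noteq> \<zero>"
      then have "inv\<^bsub>K\<^esub> s \<otimes>\<^bsub>K\<^esub> t \<in> support L g" by (simp add: support_def)
      moreover have "t = s \<otimes>\<^bsub>K\<^esub> (inv\<^bsub>K\<^esub> s \<otimes>\<^bsub>K\<^esub> t)"
        using True A_supp(2)[OF f] s by (auto simp flip: cocycle.K.m_assoc)
      ultimately have "t \<in> ?S" using s by force
      then show False using t by blast
    qed
    then show ?thesis unfolding mult_A[OF f g True A_supp(1)[OF f] order_refl A_supp(2)[OF f]]
      using A_supp(2)[OF f] f True by (intro L.add.finprod_one_eqI) auto
  qed (simp add: mult_A_outside)
  then have "support L (f \<star> g) \<subseteq> ?S" unfolding support_def by blast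
  moreover have "(f \<star> g) t \<in> carrier L" for t
  proof (cases "t \<in> carrier K")
    case True
    then show ?thesis unfolding mult_A[OF f g True A_supp(1)[OF f] order_refl A_supp(2)[OF f]]
      using A_supp(2)[OF f] f g by (intro L.finsum_closed) auto
  qed (simp add: mult_A_outside)
  ultimately show ?thesis using S finite_subset[of "support L (f \<star> g)" ?S] by (auto simp: mem_A)
qed

lemma l_distr_A:
  assumes f: "f \<in> carrier A" and f': "f' \<in> carrier A" and g: "g \<in> carrier A"
  shows "(f \<boxplus> f') \<star> g = f \<star> g \<boxplus> f' \<star> g"
proof
  fix t
  let ?S = "support L f \<union> support L f'"
  show "((f \<boxplus> f') \<star> g) t = (f \<star> g \<boxplus> f' \<star> g) t"
  proof (cases "t \<in> carrier K")
    case True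
    have S: "finite ?S" "?S \<subseteq> carrier K" "support L (f \<boxplus> f') \<subseteq> ?S"
      using A_supp f f' by (auto simp: support_def A_apply)
    let ?T = "\<lambda>f s. f s \<otimes> g (inv\<^bsub>K\<^esub> s \<otimes>\<^bsub>K\<^esub> t) \<otimes> \<alpha> s (inv\<^bsub>K\<^esub> s \<otimes>\<^bsub>K\<^esub> t)"
    have T: "?T h \<in> ?S \<rightarrow> carrier L" if "h \<in> carrier A" for h
      using that g True S(2) by auto
    have "((f \<boxplus> f') \<star> g) t = (\<Oplus>s\<in>?S. ?T (f \<boxplus> f') s)"
      using mult_A[OF add_closed[OF f f'] g True S(1,3,2)] .
    also have "\<dots> = (\<Oplus>s\<in>?S. ?T f s \<oplus> ?T f' s)"
    proof (rule L.finsum_cong')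
      fix s assume "s \<in> ?S"
      then have s: "s \<in> carrier K" using S(2) by blast
      show "?T (f \<boxplus> f') s = ?T f s \<oplus> ?T f' s" using f f' g True s by (simp add: L.l_distr A_apply)
    qed (use T[OF f] T[OF f'] in auto)
    also have "\<dots> = (\<Oplus>s\<in>?S. ?T f s) \<oplus> (\<Oplus>s\<in>?S. ?T f' s)"
      by (rule L.finsum_addf[OF T[OF f] T[OF f']])
    also have "\<dots> = (f \<star> g \<boxplus> f' \<star> g) t"
      using mult_A[OF f g True S(1) _ S(2)] mult_A[OF f' g True S(1) _ S(2)] by (simp add: A_apply)
    finally show ?thesis .
  qed (simp add: mult_A_outside A_apply)
qed

lemma r_distr_A:
  assumes f: "f \<in> carrier A" and g: "g \<in> carrier A" and g': "g' \<in> carrier A"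
  shows "f \<star> (g \<boxplus> g') = f \<star> g \<boxplus> f \<star> g'"
proof
  fix t
  let ?S = "support L f"
  show "(f \<star> (g \<boxplus> g')) t = (f \<star> g \<boxplus> f \<star> g') t"
  proof (cases "t \<in> carrier K")
    case True
    note S = A_supp[OF f]
    let ?T = "\<lambda>g s. f s \<otimes> g (inv\<^bsub>K\<^esub> s \<otimes>\<^bsub>K\<^esub> t) \<otimes> \<alpha> s (inv\<^bsub>K\<^esub> s \<otimes>\<^bsub>K\<^esub> t)"
    have T: "?T h \<in> ?S \<rightarrow> carrier L" if "h \<in> carrier A" for h
      using that f True S(2) by auto
    have "(f \<star> (g \<boxplus> g')) t = (\<Oplus>s\<in>?S. ?T (g \<boxplus> g') s)"
      using mult_A[OF f add_closed[OF g g'] True S(1) order_refl S(2)] .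
    also have "\<dots> = (\<Oplus>s\<in>?S. ?T g s \<oplus> ?T g' s)"
    proof (rule L.finsum_cong')
      fix s assume "s \<in> ?S"
      then have s: "s \<in> carrier K" using S(2) by blast
      show "?T (g \<boxplus> g') s = ?T g s \<oplus> ?T g' s"
        using f g g' True s by (simp add: L.l_distr L.r_distr A_apply)
    qed (use T[OF g] T[OF g'] in auto)
    also have "\<dots> = (\<Oplus>s\<in>?S. ?T g s) \<oplus> (\<Oplus>s\<in>?S. ?T g' s)"
      by (rule L.finsum_addf[OF T[OF g] T[OF g']])
    also have "\<dots> = (f \<star> g \<boxplus> f \<star> g') t"
      using mult_A[OF f g True S(1) order_refl S(2)] mult_A[OF f g' True S(1) order_refl S(2)] by (simp add: A_apply)
    finally show ?thesis .
  qed (simp add: mult_A_outside A_apply)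
qed

lemma single_mult:
  assumes s: "s \<in> carrier K" and a: "a \<in> carrier L" and g: "g \<in> carrier A" and t: "t \<in> carrier K"
  shows "(single L s a \<star> g) t = a \<otimes> g (inv\<^bsub>K\<^esub> s \<otimes>\<^bsub>K\<^esub> t) \<otimes> \<alpha> s (inv\<^bsub>K\<^esub> s \<otimes>\<^bsub>K\<^esub> t)"
  using mult_A[OF single_closed[OF s a] g t, of "{s}"] support_single[of s a] s a g t by simp

lemma single_mult_single:
  assumes s: "s \<in> carrier K" and a: "a \<in> carrier L" and t: "t \<in> carrier K" and b: "b \<in> carrier L"
  shows "single L s a \<star> single L t b = single L (s \<otimes>\<^bsub>K\<^esub> t) (a \<otimes> b \<otimes> \<alpha> s t)"
proof
  fix u
  show "(single L s a \<star> single L t b) u = single L (s \<otimes>\<^bsub>K\<^esub> t) (a \<otimes> b \<otimes> \<alpha> s t) u"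
  proof (cases "u \<in> carrier K")
    case True
    have eq: "inv\<^bsub>K\<^esub> s \<otimes>\<^bsub>K\<^esub> u = t \<longleftrightarrow> u = s \<otimes>\<^bsub>K\<^esub> t"
      using s t True cocycle.K.inv_solve_left'[of t s u] by auto
    show ?thesis
    proof (cases "u = s \<otimes>\<^bsub>K\<^esub> t")
      case True
      then show ?thesis
        using single_mult[OF s a single_closed[OF t b] \<open>u \<in> carrier K\<close>] eq s t a b by simp
    next
      case False
      then show ?thesis
        using single_mult[OF s a single_closed[OF t b] \<open>u \<in> carrier K\<close>] eq s t a b True
        by (simp add: single_other)
    qed
  next
    case False
    then have "u \<noteq> s \<otimes>\<^bsub>K\<^esub> t" using s t by auto
    then show ?thesis using False by (simp add: mult_A_outside single_other)
  qed
qed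

lemma single_zero: "single L t \<zero> = \<zero>\<^bsub>A\<^esub>"
  by (auto simp: single_def)

text \<open>Additivity reduces identities in the algebra to homogeneous elements.\<close>
lemma A_induct [consumes 1, case_names single add]:
  assumes f: "f \<in> carrier A"
    and single: "\<And>t a. \<lbrakk>t \<in> carrier K; a \<in> carrier L\<rbrakk> \<Longrightarrow> P (single L t a)"
    and add: "\<And>f g. \<lbrakk>f \<in> carrier A; g \<in> carrier A; P f; P g\<rbrakk> \<Longrightarrow> P (f \<boxplus> g)"
  shows "P f"
  using f
proof (induction "card (support L f)" arbitrary: f)
  case 0
  then have "f = single L \<one>\<^bsub>K\<^esub> \<zero>" unfolding single_zero by (auto simp: mem_A support_def)
  then show ?case using single by simp
next
  case (Suc n)
  then obtain t where t: "t \<in> support L f" by fastforce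
  then have tK: "t \<in> carrier K" using A_supp(2) Suc.prems by blast
  let ?g = "f(t := \<zero>)"
  have supp: "support L ?g = support L f - {t}" by (auto simp: support_def)
  have g: "?g \<in> carrier A" using Suc.prems supp by (auto simp: mem_A)
  have "card (support L ?g) = n" using supp t Suc.hyps(2) A_supp(1)[OF Suc.prems] by simp
  then have "P ?g" using Suc.hyps(1) g by simp
  moreover have "P (single L t (f t))" using single tK Suc.prems by simp
  moreover have "f = single L t (f t) \<boxplus> ?g" using Suc.prems by (auto simp: fun_eq_iff A_apply single_def)
  ultimately show ?case using add[of "single L t (f t)" ?g] g tK Suc.prems by simp
qed

lemma assoc_A:
  assumes "f \<in> carrier A" "g \<in> carrier A" "h \<in> carrier A"
  shows "f \<star> g \<star> h = f \<star> (g \<star> h)"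
  using assms
proof (induction f rule: A_induct)
  case (single s a)
  from \<open>g \<in> carrier A\<close> \<open>h \<in> carrier A\<close> show ?case
  proof (induction g rule: A_induct)
    case sg: (single t b)
    from \<open>h \<in> carrier A\<close> show ?case
    proof (induction h rule: A_induct)
      case sh: (single u c)
      have "a \<otimes> b \<otimes> \<alpha> s t \<otimes> c \<otimes> \<alpha> (s \<otimes>\<^bsub>K\<^esub> t) u = (a \<otimes> b \<otimes> c) \<otimes> (\<alpha> s t \<otimes> \<alpha> (s \<otimes>\<^bsub>K\<^esub> t) u)"
        using single sg sh by (simp add: L.m_ac)
      also have "\<dots> = a \<otimes> (b \<otimes> c \<otimes> \<alpha> t u) \<otimes> \<alpha> s (t \<otimes>\<^bsub>K\<^esub> u)"
        using single sg sh by (simp add: cocycle_assoc L.m_ac)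
      finally show ?case
        using single sg sh by (simp add: single_mult_single cocycle.K.m_assoc)
    next
      case (add h h')
      then show ?case using single sg by (simp add: r_distr_A mult_closed)
    qed
  next
    case (add g g')
    then show ?case using single by (simp add: r_distr_A l_distr_A mult_closed)
  qed
next
  case (add f f')
  then show ?case by (simp add: l_distr_A mult_closed)
qed

text \<open>Together with \<open>scalar_right\<close> it realizes scalars as elements of identity
  degree, so the unit laws and the compatibility of scalars with products reduce to these two lemmas
  and associativity.\<close>

lemma scalar_left:
  assumes a: "a \<in> carrier L" and f: "f \<in> carrier A"
  shows "single L \<one>\<^bsub>K\<^esub> a \<star> f = a \<cdot> f"
proof
  fix t show "(single L \<one>\<^bsub>K\<^esub> a \<star> f) t = (a \<cdot> f) t"
    using single_mult[OF _ a f, of "\<one>\<^bsub>K\<^esub>" t] outside[OF f, of t] a f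
    by (cases "t \<in> carrier K") (simp_all add: mult_A_outside A_apply)
qed

lemma smult_add:
  "\<lbrakk>a \<in> carrier L; f \<in> carrier A; g \<in> carrier A\<rbrakk> \<Longrightarrow> a \<cdot> (f \<boxplus> g) = a \<cdot> f \<boxplus> a \<cdot> g"
  by (auto simp: fun_eq_iff A_apply L.r_distr)

lemma smult_single: "a \<in> carrier L \<Longrightarrow> a \<cdot> single L t b = single L t (a \<otimes> b)"
  by (auto simp: fun_eq_iff A_apply single_def)

lemma scalar_right:
  assumes "f \<in> carrier A" "a \<in> carrier L"
  shows "f \<star> single L \<one>\<^bsub>K\<^esub> a = a \<cdot> f"
  using assms
proof (induction f rule: A_induct)
  case (single t b)
  then show ?case by (simp add: single_mult_single smult_single L.m_comm)
next
  case (add f g)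
  then show ?case by (simp add: l_distr_A smult_add)
qed

section \<open>The twisted group algebra as a graded-division algebra\<close>

lemma ring_A: "ring A"
proof (rule ringI[OF abelian_group_A])
  have smult_one: "\<one> \<cdot> f = f" if "f \<in> carrier A" for f using that by (auto simp: fun_eq_iff A_apply)
  show "monoid A"
    by (rule monoidI) (auto simp: mult_closed assoc_A scalar_left scalar_right smult_one)
qed (auto simp: l_distr_A r_distr_A)

lemma unital_assoc_algebra_A: "unital_assoc_algebra L A"
proof (intro unital_assoc_algebra.intro unital_assoc_algebra_axioms.intro ring_A)
  show "vectorspace L A" by (intro vectorspace.intro module_A L.field_axioms)
  fix a f g assume a: "a \<in> carrier L" and f: "f \<in> carrier A" and g: "g \<in> carrier A"
  show "(a \<cdot> f) \<star> g = a \<cdot> (f \<star> g)"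
    using assoc_A[of "single L \<one>\<^bsub>K\<^esub> a" f g] a f g by (simp add: scalar_left mult_closed)
  show "f \<star> (a \<cdot> g) = a \<cdot> (f \<star> g)"
    using assoc_A[of f "single L \<one>\<^bsub>K\<^esub> a" g] a f g \<open>(a \<cdot> f) \<star> g = a \<cdot> (f \<star> g)\<close>
    by (simp add: scalar_left scalar_right)
qed

lemma finsum_A:
  assumes "finite I" "h \<in> I \<rightarrow> carrier A"
  shows "(\<Oplus>\<^bsub>A\<^esub>i\<in>I. h i) t = (\<Oplus>i\<in>I. h i t)"
  using assms
proof (induction I)
  case (insert i I)
  then show ?case by (simp add: Pi_def A_apply)
qed simp

lemma finsum_single:
  assumes "finite S" "S \<subseteq> carrier K" "\<And>t. t \<in> S \<Longrightarrow> a t \<in> carrier L"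
  shows "(\<Oplus>\<^bsub>A\<^esub>t\<in>S. single L t (a t)) = (\<lambda>t. if t \<in> S then a t else \<zero>)"
proof
  fix t
  have "(\<Oplus>\<^bsub>A\<^esub>s\<in>S. single L s (a s)) t = (\<Oplus>s\<in>S. single L s (a s) t)"
    by (rule finsum_A) (use assms in auto)
  also have "\<dots> = (\<Oplus>s\<in>S. if t = s then a s else \<zero>)" by (simp add: single_def)
  also have "\<dots> = (if t \<in> S then a t else \<zero>)"
    using L.finsum_singleton[of t S a] assms by (auto intro!: L.add.finprod_one_eqI)
  finally show "(\<Oplus>\<^bsub>A\<^esub>s\<in>S. single L s (a s)) t = (if t \<in> S then a t else \<zero>)" .
qed

lemma graded_division_algebra_A: "graded_division_algebra L K A (twisted_component L)"
proof (intro graded_division_algebra.intro graded_algebra.intro graded_algebra_axioms.intro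
    graded_division_algebra_axioms.intro unital_assoc_algebra_A cocycle.K.is_group)
  let ?D = "twisted_component L"
  have compE: "\<exists>a\<in>carrier L. y = single L t a" if "t \<in> carrier K" "y \<in> ?D t" for y t
    using that(2) by (auto simp: twisted_component_def)
  have compI: "single L t a \<in> ?D t" if "t \<in> carrier K" "a \<in> carrier L" for a t
    using that(2) by (simp add: twisted_component_def)
  show "VectorSpace.subspace L (?D t) A" if t: "t \<in> carrier K" for t
  proof (intro subspace.intro submodule.intro)
    show "vectorspace L A" by (intro vectorspace.intro module_A L.field_axioms)
    show "module L A" by (rule module_A)
    show "?D t \<subseteq> carrier A" using t by (auto simp: twisted_component_def)
    show "\<zero>\<^bsub>A\<^esub> \<in> ?D t" using compI[OF t L.zero_closed] by (simp add: single_zero)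
    show "v \<boxplus> w \<in> ?D t" if vw: "v \<in> ?D t" "w \<in> ?D t" for v w
    proof -
      obtain a b where ab: "a \<in> carrier L" "v = single L t a" "b \<in> carrier L" "w = single L t b"
        using compE[OF t] vw by metis
      then have "v \<boxplus> w = single L t (a \<oplus> b)" by (auto simp: fun_eq_iff A_apply single_def)
      then show ?thesis using compI[OF t, of "a \<oplus> b"] ab by simp
    qed
    show "c \<cdot> v \<in> ?D t" if cv: "c \<in> carrier L" "v \<in> ?D t" for c v
      using compE[OF t cv(2)] cv(1) compI[OF t] smult_single by auto
  qed
  show "y \<star> z \<in> ?D (s \<otimes>\<^bsub>K\<^esub> t)" if st: "s \<in> carrier K" "t \<in> carrier K" "y \<in> ?D s" "z \<in> ?D t" for s t y z
    using compE[OF st(1,3)] compE[OF st(2,4)] st(1,2) compI single_mult_single by auto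
  show "y \<in> Units A" if t: "t \<in> carrier K" and y: "y \<in> ?D t" "y \<noteq> \<zero>\<^bsub>A\<^esub>" for t y
  proof -
    obtain a where a: "a \<in> carrier L" "y = single L t a" using compE[OF t y(1)] by blast
    then have "a \<noteq> \<zero>" using y(2) single_zero by auto
    let ?i = "inv\<^bsub>K\<^esub> t"
    \<comment> \<open>In either order, the product of the elements of degrees \<open>t\<close> and
      \<open>?i\<close> with coefficients \<open>a\<close> and \<open>b\<close> has coefficient
      \<open>a \<otimes> b \<otimes> \<alpha> t ?i\<close> at the identity, which dictates
      \<open>b\<close>.\<close>
    define b where "b = inv (a \<otimes> \<alpha> t ?i)"
    have ne: "a \<otimes> \<alpha> t ?i \<in> Units L"
      using a \<open>a \<noteq> \<zero>\<close> t cocycle_nonzero[of t ?i] L.integral[of a "\<alpha> t ?i"] by (auto simp: L.field_Units)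
    then have b: "b \<in> carrier L" "b \<otimes> (a \<otimes> \<alpha> t ?i) = \<one>" by (auto simp: b_def)
    have z: "single L ?i b \<in> carrier A" using b t by simp
    have ab: "a \<otimes> b \<otimes> \<alpha> t ?i = \<one>" "b \<otimes> a \<otimes> \<alpha> t ?i = \<one>" using b a t by (simp_all add: L.m_ac)
    have "y \<star> single L ?i b = \<one>\<^bsub>A\<^esub>"
      using a b t ab by (simp add: single_mult_single)
    moreover have "single L ?i b \<star> y = \<one>\<^bsub>A\<^esub>"
      using a b t ab cocycle.inv_comm[OF t] by (simp add: single_mult_single)
    ultimately show ?thesis using z a t unfolding Units_def by auto
  qed
  show "\<exists>!h. h \<in> (\<Pi>\<^sub>E t\<in>carrier K. ?D t) \<and> finite {t \<in> carrier K. h t \<noteq> \<zero>\<^bsub>A\<^esub>} \<and>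
      f = (\<Oplus>\<^bsub>A\<^esub>t\<in>{t \<in> carrier K. h t \<noteq> \<zero>\<^bsub>A\<^esub>}. h t)" if f: "f \<in> carrier A" for f
  proof (rule ex1I[of _ "\<lambda>t\<in>carrier K. single L t (f t)"], intro conjI)
    let ?h = "\<lambda>t\<in>carrier K. single L t (f t)"
    have nz: "single L t a \<noteq> \<zero>\<^bsub>A\<^esub> \<longleftrightarrow> a \<noteq> \<zero>" for t a
      by (metis A_simps(2) single_same single_zero)
    show "?h \<in> (\<Pi>\<^sub>E t\<in>carrier K. ?D t)" using f compI by auto
    have S: "{t \<in> carrier K. ?h t \<noteq> \<zero>\<^bsub>A\<^esub>} = support L f"
      using nz A_supp(2)[OF f] by (auto simp: support_def simp del: A_simps)
    show "finite {t \<in> carrier K. ?h t \<noteq> \<zero>\<^bsub>A\<^esub>}" unfolding S by (rule A_supp(1)[OF f])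
    have "(\<Oplus>\<^bsub>A\<^esub>t\<in>support L f. ?h t) = (\<Oplus>\<^bsub>A\<^esub>t\<in>support L f. single L t (f t))"
      by (rule A.finsum_cong') (use A_supp(2)[OF f] f in auto)
    also have "\<dots> = f"
      using finsum_single[of "support L f" f] A_supp[OF f] f by (auto simp: fun_eq_iff A_apply support_def)
    finally show "f = (\<Oplus>\<^bsub>A\<^esub>t\<in>{t \<in> carrier K. ?h t \<noteq> \<zero>\<^bsub>A\<^esub>}. ?h t)" unfolding S by simp
    fix h assume h: "h \<in> (\<Pi>\<^sub>E t\<in>carrier K. ?D t) \<and> finite {t \<in> carrier K. h t \<noteq> \<zero>\<^bsub>A\<^esub>} \<and>
      f = (\<Oplus>\<^bsub>A\<^esub>t\<in>{t \<in> carrier K. h t \<noteq> \<zero>\<^bsub>A\<^esub>}. h t)"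
    let ?S = "{t \<in> carrier K. h t \<noteq> \<zero>\<^bsub>A\<^esub>}"
    \<comment> \<open>For uniqueness the coefficients of an arbitrary decomposition are read off by
      evaluating its sum at each \<open>t\<close>.\<close>
    have "\<exists>a. \<forall>t\<in>carrier K. a t \<in> carrier L \<and> h t = single L t (a t)"
      using h compE by (intro bchoice) blast
    then obtain a where a: "\<And>t. t \<in> carrier K \<Longrightarrow> a t \<in> carrier L \<and> h t = single L t (a t)" by blast
    have "f = (\<Oplus>\<^bsub>A\<^esub>t\<in>?S. h t)" using h by blast
    also have "\<dots> = (\<Oplus>\<^bsub>A\<^esub>t\<in>?S. single L t (a t))"
      by (rule A.finsum_cong') (use a in auto)
    also have "\<dots> = (\<lambda>t. if t \<in> ?S then a t else \<zero>)"
      by (rule finsum_single) (use h a in auto)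
    finally have fa: "f t = (if t \<in> ?S then a t else \<zero>)" for t by metis
    show "h = ?h"
    proof (rule extensionalityI[of _ "carrier K"])
      fix t assume t: "t \<in> carrier K"
      have "f t = a t" using fa[of t] a[OF t] t nz[of t "a t"] by auto
      then show "h t = ?h t" using a[OF t] t by simp
    qed (use h in \<open>auto simp: PiE_def\<close>)
  qed
qed

lemma based_graded_algebra_A:
  "based_graded_algebra L K A (twisted_component L) \<alpha> (\<lambda>t. single L t \<one>)"
proof (intro based_graded_algebra.intro based_graded_algebra_axioms.intro
    graded_division_algebra_A cocycle.cocycle_axioms)
  have "single L t \<one> \<noteq> \<zero>\<^bsub>A\<^esub>" for t using single_same[of t \<one>] by (auto simp: fun_eq_iff A_apply intro!: exI[of _ t])
  moreover have "single L s \<one> \<star> single L t \<one> = \<alpha> s t \<cdot> single L (s \<otimes>\<^bsub>K\<^esub> t) \<one>"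
    if "s \<in> carrier K" "t \<in> carrier K" for s t using that by (simp add: single_mult_single smult_single)
  ultimately show "homogeneous_basis L K A (twisted_component L) (\<lambda>t. single L t \<one>) \<alpha>"
    unfolding homogeneous_basis_def twisted_component_def
    by (auto simp: smult_single intro!: image_eqI)
qed

end

section \<open>Isomorphisms of graded algebras\<close>

lemma graded_isomorphic_sym:
  assumes A: "graded_algebra L K A D" and iso: "graded_isomorphic L K A D B E"
  shows "graded_isomorphic L K B E A D"
proof -
  interpret A: graded_algebra L K A D by fact
  obtain h where h: "h \<in> ring_iso A B"
    "\<And>a x. \<lbrakk>a \<in> carrier L; x \<in> carrier A\<rbrakk> \<Longrightarrow> h (a \<odot>\<^bsub>A\<^esub> x) = a \<odot>\<^bsub>B\<^esub> h x"
    "\<And>t. t \<in> carrier K \<Longrightarrow> h ` D t = E t"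
    using iso unfolding graded_isomorphic_def by blast
  let ?g = "inv_into (carrier A) h"
  have bij: "bij_betw h (carrier A) (carrier B)" using ring_iso_memE(5)[OF h(1)] .
  have gh: "?g (h x) = x" if "x \<in> carrier A" for x
    using bij_betw_inv_into_left[OF bij that] .
  have hg: "\<exists>x\<in>carrier A. y = h x" if "y \<in> carrier B" for y
    using bij_betw_imp_surj_on[OF bij] that by auto
  show ?thesis unfolding graded_isomorphic_def
  proof (intro exI[of _ ?g] conjI ballI)
    show "?g \<in> ring_iso B A" by (rule ring_iso_set_sym[OF A.alg.ring_axioms h(1)])
    fix a y assume a: "a \<in> carrier L" and y: "y \<in> carrier B"
    obtain x where x: "x \<in> carrier A" "y = h x" using hg[OF y] by blast
    show "?g (a \<odot>\<^bsub>B\<^esub> y) = a \<odot>\<^bsub>A\<^esub> ?g y"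
      using gh[of "a \<odot>\<^bsub>A\<^esub> x"] gh[OF x(1)] h(2)[OF a x(1)] a x by simp
  next
    fix t assume t: "t \<in> carrier K"
    have "?g ` E t = (\<lambda>x. ?g (h x)) ` D t" by (simp add: h(3)[OF t, symmetric] image_image)
    also have "\<dots> = id ` D t" using gh A.component_carrier[OF t] by (intro image_cong) auto
    finally show "?g ` E t = D t" by simp
  qed
qed

lemma graded_isomorphic_trans:
  assumes "graded_isomorphic L K A D B E" "graded_isomorphic L K B E C G"
  shows "graded_isomorphic L K A D C G"
proof -
  obtain h where h: "h \<in> ring_iso A B"
    "\<And>a x. \<lbrakk>a \<in> carrier L; x \<in> carrier A\<rbrakk> \<Longrightarrow> h (a \<odot>\<^bsub>A\<^esub> x) = a \<odot>\<^bsub>B\<^esub> h x"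
    "\<And>t. t \<in> carrier K \<Longrightarrow> h ` D t = E t"
    using assms(1) unfolding graded_isomorphic_def by blast
  obtain g where g: "g \<in> ring_iso B C"
    "\<And>a x. \<lbrakk>a \<in> carrier L; x \<in> carrier B\<rbrakk> \<Longrightarrow> g (a \<odot>\<^bsub>B\<^esub> x) = a \<odot>\<^bsub>C\<^esub> g x"
    "\<And>t. t \<in> carrier K \<Longrightarrow> g ` E t = G t"
    using assms(2) unfolding graded_isomorphic_def by blast
  show ?thesis unfolding graded_isomorphic_def
  proof (intro exI[of _ "g \<circ> h"] conjI ballI)
    show "g \<circ> h \<in> ring_iso A C" by (rule ring_iso_set_trans[OF h(1) g(1)])
    show "(g \<circ> h) (a \<odot>\<^bsub>A\<^esub> x) = a \<odot>\<^bsub>C\<^esub> (g \<circ> h) x" if "a \<in> carrier L" "x \<in> carrier A" for a x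
      using that h(2) g(2) ring_iso_memE(1)[OF h(1)] by simp
    show "(g \<circ> h) ` D t = G t" if "t \<in> carrier K" for t
      using h(3)[OF that] g(3)[OF that] by (simp flip: image_image)
  qed
qed

text \<open>The image of a homogeneous basis has the same structure constants, so the cocycle itself
  is carried over and not just its class.\<close>

lemma based_graded_algebra_transfer:
  assumes A: "based_graded_algebra L K A D \<alpha> x" and B: "graded_division_algebra L K B E"
    and iso: "graded_isomorphic L K A D B E"
  obtains y where "based_graded_algebra L K B E \<alpha> y"
proof -
  interpret A: based_graded_algebra L K A D \<alpha> x by fact
  interpret B: graded_division_algebra L K B E by fact
  obtain h where h: "h \<in> ring_iso A B"
    "\<And>a x. \<lbrakk>a \<in> carrier L; x \<in> carrier A\<rbrakk> \<Longrightarrow> h (a \<odot>\<^bsub>A\<^esub> x) = a \<odot>\<^bsub>B\<^esub> h x"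
    "\<And>t. t \<in> carrier K \<Longrightarrow> h ` D t = E t"
    using iso unfolding graded_isomorphic_def by blast
  note hE = ring_iso_memE[OF h(1)]
  have h0: "h \<zero>\<^bsub>A\<^esub> = \<zero>\<^bsub>B\<^esub>"
    using hE(3)[of "\<zero>\<^bsub>A\<^esub>" "\<zero>\<^bsub>A\<^esub>"] hE(1)[of "\<zero>\<^bsub>A\<^esub>"] by simp
  have hnz: "h z \<noteq> \<zero>\<^bsub>B\<^esub>" if "z \<in> carrier A" "z \<noteq> \<zero>\<^bsub>A\<^esub>" for z
    using bij_betw_imp_inj_on[OF hE(5)] that h0 unfolding inj_on_def by (metis A.M.zero_closed)
  have "homogeneous_basis L K B E (\<lambda>t. h (x t)) \<alpha>"
    unfolding homogeneous_basis_def
  proof (intro conjI ballI)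
    fix t assume t: "t \<in> carrier K"
    show "h (x t) \<in> E t" using h(3)[OF t] A.basis_mem[OF t] by blast
    show "h (x t) \<noteq> \<zero>\<^bsub>B\<^esub>" using hnz A.basis_nonzero[OF t] t by simp
    show "\<exists>a\<in>carrier L. y = a \<odot>\<^bsub>B\<^esub> h (x t)" if y: "y \<in> E t" for y
    proof -
      obtain z where z: "z \<in> D t" "y = h z" using y h(3)[OF t] by blast
      obtain a where "a \<in> carrier L" "z = a \<odot>\<^bsub>A\<^esub> x t" using A.basis_gen[OF t z(1)] by blast
      then show ?thesis using z h(2) t by auto
    qed
  next
    show "h (x \<one>\<^bsub>K\<^esub>) = \<one>\<^bsub>B\<^esub>" using hE(4) A.basis_one by simp
    fix s t assume "s \<in> carrier K" "t \<in> carrier K"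
    then show "h (x s) \<otimes>\<^bsub>B\<^esub> h (x t) = \<alpha> s t \<odot>\<^bsub>B\<^esub> h (x (s \<otimes>\<^bsub>K\<^esub> t))"
      using hE(2)[of "x s" "x t"] h(2)[of "\<alpha> s t" "x (s \<otimes>\<^bsub>K\<^esub> t)"] A.basis_mult by simp
  qed
  then have "based_graded_algebra L K B E \<alpha> (\<lambda>t. h (x t))"
    by (intro based_graded_algebra.intro based_graded_algebra_axioms.intro B A.cocycle.cocycle_axioms)
  then show thesis by (rule that)
qed

text \<open>Makes the twisted algebra a common model: any two algebras with the same cocycle are
  isomorphic through it.\<close>

theorem twisted_algebra_graded_isomorphic:
  assumes C: "based_graded_algebra L K C G \<alpha> x"
  shows "graded_isomorphic L K (twisted_algebra L K \<alpha>) (twisted_component L) C G"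
proof -
  interpret C: based_graded_algebra L K C G \<alpha> x by fact
  interpret T: twisted_group_algebra L K \<alpha>
    by (intro twisted_group_algebra.intro C.field_axioms C.cocycle.cocycle_axioms)
  let ?A = "twisted_algebra L K \<alpha>"
  define h where "h f = (\<Oplus>\<^bsub>C\<^esub>t\<in>support L f. f t \<odot>\<^bsub>C\<^esub> x t)" for f
  have terms: "(\<lambda>t. f t \<odot>\<^bsub>C\<^esub> x t) \<in> S \<rightarrow> carrier C" if "f \<in> carrier ?A" "S \<subseteq> carrier K" for f S
    using that by auto
  have h_superset: "h f = (\<Oplus>\<^bsub>C\<^esub>t\<in>S. f t \<odot>\<^bsub>C\<^esub> x t)"
    if f: "f \<in> carrier ?A" and S: "finite S" "support L f \<subseteq> S" "S \<subseteq> carrier K" for f S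
    unfolding h_def
  proof (rule C.M.add.finprod_mono_neutral_cong_left[OF S(1,2)])
    show "f t \<odot>\<^bsub>C\<^esub> x t = \<zero>\<^bsub>C\<^esub>" if "t \<in> S - support L f" for t
    proof -
      have "f t = \<zero>\<^bsub>L\<^esub>" "t \<in> carrier K" using that S(3) by (auto simp: support_def)
      then show ?thesis by simp
    qed
  qed (use terms[OF f S(3)] in auto)
  have h_closed: "h f \<in> carrier C" if "f \<in> carrier ?A" for f
    unfolding h_def using terms[OF that] T.A_supp(2)[OF that] by (intro C.M.finsum_closed) blast
  have h_add: "h (f \<oplus>\<^bsub>?A\<^esub> g) = h f \<oplus>\<^bsub>C\<^esub> h g" if f: "f \<in> carrier ?A" and g: "g \<in> carrier ?A" for f g
  proof -
    let ?S = "support L f \<union> support L g"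
    have S: "finite ?S" "?S \<subseteq> carrier K" "support L (f \<oplus>\<^bsub>?A\<^esub> g) \<subseteq> ?S"
      using T.A_supp f g by (auto simp: support_def T.A_apply)
    have "h (f \<oplus>\<^bsub>?A\<^esub> g) = (\<Oplus>\<^bsub>C\<^esub>t\<in>?S. (f \<oplus>\<^bsub>?A\<^esub> g) t \<odot>\<^bsub>C\<^esub> x t)"
      by (rule h_superset[OF T.add_closed[OF f g] S(1,3,2)])
    also have "\<dots> = (\<Oplus>\<^bsub>C\<^esub>t\<in>?S. f t \<odot>\<^bsub>C\<^esub> x t \<oplus>\<^bsub>C\<^esub> g t \<odot>\<^bsub>C\<^esub> x t)"
    proof (rule C.M.finsum_cong')
      fix t assume "t \<in> ?S"
      then have "t \<in> carrier K" using S(2) by blast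
      then show "(f \<oplus>\<^bsub>?A\<^esub> g) t \<odot>\<^bsub>C\<^esub> x t = f t \<odot>\<^bsub>C\<^esub> x t \<oplus>\<^bsub>C\<^esub> g t \<odot>\<^bsub>C\<^esub> x t"
        using f g by (simp add: T.A_apply C.smult_l_distr)
    qed (use terms[OF f S(2)] terms[OF g S(2)] in auto)
    also have "\<dots> = (\<Oplus>\<^bsub>C\<^esub>t\<in>?S. f t \<odot>\<^bsub>C\<^esub> x t) \<oplus>\<^bsub>C\<^esub> (\<Oplus>\<^bsub>C\<^esub>t\<in>?S. g t \<odot>\<^bsub>C\<^esub> x t)"
      by (rule C.M.finsum_addf[OF terms[OF f S(2)] terms[OF g S(2)]])
    also have "\<dots> = h f \<oplus>\<^bsub>C\<^esub> h g"
      using h_superset[OF f S(1) _ S(2)] h_superset[OF g S(1) _ S(2)] by simp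
    finally show ?thesis .
  qed
  have h_single: "h (single L t a) = a \<odot>\<^bsub>C\<^esub> x t" if "t \<in> carrier K" "a \<in> carrier L" for t a
    using h_superset[OF T.single_closed[OF that], of "{t}"] T.support_single[of t a] that by simp
  have h_mult: "h (f \<otimes>\<^bsub>?A\<^esub> g) = h f \<otimes>\<^bsub>C\<^esub> h g" if "f \<in> carrier ?A" "g \<in> carrier ?A" for f g
    using that
  proof (induction f rule: T.A_induct)
    case (single s a)
    from \<open>g \<in> carrier ?A\<close> show ?case
    proof (induction g rule: T.A_induct)
      case sg: (single t b)
      then show ?case using single
        by (simp add: T.single_mult_single h_single C.smult_mult_smult C.basis_mult C.smult_assoc1)
    next
      case (add g g')
      then show ?case using single
        by (simp add: T.r_distr_A T.mult_closed h_add h_closed C.alg.r_distr)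
    qed
  next
    case (add f f')
    then show ?case by (simp add: T.l_distr_A T.mult_closed h_add h_closed C.alg.l_distr)
  qed
  have h_smult: "h (a \<odot>\<^bsub>?A\<^esub> f) = a \<odot>\<^bsub>C\<^esub> h f" if a: "a \<in> carrier L" and f: "f \<in> carrier ?A" for a f
    using f
  proof (induction f rule: T.A_induct)
    case (single t b)
    then show ?case using a by (simp add: T.smult_single h_single C.smult_assoc1)
  next
    case (add f g)
    then show ?case using a
      by (simp add: T.smult_add T.smult_closed_A h_add h_closed C.smult_r_distr)
  qed
  have smult_nz: "a \<odot>\<^bsub>C\<^esub> x t \<noteq> \<zero>\<^bsub>C\<^esub> \<longleftrightarrow> a \<noteq> \<zero>\<^bsub>L\<^esub>" if "t \<in> carrier K" "a \<in> carrier L" for t a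
    using C.smult_eq_zeroD[of a "x t"] C.basis_nonzero that by auto
  \<comment> \<open>This is the family of homogeneous components of \<open>h f\<close>. The
    uniqueness in \<open>direct_sum\<close> yields injectivity of \<open>h\<close>, the existence
    its surjectivity.\<close>
  define comp where "comp f = (\<lambda>t\<in>carrier K. f t \<odot>\<^bsub>C\<^esub> x t)" for f
  have comp_mem: "comp f \<in> (\<Pi>\<^sub>E t\<in>carrier K. G t)" if "f \<in> carrier ?A" for f
    using that C.component_smult C.basis_mem by (auto simp: comp_def)
  have comp_supp: "{t \<in> carrier K. comp f t \<noteq> \<zero>\<^bsub>C\<^esub>} = support L f" if f: "f \<in> carrier ?A" for f
    using smult_nz f T.A_supp(2)[OF f] by (auto simp: comp_def support_def)
  have comp_sum: "h f = (\<Oplus>\<^bsub>C\<^esub>t\<in>{t \<in> carrier K. comp f t \<noteq> \<zero>\<^bsub>C\<^esub>}. comp f t)" if f: "f \<in> carrier ?A" for f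
    unfolding comp_supp[OF f] h_def
    by (rule C.M.finsum_cong') (use T.A_supp(2)[OF f] f in \<open>auto simp: comp_def\<close>)
  have inj: "inj_on h (carrier ?A)"
  proof (rule inj_onI)
    fix f g assume f: "f \<in> carrier ?A" and g: "g \<in> carrier ?A" and eq: "h f = h g"
    define Q where "Q k \<longleftrightarrow> k \<in> (\<Pi>\<^sub>E t\<in>carrier K. G t) \<and>
        finite {t \<in> carrier K. k t \<noteq> \<zero>\<^bsub>C\<^esub>} \<and>
        h f = (\<Oplus>\<^bsub>C\<^esub>t\<in>{t \<in> carrier K. k t \<noteq> \<zero>\<^bsub>C\<^esub>}. k t)" for k
    have ex1: "\<exists>!k. Q k" unfolding Q_def by (rule C.direct_sum[OF h_closed[OF f]])
    have "Q (comp f)"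
      unfolding Q_def using comp_mem[OF f] comp_sum[OF f] T.A_supp(1)[OF f] comp_supp[OF f] by simp
    moreover have "Q (comp g)"
      unfolding Q_def eq using comp_mem[OF g] comp_sum[OF g] T.A_supp(1)[OF g] comp_supp[OF g] by simp
    ultimately have comp: "comp f = comp g" using ex1 by blast
    show "f = g"
    proof
      fix t show "f t = g t"
      proof (cases "t \<in> carrier K")
        case True
        then have "f t \<odot>\<^bsub>C\<^esub> x t = g t \<odot>\<^bsub>C\<^esub> x t" using fun_cong[OF comp, of t] by (simp add: comp_def)
        then show ?thesis
          by (intro C.smult_right_cancel[of _ _ "x t"]) (use True f g C.basis_nonzero in auto)
      qed (simp add: T.outside f g)
    qed
  qed
  have surj: "\<exists>f\<in>carrier ?A. y = h f" if y: "y \<in> carrier C" for y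
  proof -
    obtain k where k: "k \<in> (\<Pi>\<^sub>E t\<in>carrier K. G t)" "finite {t \<in> carrier K. k t \<noteq> \<zero>\<^bsub>C\<^esub>}"
      "y = (\<Oplus>\<^bsub>C\<^esub>t\<in>{t \<in> carrier K. k t \<noteq> \<zero>\<^bsub>C\<^esub>}. k t)"
      using C.direct_sum[OF y] by (elim ex1E) blast
    let ?S = "{t \<in> carrier K. k t \<noteq> \<zero>\<^bsub>C\<^esub>}"
    have "\<forall>t\<in>carrier K. \<exists>a. a \<in> carrier L \<and> k t = a \<odot>\<^bsub>C\<^esub> x t"
      using C.basis_gen k(1) by blast
    then obtain a where a: "\<And>t. t \<in> carrier K \<Longrightarrow> a t \<in> carrier L \<and> k t = a t \<odot>\<^bsub>C\<^esub> x t"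
      using bchoice[of "carrier K" "\<lambda>t a. a \<in> carrier L \<and> k t = a \<odot>\<^bsub>C\<^esub> x t"] by blast
    define f where "f t = (if t \<in> carrier K then a t else \<zero>\<^bsub>L\<^esub>)" for t
    have supp: "support L f = ?S"
    proof -
      have "f t \<noteq> \<zero>\<^bsub>L\<^esub> \<longleftrightarrow> t \<in> ?S" for t using a[of t] smult_nz[of t "a t"] by (auto simp: f_def)
      then show ?thesis by (auto simp: support_def)
    qed
    have f: "f \<in> carrier ?A" unfolding T.mem_A supp using k(2) a by (auto simp: f_def)
    have "y = h f" unfolding k(3) h_def supp
      by (rule C.M.finsum_cong') (use a in \<open>auto simp: f_def\<close>)
    then show ?thesis using f by blast
  qed
  show ?thesis unfolding graded_isomorphic_def
  proof (intro exI[of _ h] conjI ballI)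
    show "h \<in> ring_iso ?A C"
    proof (rule ring_iso_memI)
      show "h \<one>\<^bsub>?A\<^esub> = \<one>\<^bsub>C\<^esub>" using h_single[of "\<one>\<^bsub>K\<^esub>" "\<one>\<^bsub>L\<^esub>"] C.basis_one by simp
      show "bij_betw h (carrier ?A) (carrier C)"
        unfolding bij_betw_def using inj surj h_closed by blast
    qed (use h_closed h_mult h_add in auto)
    show "h (a \<odot>\<^bsub>?A\<^esub> f) = a \<odot>\<^bsub>C\<^esub> h f" if "a \<in> carrier L" "f \<in> carrier ?A" for a f
      using h_smult that .
    fix t assume t: "t \<in> carrier K"
    have "h ` twisted_component L t = (\<lambda>a. a \<odot>\<^bsub>C\<^esub> x t) ` carrier L"
      unfolding twisted_component_def image_image by (rule image_cong) (use h_single t in auto)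
    also have "\<dots> = G t"
      using C.basis_gen[OF t] C.component_smult[OF t _ C.basis_mem[OF t]] by auto
    finally show "h ` twisted_component L t = G t" .
  qed
qed

section \<open>The classification\<close>

lemma carrier_F: "carrier (F L K t) =
    rcosets\<^bsub>mult_of L\<^esub> (powers (mult_of L) (carrier (mult_of L)) (group.ord K t))"
  by (simp add: power_quotient_def FactGroup_def)

lemma mult_F: "X \<otimes>\<^bsub>F L K t\<^esub> Y = X <#>\<^bsub>mult_of L\<^esub> Y"
  by (simp add: power_quotient_def)

text \<open>Reduces the conditions on quotients of the unit group to the abstract setting.
  Extensionality is split off because it is what turns agreement on \<open>K\<close> and on its
  torsion into equality of the pairs.\<close>

lemma admissible_iff:
  assumes L: "field L" and K: "comm_group K"
  shows "admissible L K \<beta> \<mu> \<longleftrightarrow> \<beta> \<in> extensional (carrier K \<times> carrier K) \<and> \<mu> \<in> extensional (Tor K) \<and>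
    order_family (mult_of L) K (\<lambda>s t. \<beta> (s, t)) \<mu>"
proof -
  interpret U: comm_group "mult_of L" by (rule field.comm_group_mult_of[OF L])
  interpret K: comm_group K by fact
  have bichar: "alternating_bicharacter L K \<beta> \<longleftrightarrow> \<beta> \<in> extensional (carrier K \<times> carrier K) \<and>
    alternating (mult_of L) K (\<lambda>s t. \<beta> (s, t))"
  proof
    assume b: "alternating_bicharacter L K \<beta>"
    then have "alternating (mult_of L) K (\<lambda>s t. \<beta> (s, t))"
      unfolding alternating_bicharacter_def
      by unfold_locales (auto simp: PiE_def Pi_def)
    then show "\<beta> \<in> extensional (carrier K \<times> carrier K) \<and> alternating (mult_of L) K (\<lambda>s t. \<beta> (s, t))"
      using b unfolding alternating_bicharacter_def by (auto simp: PiE_def)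
  next
    assume b: "\<beta> \<in> extensional (carrier K \<times> carrier K) \<and> alternating (mult_of L) K (\<lambda>s t. \<beta> (s, t))"
    then interpret alternating "mult_of L" K "\<lambda>s t. \<beta> (s, t)" by blast
    show "alternating_bicharacter L K \<beta>"
      unfolding alternating_bicharacter_def
      using b closed mult_left mult_right self by (auto simp: PiE_def Pi_def)
  qed
  show ?thesis
  proof
    assume adm: "admissible L K \<beta> \<mu>"
    then have A: "cond_A L K \<mu>" and B: "cond_B L K \<mu>" and C: "cond_C L K \<mu>" and D: "cond_D L K \<beta> \<mu>"
      and \<mu>: "\<mu> \<in> F_K L K" and b: "\<beta> \<in> extensional (carrier K \<times> carrier K)"
      "alternating (mult_of L) K (\<lambda>s t. \<beta> (s, t))"
      unfolding admissible_def bichar by blast+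
    have "order_family (mult_of L) K (\<lambda>s t. \<beta> (s, t)) \<mu>"
    proof (intro order_family.intro order_family_axioms.intro b(2))
      fix t assume "t \<in> carrier K" "K.ord t > 0"
      then show "\<mu> t \<in> U.Pow_cosets (K.ord t)"
        using \<mu> unfolding F_K_def carrier_F by (auto simp: K.Tor_iff PiE_def Pi_def)
    next
      fix g and n :: nat assume "g \<in> carrier K" "K.ord g > 0" "n > 0" "n dvd K.ord g"
      then show "\<mu> (g [^]\<^bsub>K\<^esub> n) = U.Pow_subgroup (K.ord g div n) <#>\<^bsub>mult_of L\<^esub> \<mu> g"
        by (intro A[unfolded cond_A_def quotient_image_def, rule_format]) (simp_all add: K.Tor_iff)
    next
      fix g h assume "g \<in> carrier K" "h \<in> carrier K" "K.ord g > 0" "K.ord h > 0"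
        "coprime (K.ord g) (K.ord h)"
      then show "\<mu> (g \<otimes>\<^bsub>K\<^esub> h) =
          powers (mult_of L) (\<mu> g) (K.ord h) <#>\<^bsub>mult_of L\<^esub> powers (mult_of L) (\<mu> h) (K.ord g)"
        by (intro B[unfolded cond_B_def mult_F, rule_format]) (simp_all add: K.Tor_iff)
    next
      fix g h and p k l :: nat
      assume *: "g \<in> carrier K" "h \<in> carrier K" "prime p" "K.ord g = p ^ k" "K.ord h = p ^ l" "l < k"
      then have "K.ord g > 0" "K.ord h > 0" "p ^ l < p ^ k"
        using prime_gt_1_nat[OF *(3)] by (simp_all add: power_strict_increasing)
      then show "\<mu> (g \<otimes>\<^bsub>K\<^esub> h) = \<mu> g <#>\<^bsub>mult_of L\<^esub> powers (mult_of L) (\<mu> h) (p ^ (k - l))"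
        using * by (intro C[unfolded cond_C_def mult_F, rule_format]) (simp_all add: K.Tor_iff)
    next
      fix g h and p k :: nat
      assume *: "g \<in> carrier K" "h \<in> carrier K" "prime p" "odd p" "k \<ge> 1" "K.ord g = p ^ k"
        "K.ord h = p ^ k" "K.ord (g \<otimes>\<^bsub>K\<^esub> h) = p ^ k"
      then have "K.ord g > 0" "K.ord h > 0" using prime_gt_0_nat[OF *(3)] by simp_all
      then show "\<mu> (g \<otimes>\<^bsub>K\<^esub> h) = \<mu> g <#>\<^bsub>mult_of L\<^esub> \<mu> h"
        using * D[unfolded cond_D_def mult_F, rule_format, of g h p k] by (simp add: K.Tor_iff)
    next
      fix g h and k :: nat
      assume *: "g \<in> carrier K" "h \<in> carrier K" "k \<ge> 1" "K.ord g = 2 ^ k"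
        "K.ord h = 2 ^ k" "K.ord (g \<otimes>\<^bsub>K\<^esub> h) = 2 ^ k"
      then have "K.ord g > 0" "K.ord h > 0" by simp_all
      then show "\<mu> (g \<otimes>\<^bsub>K\<^esub> h) = \<beta> (g, h) [^]\<^bsub>mult_of L\<^esub> ((2::nat) ^ (k - 1)) <#\<^bsub>mult_of L\<^esub>
          (\<mu> g <#>\<^bsub>mult_of L\<^esub> \<mu> h)"
        using * D[unfolded cond_D_def mult_F, rule_format, of g h 2 k] by (simp add: K.Tor_iff)
    qed
    then show "\<beta> \<in> extensional (carrier K \<times> carrier K) \<and> \<mu> \<in> extensional (Tor K) \<and>
        order_family (mult_of L) K (\<lambda>s t. \<beta> (s, t)) \<mu>"
      using b \<mu> unfolding F_K_def by (auto simp: PiE_def)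
  next
    assume fam: "\<beta> \<in> extensional (carrier K \<times> carrier K) \<and> \<mu> \<in> extensional (Tor K) \<and>
        order_family (mult_of L) K (\<lambda>s t. \<beta> (s, t)) \<mu>"
    then interpret f: order_family "mult_of L" K "\<lambda>s t. \<beta> (s, t)" \<mu> by blast
    show "admissible L K \<beta> \<mu>"
      unfolding admissible_def
    proof (intro conjI)
      show "alternating_bicharacter L K \<beta>" using fam f.alternating_axioms bichar by blast
      show "\<mu> \<in> F_K L K"
        unfolding F_K_def carrier_F using fam f.coset by (simp add: PiE_def Pi_def K.Tor_iff)
      show "cond_A L K \<mu>"
        unfolding cond_A_def quotient_image_def by (intro ballI allI impI f.pow) (auto simp: K.Tor_iff)
      show "cond_B L K \<mu>"
        unfolding cond_B_def mult_F
        by (intro ballI allI impI f.mult_coprime) (auto simp: K.Tor_iff coprime_iff_gcd_eq_1)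
      show "cond_C L K \<mu>"
        unfolding cond_C_def mult_F
      proof (intro ballI allI impI)
        fix g h and p k l :: nat
        assume "g \<in> Tor K" "h \<in> Tor K"
          and *: "prime p \<and> K.ord g = p ^ k \<and> K.ord h = p ^ l \<and> p ^ k > p ^ l"
        then have gh: "g \<in> carrier K" "h \<in> carrier K" by (auto simp: Tor_def)
        have "l < k" using * prime_gt_1_nat by (metis power_strict_increasing_iff)
        then show "\<mu> (g \<otimes>\<^bsub>K\<^esub> h) = \<mu> g <#>\<^bsub>mult_of L\<^esub> powers (mult_of L) (\<mu> h) (p ^ (k - l))"
          using f.mult_prime_power[OF gh] * by blast
      qed
      show "cond_D L K \<beta> \<mu>"
        unfolding cond_D_def mult_F
      proof (intro ballI allI impI conjI)
        fix g h and p k :: nat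
        assume "g \<in> Tor K" "h \<in> Tor K"
          and *: "prime p \<and> k \<ge> 1 \<and> K.ord g = p ^ k \<and> K.ord h = p ^ k \<and> K.ord (g \<otimes>\<^bsub>K\<^esub> h) = p ^ k"
        then have gh: "g \<in> carrier K" "h \<in> carrier K" by (auto simp: Tor_def)
        show "\<mu> (g \<otimes>\<^bsub>K\<^esub> h) = \<mu> g <#>\<^bsub>mult_of L\<^esub> \<mu> h" if "odd p"
          using f.mult_odd[OF gh _ that] * by blast
        show "\<mu> (g \<otimes>\<^bsub>K\<^esub> h) = \<beta> (g, h) [^]\<^bsub>mult_of L\<^esub> ((2::nat) ^ (k - 1)) <#\<^bsub>mult_of L\<^esub>
          (\<mu> g <#>\<^bsub>mult_of L\<^esub> \<mu> h)" if "p = 2"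
          using f.mult_two[OF gh, of k] * that by blast
      qed
    qed
  qed
qed

abbreviation bichar_of ::
  "('l, 'm) ring_scheme \<Rightarrow> ('k, 'n) monoid_scheme \<Rightarrow> ('k \<Rightarrow> 'k \<Rightarrow> 'l) \<Rightarrow> 'k \<times> 'k \<Rightarrow> 'l" where
  "bichar_of L K \<alpha> \<equiv> restrict (commutation (mult_of L) \<alpha>) (carrier K \<times> carrier K)"

abbreviation powers_of ::
  "('l, 'm) ring_scheme \<Rightarrow> ('k, 'n) monoid_scheme \<Rightarrow> ('k \<Rightarrow> 'k \<Rightarrow> 'l) \<Rightarrow> 'k \<Rightarrow> 'l set" where
  "powers_of L K \<alpha> \<equiv> restrict (order_coset (mult_of L) K \<alpha>) (Tor K)"

lemma admissible_cocycle:
  assumes L: "field L" and \<alpha>: "cocycle (mult_of L) K \<alpha>"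
  shows "admissible L K (bichar_of L K \<alpha>)
    (powers_of L K \<alpha>)"
proof -
  interpret cocycle "mult_of L" K \<alpha> by fact
  have "order_family (mult_of L) K
      (\<lambda>s t. bichar_of L K \<alpha> (s, t))
      (powers_of L K \<alpha>)"
    by (rule order_family.order_family_cong[OF order_family_order_coset]) simp_all
  then show ?thesis unfolding admissible_iff[OF L K.comm_group_axioms] by simp
qed

text \<open>The algebra determines the pair: \<beta> by cancelling a nonzero product of basis
  elements, \<mu> because one power of a basis element already fixes the coset. Read from right to
  left this yields existence, from left to right uniqueness of the pair.\<close>

lemma is_D_iff:
  assumes based: "based_graded_algebra L K A D \<alpha> x" and adm: "admissible L K \<beta> \<mu>"
  shows "is_D L K \<beta> \<mu> A D \<longleftrightarrow>
    \<beta> = bichar_of L K \<alpha> \<and>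
    \<mu> = powers_of L K \<alpha>"
proof -
  interpret based_graded_algebra L K A D \<alpha> x by fact
  have K: "comm_group K" by (rule cocycle.K.comm_group_axioms)
  have ext: "\<beta> \<in> extensional (carrier K \<times> carrier K)" "\<mu> \<in> extensional (Tor K)"
    and fam: "order_family (mult_of L) K (\<lambda>s t. \<beta> (s, t)) \<mu>"
    using adm unfolding admissible_iff[OF field_axioms K] by blast+
  interpret f: order_family "mult_of L" K "\<lambda>s t. \<beta> (s, t)" \<mu> by fact
  have nontriv: "\<one>\<^bsub>A\<^esub> \<noteq> \<zero>\<^bsub>A\<^esub>" using basis_nonzero[of "\<one>\<^bsub>K\<^esub>"] basis_one by simp
  show ?thesis
  proof
    assume D: "is_D L K \<beta> \<mu> A D"
    have "\<beta> (s, t) = commutation (mult_of L) \<alpha> (s, t)" if st: "s \<in> carrier K" "t \<in> carrier K" for s t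
    proof -
      let ?y = "x t \<otimes>\<^bsub>A\<^esub> x s"
      have "?y \<in> carrier A" "?y \<noteq> \<zero>\<^bsub>A\<^esub>"
        using st basis_mult[of t s] smult_eq_zeroD[of "\<alpha> t s" "x (t \<otimes>\<^bsub>K\<^esub> s)"] basis_nonzero[of "t \<otimes>\<^bsub>K\<^esub> s"]
          cocycle.closed[of t s] by auto
      moreover have "x s \<otimes>\<^bsub>A\<^esub> x t = \<beta> (s, t) \<odot>\<^bsub>A\<^esub> ?y"
        using D st basis_mem unfolding is_D_def by blast
      moreover have "x s \<otimes>\<^bsub>A\<^esub> x t = commutation (mult_of L) \<alpha> (s, t) \<odot>\<^bsub>A\<^esub> ?y"
        using components_commute st basis_mem by blast
      ultimately show ?thesis
        using smult_right_cancel[of "\<beta> (s, t)" "commutation (mult_of L) \<alpha> (s, t)" ?y]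
          f.closed[OF st] cocycle.commutation_closed[OF st] by simp
    qed
    then have "\<beta> = bichar_of L K \<alpha>"
      by (intro extensionalityI[OF ext(1)]) auto
    moreover have "\<mu> t = order_coset (mult_of L) K \<alpha> t" if t: "t \<in> Tor K" for t
    proof -
      have tK: "t \<in> carrier K" "group.ord K t > 0" using t cocycle.K.Tor_iff by auto
      obtain c where c: "c \<in> carrier L" "c \<in> order_coset (mult_of L) K \<alpha> t"
        "x t [^]\<^bsub>A\<^esub> group.ord K t = c \<odot>\<^bsub>A\<^esub> \<one>\<^bsub>A\<^esub>"
        using component_pow[OF t basis_mem[OF tK(1)] basis_nonzero[OF tK(1)]] by blast
      have \<mu>t: "\<mu> t \<in> cocycle.Pow_cosets (group.ord K t)" by (rule f.coset[OF tK])
      obtain a where a: "a \<in> \<mu> t" "x t [^]\<^bsub>A\<^esub> group.ord K t = a \<odot>\<^bsub>A\<^esub> \<one>\<^bsub>A\<^esub>"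
        using D t basis_mem[OF tK(1)] basis_nonzero[OF tK(1)] unfolding is_D_def by blast
      have "a \<in> carrier L" using cocycle.Pow_cosets_carrier[OF \<mu>t a(1)] by simp
      then have "a = c" using smult_right_cancel[of a c "\<one>\<^bsub>A\<^esub>"] a c nontriv by simp
      then show ?thesis
        using cocycle.Pow_cosets_eqI[OF \<mu>t cocycle.order_coset_Pow[OF tK(1)]] a c by blast
    qed
    then have "\<mu> = powers_of L K \<alpha>"
      by (intro extensionalityI[OF ext(2)]) auto
    ultimately show "\<beta> = bichar_of L K \<alpha> \<and>
        \<mu> = powers_of L K \<alpha>" ..
  next
    assume eq: "\<beta> = bichar_of L K \<alpha> \<and>
        \<mu> = powers_of L K \<alpha>"
    show "is_D L K \<beta> \<mu> A D" unfolding is_D_def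
    proof (intro conjI ballI impI)
      show "graded_division_algebra L K A D" by (rule graded_division_algebra_axioms)
      show "one_dim_components L K A D"
        unfolding one_dim_components_iff[OF graded_algebra_axioms]
        using basis_mem basis_nonzero basis_gen by blast
      show "y \<otimes>\<^bsub>A\<^esub> z = \<beta> (s, t) \<odot>\<^bsub>A\<^esub> (z \<otimes>\<^bsub>A\<^esub> y)"
        if "s \<in> carrier K" "t \<in> carrier K" "y \<in> D s" "z \<in> D t" for s t y z
        using components_commute[OF that] that(1,2) eq by simp
      show "y [^]\<^bsub>A\<^esub> group.ord K t \<in> {a \<odot>\<^bsub>A\<^esub> \<one>\<^bsub>A\<^esub> |a. a \<in> \<mu> t}"
        if t: "t \<in> Tor K" "y \<in> D t" "y \<noteq> \<zero>\<^bsub>A\<^esub>" for t y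
      proof -
        obtain c where "c \<in> order_coset (mult_of L) K \<alpha> t"
          "y [^]\<^bsub>A\<^esub> group.ord K t = c \<odot>\<^bsub>A\<^esub> \<one>\<^bsub>A\<^esub>" using component_pow[OF t] by blast
        then show ?thesis using eq t(1) by auto
      qed
    qed
  qed
qed

lemma exists_based:
  assumes "comm_group K" "graded_division_algebra L K A D" "one_dim_components L K A D"
  obtains \<alpha> x where "based_graded_algebra L K A D \<alpha> x"
proof -
  interpret graded_division_algebra L K A D by fact
  obtain x \<alpha> where "cocycle (mult_of L) K \<alpha>" "homogeneous_basis L K A D x \<alpha>"
    by (rule exists_homogeneous_basis[OF assms(1)
          assms(3)[unfolded one_dim_components_iff[OF graded_algebra_axioms]]])
  then have "based_graded_algebra L K A D \<alpha> x"
    by (intro based_graded_algebra.intro based_graded_algebra_axioms.intro assms(2))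
  then show thesis by (rule that)
qed

text \<open>Changing the homogeneous basis by scalars changes the cocycle by a coboundary, so
  cohomologous cocycles belong to bases of one and the same algebra.\<close>

lemma based_graded_algebra_rescale:
  assumes A: "based_graded_algebra L K A D \<alpha>' x" and \<alpha>: "cocycle (mult_of L) K \<alpha>"
    and l: "\<And>t. t \<in> carrier K \<Longrightarrow> l t \<in> carrier (mult_of L)"
    and cob: "\<And>s t. \<lbrakk>s \<in> carrier K; t \<in> carrier K\<rbrakk> \<Longrightarrow>
      \<alpha>' s t \<otimes>\<^bsub>mult_of L\<^esub> (l s \<otimes>\<^bsub>mult_of L\<^esub> l t) = \<alpha> s t \<otimes>\<^bsub>mult_of L\<^esub> l (s \<otimes>\<^bsub>K\<^esub> t)"
  shows "based_graded_algebra L K A D \<alpha> (\<lambda>t. l t \<odot>\<^bsub>A\<^esub> x t)"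
proof -
  interpret A: based_graded_algebra L K A D \<alpha>' x by fact
  interpret a: cocycle "mult_of L" K \<alpha> by fact
  have l': "l t \<in> carrier L" "l t \<noteq> \<zero>\<^bsub>L\<^esub>" if "t \<in> carrier K" for t using l[OF that] by auto
  have \<alpha>c: "\<alpha> s t \<in> carrier L" if "s \<in> carrier K" "t \<in> carrier K" for s t using a.closed[OF that] by simp
  have "homogeneous_basis L K A D (\<lambda>t. l t \<odot>\<^bsub>A\<^esub> x t) \<alpha>"
    unfolding homogeneous_basis_def
  proof (intro conjI ballI)
    fix t assume t: "t \<in> carrier K"
    show "l t \<odot>\<^bsub>A\<^esub> x t \<in> D t" using A.component_smult[OF t l'(1)[OF t] A.basis_mem[OF t]] .
    show "l t \<odot>\<^bsub>A\<^esub> x t \<noteq> \<zero>\<^bsub>A\<^esub>"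
      using A.smult_eq_zeroD[of "l t" "x t"] A.basis_nonzero[OF t] l'[OF t] t by auto
    show "\<exists>a\<in>carrier L. y = a \<odot>\<^bsub>A\<^esub> (l t \<odot>\<^bsub>A\<^esub> x t)" if y: "y \<in> D t" for y
    proof -
      obtain b where b: "b \<in> carrier L" "y = b \<odot>\<^bsub>A\<^esub> x t" using A.basis_gen[OF t y] by blast
      have u: "l t \<in> Units L" using l'[OF t] A.field_Units by simp
      have "y = (b \<otimes>\<^bsub>L\<^esub> inv\<^bsub>L\<^esub> (l t)) \<odot>\<^bsub>A\<^esub> (l t \<odot>\<^bsub>A\<^esub> x t)"
        using b u t l'[OF t] by (simp add: A.smult_assoc1[symmetric] A.R.m_assoc)
      then show ?thesis using b u by blast
    qed
  next
    \<comment> \<open>Both cocycles are normalized, so the relation at the identity pair makes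
      \<open>l\<close> trivial there and the rescaled basis still contains the unit.\<close>
    have "l \<one>\<^bsub>K\<^esub> \<otimes>\<^bsub>mult_of L\<^esub> l \<one>\<^bsub>K\<^esub> = l \<one>\<^bsub>K\<^esub>"
      using cob[of "\<one>\<^bsub>K\<^esub>" "\<one>\<^bsub>K\<^esub>"] l[of "\<one>\<^bsub>K\<^esub>"] A.cocycle.one_one a.one_one l'[of "\<one>\<^bsub>K\<^esub>"] by simp
    then have "l \<one>\<^bsub>K\<^esub> = \<one>\<^bsub>L\<^esub>" using group.l_cancel_one[OF field.field_mult_group[OF A.field_axioms], of "l \<one>\<^bsub>K\<^esub>" "l \<one>\<^bsub>K\<^esub>"] l[of "\<one>\<^bsub>K\<^esub>"] by simp
    then show "l \<one>\<^bsub>K\<^esub> \<odot>\<^bsub>A\<^esub> x \<one>\<^bsub>K\<^esub> = \<one>\<^bsub>A\<^esub>" by (simp add: A.basis_one)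
    fix s t assume st: "s \<in> carrier K" "t \<in> carrier K"
    have "(l s \<odot>\<^bsub>A\<^esub> x s) \<otimes>\<^bsub>A\<^esub> (l t \<odot>\<^bsub>A\<^esub> x t) =
        (\<alpha>' s t \<otimes>\<^bsub>L\<^esub> (l s \<otimes>\<^bsub>L\<^esub> l t)) \<odot>\<^bsub>A\<^esub> x (s \<otimes>\<^bsub>K\<^esub> t)"
      using st l' by (simp add: A.smult_mult_smult A.basis_mult A.R.m_comm flip: A.smult_assoc1)
    also have "\<dots> = (\<alpha> s t \<otimes>\<^bsub>L\<^esub> l (s \<otimes>\<^bsub>K\<^esub> t)) \<odot>\<^bsub>A\<^esub> x (s \<otimes>\<^bsub>K\<^esub> t)" using cob[OF st] by simp
    also have "\<dots> = \<alpha> s t \<odot>\<^bsub>A\<^esub> (l (s \<otimes>\<^bsub>K\<^esub> t) \<odot>\<^bsub>A\<^esub> x (s \<otimes>\<^bsub>K\<^esub> t))"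
      using st l' \<alpha>c by (simp add: A.smult_assoc1)
    finally show "(l s \<odot>\<^bsub>A\<^esub> x s) \<otimes>\<^bsub>A\<^esub> (l t \<odot>\<^bsub>A\<^esub> x t) =
        \<alpha> s t \<odot>\<^bsub>A\<^esub> (l (s \<otimes>\<^bsub>K\<^esub> t) \<odot>\<^bsub>A\<^esub> x (s \<otimes>\<^bsub>K\<^esub> t))" .
  qed
  then show ?thesis
    by (intro based_graded_algebra.intro based_graded_algebra_axioms.intro \<alpha>
      A.graded_division_algebra_axioms)
qed

lemma is_D_exists:
  fixes L :: "('l, 'm) ring_scheme" and K :: "('k, 'n) monoid_scheme"
  assumes L: "field L" and K: "comm_group K" and fg: "finitely_generated K" and adm: "admissible L K \<beta> \<mu>"
  shows "\<exists>(A :: ('l, 'k \<Rightarrow> 'l) module) D. is_D L K \<beta> \<mu> A D"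
proof -
  have ext: "\<beta> \<in> extensional (carrier K \<times> carrier K)" "\<mu> \<in> extensional (Tor K)"
    and fam: "order_family (mult_of L) K (\<lambda>s t. \<beta> (s, t)) \<mu>"
    using adm unfolding admissible_iff[OF L K] by blast+
  interpret f: order_family "mult_of L" K "\<lambda>s t. \<beta> (s, t)" \<mu> by fact
  obtain \<alpha> where \<alpha>: "cocycle (mult_of L) K \<alpha>"
    "\<And>s t. \<lbrakk>s \<in> carrier K; t \<in> carrier K\<rbrakk> \<Longrightarrow> commutation (mult_of L) \<alpha> (s, t) = \<beta> (s, t)"
    "\<And>t. \<lbrakk>t \<in> carrier K; f.K.ord t > 0\<rbrakk> \<Longrightarrow> order_coset (mult_of L) K \<alpha> t = \<mu> t"
  proof (rule f.exists_cocycle[OF fg])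
    fix \<alpha>
    assume "cocycle (mult_of L) K \<alpha>"
      "\<And>s t. \<lbrakk>s \<in> carrier K; t \<in> carrier K\<rbrakk> \<Longrightarrow> commutation (mult_of L) \<alpha> (s, t) = \<beta> (s, t)"
      "\<And>t. \<lbrakk>t \<in> carrier K; f.K.ord t > 0\<rbrakk> \<Longrightarrow> order_coset (mult_of L) K \<alpha> t = \<mu> t"
    then show thesis by (rule that)
  qed
  have "\<beta> = bichar_of L K \<alpha>"
    by (intro extensionalityI[OF ext(1)]) (auto simp: \<alpha>(2))
  moreover have "\<mu> = powers_of L K \<alpha>"
    by (intro extensionalityI[OF ext(2)]) (auto simp: \<alpha>(3) f.K.Tor_iff)
  moreover have "based_graded_algebra L K (twisted_algebra L K \<alpha>) (twisted_component L) \<alpha>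
      (\<lambda>t. single L t \<one>\<^bsub>L\<^esub>)"
    by (intro twisted_group_algebra.based_graded_algebra_A twisted_group_algebra.intro L \<alpha>(1))
  ultimately have "is_D L K \<beta> \<mu> (twisted_algebra L K \<alpha>) (twisted_component L)"
    using is_D_iff[OF _ adm] by blast
  then show ?thesis by blast
qed

text \<open>After rescaling the basis of \<open>B\<close>, both algebras have the cocycle \<alpha>
  and are compared through its twisted algebra, whose carrier type may differ from both.\<close>

lemma is_D_unique:
  assumes K: "comm_group K" and fg: "finitely_generated K" and adm: "admissible L K \<beta> \<mu>"
    and A: "is_D L K \<beta> \<mu> A D" and B: "is_D L K \<beta> \<mu> B E"
  shows "graded_isomorphic L K A D B E"
proof -
  obtain \<alpha> x where a: "based_graded_algebra L K A D \<alpha> x"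
    using exists_based[OF K] A unfolding is_D_def by blast
  obtain \<alpha>' y where b: "based_graded_algebra L K B E \<alpha>' y"
    using exists_based[OF K] B unfolding is_D_def by blast
  have eqa: "\<beta> = bichar_of L K \<alpha>"
      "\<mu> = powers_of L K \<alpha>"
    using is_D_iff[OF a adm] A by blast+
  have eqb: "\<beta> = bichar_of L K \<alpha>'"
      "\<mu> = powers_of L K \<alpha>'"
    using is_D_iff[OF b adm] B by blast+
  have comm: "commutation (mult_of L) \<alpha> (s, t) = commutation (mult_of L) \<alpha>' (s, t)"
    if "s \<in> carrier K" "t \<in> carrier K" for s t
    using fun_cong[OF trans[OF eqa(1)[symmetric] eqb(1)], of "(s, t)"] that by simp
  have coset: "order_coset (mult_of L) K \<alpha> t = order_coset (mult_of L) K \<alpha>' t" if "t \<in> Tor K" for t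
    using fun_cong[OF trans[OF eqa(2)[symmetric] eqb(2)], of t] that by simp
  have \<alpha>: "cocycle (mult_of L) K \<alpha>" and \<alpha>': "cocycle (mult_of L) K \<alpha>'"
    using a b by (simp_all add: based_graded_algebra_def)
  have gA: "graded_algebra L K A D"
    using a by (simp add: based_graded_algebra_def graded_division_algebra_def)
  obtain l where l: "\<And>t. t \<in> carrier K \<Longrightarrow> l t \<in> carrier (mult_of L)"
    "\<And>s t. \<lbrakk>s \<in> carrier K; t \<in> carrier K\<rbrakk> \<Longrightarrow>
      \<alpha>' s t \<otimes>\<^bsub>mult_of L\<^esub> (l s \<otimes>\<^bsub>mult_of L\<^esub> l t) = \<alpha> s t \<otimes>\<^bsub>mult_of L\<^esub> l (s \<otimes>\<^bsub>K\<^esub> t)"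
  proof (rule cocycle_cohomologous[OF \<alpha> \<alpha>' fg comm coset])
    fix l
    assume "\<And>t. t \<in> carrier K \<Longrightarrow> l t \<in> carrier (mult_of L)"
      "\<And>s t. \<lbrakk>s \<in> carrier K; t \<in> carrier K\<rbrakk> \<Longrightarrow>
        \<alpha>' s t \<otimes>\<^bsub>mult_of L\<^esub> (l s \<otimes>\<^bsub>mult_of L\<^esub> l t) = \<alpha> s t \<otimes>\<^bsub>mult_of L\<^esub> l (s \<otimes>\<^bsub>K\<^esub> t)"
    then show thesis by (rule that)
  qed
  have b': "based_graded_algebra L K B E \<alpha> (\<lambda>t. l t \<odot>\<^bsub>B\<^esub> y t)"
    by (rule based_graded_algebra_rescale[OF b \<alpha> l])
  have gT: "graded_algebra L K (twisted_algebra L K \<alpha>) (twisted_component L)"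
  proof -
    interpret a: based_graded_algebra L K A D \<alpha> x by fact
    show ?thesis
      using twisted_group_algebra.graded_division_algebra_A[OF twisted_group_algebra.intro[OF a.field_axioms \<alpha>]]
      by (simp add: graded_division_algebra_def)
  qed
  have "graded_isomorphic L K A D (twisted_algebra L K \<alpha>) (twisted_component L)"
    by (rule graded_isomorphic_sym[OF gT twisted_algebra_graded_isomorphic[OF a]])
  then show ?thesis
    using graded_isomorphic_trans twisted_algebra_graded_isomorphic[OF b'] by blast
qed

text \<open>Existence has to name a carrier type, and functions from \<open>K\<close> to
  \<open>L\<close> always suffice; the algebras compared or classified may live in any type. That
  only one of the algebras fits is expressed by uniqueness of the pair of \<beta> and \<mu>.\<close>

theorem theorem3p5:
  fixes L :: "('l, 'm) ring_scheme" and K :: "('k, 'n) monoid_scheme"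
  assumes "field L" and "comm_group K" and "finitely_generated K"
  shows
    "(\<forall>\<beta> \<mu>. admissible L K \<beta> \<mu> \<longrightarrow>
        (\<exists>(A :: ('l, 'k \<Rightarrow> 'l) module) D. is_D L K \<beta> \<mu> A D) \<and>
        (\<forall>(A :: ('l, 'a) module) D (B :: ('l, 'b) module) E.
           is_D L K \<beta> \<mu> A D \<and> is_D L K \<beta> \<mu> B E \<longrightarrow> graded_isomorphic L K A D B E)) \<and>
     (\<forall>(C :: ('l, 'c) module) G.
        graded_division_algebra L K C G \<and> one_dim_components L K C G \<longrightarrow>
        (\<exists>!\<beta>\<mu>. case \<beta>\<mu> of (\<beta>, \<mu>) \<Rightarrow> admissible L K \<beta> \<mu> \<and>
           (\<exists>(A :: ('l, 'k \<Rightarrow> 'l) module) D.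
              is_D L K \<beta> \<mu> A D \<and> graded_isomorphic L K C G A D)))"
proof (intro conjI allI impI; (elim conjE)?)
  fix \<beta> \<mu> assume adm: "admissible L K \<beta> \<mu>"
  show "\<exists>(A :: ('l, 'k \<Rightarrow> 'l) module) D. is_D L K \<beta> \<mu> A D"
    by (rule is_D_exists[OF assms adm])
  show "graded_isomorphic L K A D B E" if "is_D L K \<beta> \<mu> A D" "is_D L K \<beta> \<mu> B E"
    for A :: "('l, 'a) module" and D and B :: "('l, 'b) module" and E
    by (rule is_D_unique[OF assms(2,3) adm that])
next
  fix C :: "('l, 'c) module" and G
  assume C: "graded_division_algebra L K C G" "one_dim_components L K C G"
  obtain \<alpha> x where c: "based_graded_algebra L K C G \<alpha> x" using exists_based[OF assms(2) C] .
  let ?\<beta> = "bichar_of L K \<alpha>"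
  let ?\<mu> = "powers_of L K \<alpha>"
  let ?A = "twisted_algebra L K \<alpha>" and ?D = "twisted_component L"
  have \<alpha>: "cocycle (mult_of L) K \<alpha>" using c by (simp add: based_graded_algebra_def)
  have twg: "twisted_group_algebra L K \<alpha>" by (intro twisted_group_algebra.intro assms(1) \<alpha>)
  have adm: "admissible L K ?\<beta> ?\<mu>" by (rule admissible_cocycle[OF assms(1) \<alpha>])
  have "is_D L K ?\<beta> ?\<mu> ?A ?D"
    using is_D_iff[OF twisted_group_algebra.based_graded_algebra_A[OF twg] adm] by blast
  moreover have "graded_algebra L K ?A ?D"
    using twisted_group_algebra.graded_division_algebra_A[OF twg]
    by (simp add: graded_division_algebra_def)
  then have "graded_isomorphic L K C G ?A ?D"
    by (rule graded_isomorphic_sym[OF _ twisted_algebra_graded_isomorphic[OF c]])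
  ultimately have ex: "\<exists>(A :: ('l, 'k \<Rightarrow> 'l) module) D.
      is_D L K ?\<beta> ?\<mu> A D \<and> graded_isomorphic L K C G A D" by blast
  have uniq: "\<beta> = ?\<beta> \<and> \<mu> = ?\<mu>"
    if adm': "admissible L K \<beta> \<mu>" and D: "is_D L K \<beta> \<mu> A D" and iso: "graded_isomorphic L K C G A D"
    for \<beta> \<mu> and A :: "('l, 'k \<Rightarrow> 'l) module" and D
  proof -
    have "graded_division_algebra L K A D" using D by (simp add: is_D_def)
    \<comment> \<open>The cocycle of \<open>C\<close> is also a cocycle of \<open>A\<close>, so both
      candidate pairs are computed from the same \<alpha>.\<close>
    then obtain y where "based_graded_algebra L K A D \<alpha> y"
      by (rule based_graded_algebra_transfer[OF c _ iso])
    then show ?thesis using is_D_iff[OF _ adm'] D by blast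
  qed
  show "\<exists>!\<beta>\<mu>. case \<beta>\<mu> of (\<beta>, \<mu>) \<Rightarrow> admissible L K \<beta> \<mu> \<and>
           (\<exists>(A :: ('l, 'k \<Rightarrow> 'l) module) D. is_D L K \<beta> \<mu> A D \<and> graded_isomorphic L K C G A D)"
  proof (rule ex1I[of _ "(?\<beta>, ?\<mu>)"])
    show "case (?\<beta>, ?\<mu>) of (\<beta>, \<mu>) \<Rightarrow> admissible L K \<beta> \<mu> \<and>
       (\<exists>(A :: ('l, 'k \<Rightarrow> 'l) module) D. is_D L K \<beta> \<mu> A D \<and> graded_isomorphic L K C G A D)"
      using adm ex by simp
    fix \<beta>\<mu> :: "('k \<times> 'k \<Rightarrow> 'l) \<times> ('k \<Rightarrow> 'l set)"
    assume "case \<beta>\<mu> of (\<beta>, \<mu>) \<Rightarrow> admissible L K \<beta> \<mu> \<and>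
       (\<exists>(A :: ('l, 'k \<Rightarrow> 'l) module) D. is_D L K \<beta> \<mu> A D \<and> graded_isomorphic L K C G A D)"
    then show "\<beta>\<mu> = (?\<beta>, ?\<mu>)" using uniq by (cases \<beta>\<mu>) auto
  qed
qed

end
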